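(* Let $C$ be a strict 2-groupoid, $Z:P_2(\mathbb{R}^2)\to C$ a strict 2-functor (an extended FQFT on 2-dimensional Minkowski space), and $G$ a group acting on $\mathbb{R}^2$ by diffeomorphisms respecting causal subsets (in the sense of the context). Then every $G$-equivariant structure on the FQFT $Z$ induces a $G$-equivariant structure on the AQFT $\mathcal{A}_Z$ obtained from $Z$.
   Context: **Causal subsets.** $\mathbb{R}^2$ carries the standard Minkowski metric, with coordinates $(x,t)$, $x$ pointing to the right and $t$ to the future; the lightlike directions are $\pm(1,1)$ and $\pm(1,-1)$. A causal subset is the (non-empty) interior of the intersection of the future of one point with the past of another: an open rectangle all of whose sides are lightlike. It has a left corner, a right corner, a bottom (past) vertex and a top (future) vertex. $S(\mathbb{R}^2)$ is the category (poset) whose objects are causal subsets and whose morphisms are inclusions. **The 2-category $P_2(\mathbb{R}^2)$.** It is the strict 2-category whose objects are the points of $\mathbb{R}^2$, whose 1-morphisms are piecewise lightlike right-moving paths (composition is concatenation), and whose 2-morphisms are generated, under gluing along pieces of joint boundary, from the closures of causal subsets; the closure of a causal subset with left corner $p$ and right corner $q$ is regarded as a 2-morphism from its future boundary path $p\to q$ to its past boundary path $p\to q$. Thus 2-morphisms are the regions so obtained by gluing (identities being the degenerate regions), and composition is by gluing regions. **Notation.** A strict 2-groupoid is a strict 2-category in which all 1-morphisms and 2-morphisms are invertible. In $C$, $\circ$ denotes vertical composition of 2-morphisms and $\cdot$ horizontal composition, written in the same (functional) order as composition of 1-morphisms $h\cdot k$ ("first $k$, then $h$"). Whiskering means horizontal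 composition with identity 2-morphisms. $\mathrm{End}_C(h)$ is the monoid of 2-morphisms $h\Rightarrow h$ under vertical composition. **Definition of $\mathcal{A}_Z$.** $\mathcal{A}_Z: S(\mathbb{R}^2)\to\mathrm{Monoids}$ is the following functor. For a causal subset $O$ with left corner $p$, right corner $q$ and bottom vertex $m$, put $\mathcal{A}_Z(O):=\mathrm{End}_C(Z(p\to m\to q))$. For an inclusion $O'\subset O$, where $O'$ has left corner $p'$, right corner $q'$ and bottom vertex $m'$, let $u$ be the point on the segment $p\to m$ such that $u\to p'$ is a (possibly degenerate) lightlike segment in direction $(1,1)$, and let $v$ be the point on the segment $m\to q$ such that $q'\to v$ is a (possibly degenerate) lightlike segment in direction $(1,-1)$. Let $f$ be the 2-morphism in $P_2(\mathbb{R}^2)$ from $u\to p'\to m'\to q'\to v$ to $u\to m\to v$ given by the region between these two paths, and let $f'$ be the whiskering of $f$ by $p\to u$ and $v\to q$. For $a\in \mathrm{End}_C(Z(p'\to m'\to q'))$ let $a'$ be the whiskering of $a$ by $Z(p\to u\to p')$ and $Z(q'\to v\to q)$. Then $\mathcal{A}_Z(O'\subset O)$ is the map $a\mapsto Z(f')\circ a'\circ Z(f')^{-1}$. **Group actions.** $G$ acts by diffeomorphisms of $\mathbb{R}^2$ such that each $g\in G$ induces a functor $g:S(\mathbb{R}^2)\to S(\mathbb{R}^2)$ and a 2-functor $g:P_2(\mathbb{R}^2)\to P_2(\mathbb{R}^2)$. The convention for products is $(g_1g_2)(x)=g_2(g_1(x))$. Write $g^*Z:=Z\circ g$ and $g^*\mathcal{A}:=\mathcal{A}\circ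 g$, so $g_1^*g_2^*=(g_1g_2)^*$. **Equivariant structure on a 2-functor.** A $G$-equivariant structure on $Z$ is a choice, for all $g\in G$, of isomorphisms $f_g:Z\to g^*Z$ of 2-functors (strictly invertible pseudonatural transformations) and, for all $g_1,g_2\in G$, of invertible modifications $$F_{g_1,g_2}: (g_1^*f_{g_2})\cdot f_{g_1}\Rightarrow f_{g_1g_2}$$ such that for all $g_1,g_2,g_3\in G$, as modifications $((g_1g_2)^*f_{g_3})\cdot (g_1^*f_{g_2})\cdot f_{g_1}\Rightarrow f_{g_1g_2g_3}$, $$F_{g_1g_2,g_3}\circ\bigl((g_1g_2)^*f_{g_3}\cdot F_{g_1,g_2}\bigr)=F_{g_1,g_2g_3}\circ\bigl(g_1^*F_{g_2,g_3}\cdot f_{g_1}\bigr).$$ **Equivariant structure on a net.** A $G$-equivariant structure on a net $\mathcal{A}:S(\mathbb{R}^2)\to\mathrm{Monoids}$ is a choice of isomorphisms (natural isomorphisms of functors) $r_g:\mathcal{A}\to g^*\mathcal{A}$ for all $g\in G$ such that $(g_1^*r_{g_2})\circ r_{g_1}=r_{g_1g_2}$ for all $g_1,g_2\in G$. *)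

theory Defs
  imports "HOL-Analysis.Analysis" "HOL-Algebra.Group"
begin

section \<open>Strict 2-categories\<close>

text \<open>
  Both compositions of 2-cells and the composition of 1-cells are written in functional order:
  in \<open>h \<cdot> k\<close>, \<open>a \<circ>\<^sub>v b\<close> and \<open>a \<circ>\<^sub>h b\<close> the right-hand factor comes first.
  Operations are only constrained on composable arguments.
\<close>

record ('o, 'm, 'c) two_category =
  Obj :: "'o set"
  Arr :: "'m set"
  Cell :: "'c set"
  src1 :: "'m \<Rightarrow> 'o"
  tgt1 :: "'m \<Rightarrow> 'o"
  src2 :: "'c \<Rightarrow> 'm"
  tgt2 :: "'c \<Rightarrow> 'm"
  id1 :: "'o \<Rightarrow> 'm"
  id2 :: "'m \<Rightarrow> 'c"
  comp1 :: "'m \<Rightarrow> 'm \<Rightarrow> 'm" (infixr "\<cdot>\<index>" 70)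
  vcomp :: "'c \<Rightarrow> 'c \<Rightarrow> 'c" (infixr "\<circ>\<^sub>v\<index>" 65)
  hcomp :: "'c \<Rightarrow> 'c \<Rightarrow> 'c" (infixr "\<circ>\<^sub>h\<index>" 70)

locale strict_2category =
  fixes C :: "('o, 'm, 'c) two_category" (structure)
  assumes arr_obj: "h \<in> Arr C \<Longrightarrow> src1 C h \<in> Obj C \<and> tgt1 C h \<in> Obj C"
    and cell_arr: "a \<in> Cell C \<Longrightarrow> src2 C a \<in> Arr C \<and> tgt2 C a \<in> Arr C"
    and cell_globular: "a \<in> Cell C \<Longrightarrow>
      src1 C (src2 C a) = src1 C (tgt2 C a) \<and> tgt1 C (src2 C a) = tgt1 C (tgt2 C a)"
    and id1_arr: "x \<in> Obj C \<Longrightarrow> id1 C x \<in> Arr C \<and> src1 C (id1 C x) = x \<and> tgt1 C (id1 C x) = x"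
    and id2_cell: "h \<in> Arr C \<Longrightarrow> id2 C h \<in> Cell C \<and> src2 C (id2 C h) = h \<and> tgt2 C (id2 C h) = h"
    and comp1_arr: "\<lbrakk>h \<in> Arr C; k \<in> Arr C; src1 C h = tgt1 C k\<rbrakk> \<Longrightarrow>
      h \<cdot> k \<in> Arr C \<and> src1 C (h \<cdot> k) = src1 C k \<and> tgt1 C (h \<cdot> k) = tgt1 C h"
    and comp1_assoc: "\<lbrakk>h \<in> Arr C; k \<in> Arr C; l \<in> Arr C; src1 C h = tgt1 C k; src1 C k = tgt1 C l\<rbrakk> \<Longrightarrow>
      (h \<cdot> k) \<cdot> l = h \<cdot> (k \<cdot> l)"
    and comp1_unit: "h \<in> Arr C \<Longrightarrow> h \<cdot> id1 C (src1 C h) = h \<and> id1 C (tgt1 C h) \<cdot> h = h"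
    and vcomp_cell: "\<lbrakk>a \<in> Cell C; b \<in> Cell C; src2 C a = tgt2 C b\<rbrakk> \<Longrightarrow>
      a \<circ>\<^sub>v b \<in> Cell C \<and> src2 C (a \<circ>\<^sub>v b) = src2 C b \<and> tgt2 C (a \<circ>\<^sub>v b) = tgt2 C a"
    and vcomp_assoc: "\<lbrakk>a \<in> Cell C; b \<in> Cell C; c \<in> Cell C; src2 C a = tgt2 C b; src2 C b = tgt2 C c\<rbrakk> \<Longrightarrow>
      (a \<circ>\<^sub>v b) \<circ>\<^sub>v c = a \<circ>\<^sub>v (b \<circ>\<^sub>v c)"
    and vcomp_unit: "a \<in> Cell C \<Longrightarrow> a \<circ>\<^sub>v id2 C (src2 C a) = a \<and> id2 C (tgt2 C a) \<circ>\<^sub>v a = a"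
    and hcomp_cell: "\<lbrakk>a \<in> Cell C; b \<in> Cell C; src1 C (src2 C a) = tgt1 C (src2 C b)\<rbrakk> \<Longrightarrow>
      a \<circ>\<^sub>h b \<in> Cell C \<and> src2 C (a \<circ>\<^sub>h b) = src2 C a \<cdot> src2 C b \<and> tgt2 C (a \<circ>\<^sub>h b) = tgt2 C a \<cdot> tgt2 C b"
    and hcomp_assoc: "\<lbrakk>a \<in> Cell C; b \<in> Cell C; c \<in> Cell C;
        src1 C (src2 C a) = tgt1 C (src2 C b); src1 C (src2 C b) = tgt1 C (src2 C c)\<rbrakk> \<Longrightarrow>
      (a \<circ>\<^sub>h b) \<circ>\<^sub>h c = a \<circ>\<^sub>h (b \<circ>\<^sub>h c)"
    and hcomp_unit: "a \<in> Cell C \<Longrightarrow>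
      a \<circ>\<^sub>h id2 C (id1 C (src1 C (src2 C a))) = a \<and> id2 C (id1 C (tgt1 C (src2 C a))) \<circ>\<^sub>h a = a"
    and hcomp_id2: "\<lbrakk>h \<in> Arr C; k \<in> Arr C; src1 C h = tgt1 C k\<rbrakk> \<Longrightarrow>
      id2 C h \<circ>\<^sub>h id2 C k = id2 C (h \<cdot> k)"
    and interchange: "\<lbrakk>a \<in> Cell C; a' \<in> Cell C; b \<in> Cell C; b' \<in> Cell C;
        src2 C a' = tgt2 C a; src2 C b' = tgt2 C b; src1 C (src2 C a) = tgt1 C (src2 C b)\<rbrakk> \<Longrightarrow>
      (a' \<circ>\<^sub>v a) \<circ>\<^sub>h (b' \<circ>\<^sub>v b) = (a' \<circ>\<^sub>h b') \<circ>\<^sub>v (a \<circ>\<^sub>h b)"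

definition inverse1 :: "('o, 'm, 'c) two_category \<Rightarrow> 'm \<Rightarrow> 'm \<Rightarrow> bool" where
  "inverse1 C h k \<longleftrightarrow> k \<in> Arr C \<and> src1 C k = tgt1 C h \<and> tgt1 C k = src1 C h \<and>
     k \<cdot>\<^bsub>C\<^esub> h = id1 C (src1 C h) \<and> h \<cdot>\<^bsub>C\<^esub> k = id1 C (tgt1 C h)"

definition inverse2 :: "('o, 'm, 'c) two_category \<Rightarrow> 'c \<Rightarrow> 'c \<Rightarrow> bool" where
  "inverse2 C a b \<longleftrightarrow> b \<in> Cell C \<and> src2 C b = tgt2 C a \<and> tgt2 C b = src2 C a \<and>
     b \<circ>\<^sub>v\<^bsub>C\<^esub> a = id2 C (src2 C a) \<and> a \<circ>\<^sub>v\<^bsub>C\<^esub> b = id2 C (tgt2 C a)"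

definition inv1 :: "('o, 'm, 'c) two_category \<Rightarrow> 'm \<Rightarrow> 'm" where
  "inv1 C h = (THE k. inverse1 C h k)"

definition inv2 :: "('o, 'm, 'c) two_category \<Rightarrow> 'c \<Rightarrow> 'c" where
  "inv2 C a = (THE b. inverse2 C a b)"

locale strict_2groupoid = strict_2category +
  assumes arr_invertible: "h \<in> Arr C \<Longrightarrow> \<exists>k. inverse1 C h k"
    and cell_invertible: "a \<in> Cell C \<Longrightarrow> \<exists>b. inverse2 C a b"

text \<open>Horizontal composition with identity 2-cells on both sides.\<close>

definition whisker :: "('o, 'm, 'c) two_category \<Rightarrow> 'm \<Rightarrow> 'c \<Rightarrow> 'm \<Rightarrow> 'c" where
  "whisker C h a k = id2 C h \<circ>\<^sub>h\<^bsub>C\<^esub> a \<circ>\<^sub>h\<^bsub>C\<^esub> id2 C k"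

definition End :: "('o, 'm, 'c) two_category \<Rightarrow> 'm \<Rightarrow> 'c monoid" where
  "End C h = \<lparr>carrier = {a \<in> Cell C. src2 C a = h \<and> tgt2 C a = h}, mult = vcomp C, one = id2 C h\<rparr>"


section \<open>Strict 2-functors, pseudonatural transformations, modifications\<close>

record ('o, 'm, 'c, 'p, 'n, 'd) two_functor =
  on_obj :: "'o \<Rightarrow> 'p"
  on_arr :: "'m \<Rightarrow> 'n"
  on_cell :: "'c \<Rightarrow> 'd"

locale strict_2functor = A: strict_2category A + B: strict_2category B
  for A :: "('o, 'm, 'c) two_category" and B :: "('p, 'n, 'd) two_category" +
  fixes F :: "('o, 'm, 'c, 'p, 'n, 'd) two_functor"
  assumes map_obj: "x \<in> Obj A \<Longrightarrow> on_obj F x \<in> Obj B"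
    and map_arr: "h \<in> Arr A \<Longrightarrow> on_arr F h \<in> Arr B \<and>
      src1 B (on_arr F h) = on_obj F (src1 A h) \<and> tgt1 B (on_arr F h) = on_obj F (tgt1 A h)"
    and map_cell: "a \<in> Cell A \<Longrightarrow> on_cell F a \<in> Cell B \<and>
      src2 B (on_cell F a) = on_arr F (src2 A a) \<and> tgt2 B (on_cell F a) = on_arr F (tgt2 A a)"
    and map_id1: "x \<in> Obj A \<Longrightarrow> on_arr F (id1 A x) = id1 B (on_obj F x)"
    and map_id2: "h \<in> Arr A \<Longrightarrow> on_cell F (id2 A h) = id2 B (on_arr F h)"
    and map_comp1: "\<lbrakk>h \<in> Arr A; k \<in> Arr A; src1 A h = tgt1 A k\<rbrakk> \<Longrightarrow>
      on_arr F (h \<cdot>\<^bsub>A\<^esub> k) = on_arr F h \<cdot>\<^bsub>B\<^esub> on_arr F k"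
    and map_vcomp: "\<lbrakk>a \<in> Cell A; b \<in> Cell A; src2 A a = tgt2 A b\<rbrakk> \<Longrightarrow>
      on_cell F (a \<circ>\<^sub>v\<^bsub>A\<^esub> b) = on_cell F a \<circ>\<^sub>v\<^bsub>B\<^esub> on_cell F b"
    and map_hcomp: "\<lbrakk>a \<in> Cell A; b \<in> Cell A; src1 A (src2 A a) = tgt1 A (src2 A b)\<rbrakk> \<Longrightarrow>
      on_cell F (a \<circ>\<^sub>h\<^bsub>A\<^esub> b) = on_cell F a \<circ>\<^sub>h\<^bsub>B\<^esub> on_cell F b"

definition functor_comp ::
  "('p, 'n, 'd, 'q, 'l, 'e) two_functor \<Rightarrow> ('o, 'm, 'c, 'p, 'n, 'd) two_functor \<Rightarrow>
   ('o, 'm, 'c, 'q, 'l, 'e) two_functor" where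
  "functor_comp F E = \<lparr>on_obj = on_obj F \<circ> on_obj E, on_arr = on_arr F \<circ> on_arr E,
     on_cell = on_cell F \<circ> on_cell E\<rparr>"

record ('o, 'm, 'n, 'd) transformation =
  t_obj :: "'o \<Rightarrow> 'n"
  t_arr :: "'m \<Rightarrow> 'd"

text \<open>
  For \<open>h : x \<rightarrow> y\<close> the component \<open>t_arr t h\<close> fills the naturality square in the direction
  \<open>t y \<cdot> F h \<Rightarrow> G h \<cdot> t x\<close>.
\<close>

locale pseudonatural = F: strict_2functor A B F + G: strict_2functor A B G
  for A :: "('o, 'm, 'c) two_category" and B :: "('p, 'n, 'd) two_category" and F G +
  fixes t :: "('o, 'm, 'n, 'd) transformation"
  assumes comp_obj: "x \<in> Obj A \<Longrightarrow> t_obj t x \<in> Arr B \<and>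
      src1 B (t_obj t x) = on_obj F x \<and> tgt1 B (t_obj t x) = on_obj G x"
    and comp_arr: "h \<in> Arr A \<Longrightarrow> t_arr t h \<in> Cell B \<and>
      src2 B (t_arr t h) = t_obj t (tgt1 A h) \<cdot>\<^bsub>B\<^esub> on_arr F h \<and>
      tgt2 B (t_arr t h) = on_arr G h \<cdot>\<^bsub>B\<^esub> t_obj t (src1 A h)"
    and comp_invertible: "h \<in> Arr A \<Longrightarrow> \<exists>b. inverse2 B (t_arr t h) b"
    and comp_id1: "x \<in> Obj A \<Longrightarrow> t_arr t (id1 A x) = id2 B (t_obj t x)"
    and comp_comp1: "\<lbrakk>h \<in> Arr A; k \<in> Arr A; src1 A h = tgt1 A k\<rbrakk> \<Longrightarrow>
      t_arr t (h \<cdot>\<^bsub>A\<^esub> k) =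
        (id2 B (on_arr G h) \<circ>\<^sub>h\<^bsub>B\<^esub> t_arr t k) \<circ>\<^sub>v\<^bsub>B\<^esub> (t_arr t h \<circ>\<^sub>h\<^bsub>B\<^esub> id2 B (on_arr F k))"
    and natural: "a \<in> Cell A \<Longrightarrow>
      t_arr t (tgt2 A a) \<circ>\<^sub>v\<^bsub>B\<^esub> (id2 B (t_obj t (tgt1 A (src2 A a))) \<circ>\<^sub>h\<^bsub>B\<^esub> on_cell F a) =
      (on_cell G a \<circ>\<^sub>h\<^bsub>B\<^esub> id2 B (t_obj t (src1 A (src2 A a)))) \<circ>\<^sub>v\<^bsub>B\<^esub> t_arr t (src2 A a)"

definition trans_id ::
  "('p, 'n, 'd) two_category \<Rightarrow> ('o, 'm, 'c, 'p, 'n, 'd) two_functor \<Rightarrow>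
   ('o, 'm, 'n, 'd) transformation" where
  "trans_id B F = \<lparr>t_obj = (\<lambda>x. id1 B (on_obj F x)), t_arr = (\<lambda>h. id2 B (on_arr F h))\<rparr>"

definition trans_comp ::
  "('o, 'm, 'c) two_category \<Rightarrow> ('p, 'n, 'd) two_category \<Rightarrow>
   ('o, 'm, 'n, 'd) transformation \<Rightarrow> ('o, 'm, 'n, 'd) transformation \<Rightarrow>
   ('o, 'm, 'n, 'd) transformation" where
  "trans_comp A B s t =
    \<lparr>t_obj = (\<lambda>x. t_obj s x \<cdot>\<^bsub>B\<^esub> t_obj t x),
     t_arr = (\<lambda>h. (t_arr s h \<circ>\<^sub>h\<^bsub>B\<^esub> id2 B (t_obj t (src1 A h))) \<circ>\<^sub>v\<^bsub>B\<^esub>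
                  (id2 B (t_obj s (tgt1 A h)) \<circ>\<^sub>h\<^bsub>B\<^esub> t_arr t h))\<rparr>"

definition trans_agree ::
  "('o, 'm, 'c) two_category \<Rightarrow> ('o, 'm, 'n, 'd) transformation \<Rightarrow>
   ('o, 'm, 'n, 'd) transformation \<Rightarrow> bool" where
  "trans_agree A s t \<longleftrightarrow>
    (\<forall>x \<in> Obj A. t_obj s x = t_obj t x) \<and> (\<forall>h \<in> Arr A. t_arr s h = t_arr t h)"

definition trans_pullback ::
  "('o, 'm, 'c, 'p, 'n, 'd) two_functor \<Rightarrow> ('p, 'n, 'l, 'e) transformation \<Rightarrow>
   ('o, 'm, 'l, 'e) transformation" where
  "trans_pullback E t = \<lparr>t_obj = t_obj t \<circ> on_obj E, t_arr = t_arr t \<circ> on_arr E\<rparr>"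

locale functor_isomorphism = pseudonatural +
  assumes strictly_invertible: "\<exists>s. pseudonatural A B G F s \<and>
    trans_agree A (trans_comp A B s t) (trans_id B F) \<and>
    trans_agree A (trans_comp A B t s) (trans_id B G)"

locale modification = s: pseudonatural A B F G s + t: pseudonatural A B F G t
  for A :: "('o, 'm, 'c) two_category" and B :: "('p, 'n, 'd) two_category" and F G s t +
  fixes M :: "'o \<Rightarrow> 'd"
  assumes component: "x \<in> Obj A \<Longrightarrow> M x \<in> Cell B \<and>
      src2 B (M x) = t_obj s x \<and> tgt2 B (M x) = t_obj t x"
    and compatible: "h \<in> Arr A \<Longrightarrow>
      (id2 B (on_arr G h) \<circ>\<^sub>h\<^bsub>B\<^esub> M (src1 A h)) \<circ>\<^sub>v\<^bsub>B\<^esub> t_arr s h =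
      t_arr t h \<circ>\<^sub>v\<^bsub>B\<^esub> (M (tgt1 A h) \<circ>\<^sub>h\<^bsub>B\<^esub> id2 B (on_arr F h))"

locale invertible_modification = modification +
  assumes invertible: "\<exists>N. modification A B F G t s N \<and> (\<forall>x \<in> Obj A. inverse2 B (M x) (N x))"


section \<open>Two-dimensional Minkowski space\<close>

text \<open>Points are pairs \<open>(x, t)\<close> of a space and a time coordinate.\<close>

type_synonym point = "real \<times> real"

definition causal_future :: "point \<Rightarrow> point set" where
  "causal_future p = {q. \<bar>fst q - fst p\<bar> \<le> snd q - snd p}"

definition causal_past :: "point \<Rightarrow> point set" where
  "causal_past p = {q. p \<in> causal_future q}"

definition causal_subset :: "point set \<Rightarrow> bool" where
  "causal_subset U \<longleftrightarrow> U \<noteq> {} \<and> (\<exists>m n. U = interior (causal_future m \<inter> causal_past n))"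

definition left_corner :: "point set \<Rightarrow> point" where
  "left_corner U = (THE p. p \<in> closure U \<and> (\<forall>z \<in> closure U. fst p \<le> fst z))"

definition right_corner :: "point set \<Rightarrow> point" where
  "right_corner U = (THE q. q \<in> closure U \<and> (\<forall>z \<in> closure U. fst z \<le> fst q))"

definition bottom_vertex :: "point set \<Rightarrow> point" where
  "bottom_vertex U = (THE m. m \<in> closure U \<and> (\<forall>z \<in> closure U. snd m \<le> snd z))"

definition top_vertex :: "point set \<Rightarrow> point" where
  "top_vertex U = (THE n. n \<in> closure U \<and> (\<forall>z \<in> closure U. snd z \<le> snd n))"


section \<open>The 2-category of paths and regions\<close>

text \<open>
  A piecewise lightlike right-moving path is the graph of a function of the space coordinate, so up
  to reparametrisation it is determined by the set of its points, and concatenation is union.  A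
  1-morphism records start point, point set and end point; a 2-morphism records its source path (the
  future boundary), the closed region, and its target path (the past boundary).
\<close>

type_synonym path = "point \<times> point set \<times> point"
type_synonym region = "path \<times> point set \<times> path"

definition lightlike_right :: "point \<Rightarrow> point \<Rightarrow> bool" where
  "lightlike_right p q \<longleftrightarrow> (\<exists>s \<ge> 0. q = p + s *\<^sub>R (1, 1) \<or> q = p + s *\<^sub>R (1, -1))"

definition const_path :: "point \<Rightarrow> path" where
  "const_path p = (p, {p}, p)"

definition seg :: "point \<Rightarrow> point \<Rightarrow> path" where
  "seg p q = (p, closed_segment p q, q)"

text \<open>\<open>concat_path \<delta> \<gamma>\<close> is ``first \<open>\<gamma>\<close>, then \<open>\<delta>\<close>''.\<close>

definition concat_path :: "path \<Rightarrow> path \<Rightarrow> path" where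
  "concat_path \<delta> \<gamma> = (fst \<gamma>, fst (snd \<gamma>) \<union> fst (snd \<delta>), snd (snd \<delta>))"

inductive_set paths :: "path set" where
  const: "const_path p \<in> paths"
| step: "\<lbrakk>\<gamma> \<in> paths; snd (snd \<gamma>) = q; lightlike_right q r\<rbrakk> \<Longrightarrow> concat_path (seg q r) \<gamma> \<in> paths"

fun polygon :: "point list \<Rightarrow> path" where
  "polygon [] = undefined"
| "polygon [p] = const_path p"
| "polygon (p # q # ps) = concat_path (polygon (q # ps)) (seg p q)"

definition future_boundary :: "point set \<Rightarrow> path" where
  "future_boundary U = polygon [left_corner U, top_vertex U, right_corner U]"

definition past_boundary :: "point set \<Rightarrow> path" where
  "past_boundary U = polygon [left_corner U, bottom_vertex U, right_corner U]"

definition id_region :: "path \<Rightarrow> region" where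
  "id_region \<gamma> = (\<gamma>, fst (snd \<gamma>), \<gamma>)"

definition vglue :: "region \<Rightarrow> region \<Rightarrow> region" where
  "vglue S R = (fst R, fst (snd R) \<union> fst (snd S), snd (snd S))"

definition hglue :: "region \<Rightarrow> region \<Rightarrow> region" where
  "hglue S R = (concat_path (fst S) (fst R), fst (snd R) \<union> fst (snd S),
     concat_path (snd (snd S)) (snd (snd R)))"

text \<open>
  Gluing along a piece of joint boundary is whiskering with the remaining pieces of the boundary
  paths, followed by vertical gluing.
\<close>

inductive_set regions :: "region set" where
  id: "\<gamma> \<in> paths \<Longrightarrow> id_region \<gamma> \<in> regions"
| causal: "causal_subset U \<Longrightarrow> (future_boundary U, closure U, past_boundary U) \<in> regions"
| vglue: "\<lbrakk>S \<in> regions; R \<in> regions; fst S = snd (snd R)\<rbrakk> \<Longrightarrow> vglue S R \<in> regions"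
| hglue: "\<lbrakk>S \<in> regions; R \<in> regions; fst (fst S) = snd (snd (fst R))\<rbrakk> \<Longrightarrow> hglue S R \<in> regions"

definition P2 :: "(point, path, region) two_category" where
  "P2 = \<lparr>Obj = UNIV, Arr = paths, Cell = regions,
     src1 = fst, tgt1 = (\<lambda>\<gamma>. snd (snd \<gamma>)), src2 = fst, tgt2 = (\<lambda>R. snd (snd R)),
     id1 = const_path, id2 = id_region, comp1 = concat_path, vcomp = vglue, hcomp = hglue\<rparr>"

lemma paths_ends: "\<gamma> \<in> paths \<Longrightarrow> fst \<gamma> \<in> fst (snd \<gamma>) \<and> snd (snd \<gamma>) \<in> fst (snd \<gamma>)"
  by (induction rule: paths.induct) (auto simp: const_path_def concat_path_def seg_def)

lemma concat_path_assoc: "concat_path (concat_path \<epsilon> \<delta>) \<gamma> = concat_path \<epsilon> (concat_path \<delta> \<gamma>)"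
  by (auto simp: concat_path_def)

lemma concat_path_paths:
  assumes "\<delta> \<in> paths" "\<gamma> \<in> paths" "fst \<delta> = snd (snd \<gamma>)"
  shows "concat_path \<delta> \<gamma> \<in> paths"
  using assms
proof (induction rule: paths.induct)
  case (const p)
  then have "concat_path (const_path p) \<gamma> = \<gamma>"
    using paths_ends[of \<gamma>] by (auto simp: concat_path_def const_path_def prod_eq_iff)
  with const show ?case by simp
next
  case (step \<delta> q r)
  then have "concat_path \<delta> \<gamma> \<in> paths" by (simp add: concat_path_def)
  then have "concat_path (seg q r) (concat_path \<delta> \<gamma>) \<in> paths"
    using step.hyps by (intro paths.step) (simp_all add: concat_path_def)
  then show ?case by (simp add: concat_path_assoc)
qed

lemma seg_paths: "lightlike_right p q \<Longrightarrow> seg p q \<in> paths"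
  using paths.step[OF paths.const[of p], of p q]
  by (simp add: concat_path_def const_path_def seg_def insert_absorb)

lemma causal_future_eq: "causal_future m = {q. fst m - snd m \<ge> fst q - snd q \<and> fst m + snd m \<le> fst q + snd q}"
  by (auto simp: causal_future_def abs_le_iff)

lemma closed_causal_future: "closed (causal_future m)"
  unfolding causal_future_eq
  by (intro closed_Collect_conj closed_Collect_le continuous_intros)

lemma closed_causal_past: "closed (causal_past m)"
  unfolding causal_past_def causal_future_eq mem_Collect_eq
  by (intro closed_Collect_conj closed_Collect_le continuous_intros)

lemma convex_causal_future: "convex (causal_future m)"
proof -
  have "causal_future m = (\<lambda>q. (fst q - snd q, fst q + snd q)) -` ({..fst m - snd m} \<times> {fst m + snd m..})"
    by (auto simp: causal_future_eq)
  then show ?thesis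
    by (simp only:) (intro convex_linear_vimage convex_Times convex_real_interval linearI; simp add: algebra_simps)
qed

lemma convex_causal_past: "convex (causal_past m)"
proof -
  have "causal_past m = (\<lambda>q. (fst q - snd q, fst q + snd q)) -` ({fst m - snd m..} \<times> {..fst m + snd m})"
    by (auto simp: causal_past_def causal_future_eq)
  then show ?thesis
    by (simp only:) (intro convex_linear_vimage convex_Times convex_real_interval linearI; simp add: algebra_simps)
qed

text \<open>The closure of a causal subset is a rectangle with bottom vertex \<open>m\<close> and lightlike side vectors
  \<open>\<alpha> (-1, 1)\<close> and \<open>\<beta> (1, 1)\<close>; in particular the four corners are well defined.\<close>

lemma causal_subset_corners:
  assumes "causal_subset U"
  obtains m \<alpha> \<beta> where "0 < \<alpha>" "0 < \<beta>"
    "closure U = causal_future m \<inter> causal_past (m + \<alpha> *\<^sub>R (-1, 1) + \<beta> *\<^sub>R (1, 1))"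
    "bottom_vertex U = m" "top_vertex U = m + \<alpha> *\<^sub>R (-1, 1) + \<beta> *\<^sub>R (1, 1)"
    "left_corner U = m + \<alpha> *\<^sub>R (-1, 1)" "right_corner U = m + \<beta> *\<^sub>R (1, 1)"
proof -
  from assms obtain m n where U: "U = interior (causal_future m \<inter> causal_past n)" and ne: "U \<noteq> {}"
    unfolding causal_subset_def by blast
  define D where "D = causal_future m \<inter> causal_past n"
  define \<alpha> where "\<alpha> = ((fst m - snd m) - (fst n - snd n)) / 2"
  define \<beta> where "\<beta> = ((fst n + snd n) - (fst m + snd m)) / 2"
  have n: "n = m + \<alpha> *\<^sub>R (-1, 1) + \<beta> *\<^sub>R (1, 1)"
    by (simp add: prod_eq_iff \<alpha>_def \<beta>_def field_simps)
  have D: "D = {q. fst m - snd m - 2 * \<alpha> \<le> fst q - snd q \<and> fst q - snd q \<le> fst m - snd m \<and>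
      fst m + snd m \<le> fst q + snd q \<and> fst q + snd q \<le> fst m + snd m + 2 * \<beta>}"
    by (auto simp: D_def causal_past_def causal_future_eq \<alpha>_def \<beta>_def field_simps)
  obtain q e where e: "e > 0" and q: "ball q e \<subseteq> D"
    using ne U D_def mem_interior by blast
  have near: "(fst q + e/2, snd q) \<in> D" "(fst q - e/2, snd q) \<in> D"
    using e by (auto intro!: subsetD[OF q] simp: dist_prod_def dist_real_def)
  have pos: "0 < \<alpha>" "0 < \<beta>" using near e by (auto simp: D)
  have cl: "closure U = D"
    using ne convex_closure_interior[of D] unfolding U D_def
    by (metis closure_closed closed_Int closed_causal_future closed_causal_past
        convex_Int convex_causal_future convex_causal_past)
  have "bottom_vertex U = m"
    unfolding bottom_vertex_def cl
  proof (rule the_equality)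
    show "m \<in> D \<and> (\<forall>z\<in>D. snd m \<le> snd z)" using pos by (auto simp: D)
    show "z = m" if "z \<in> D \<and> (\<forall>w\<in>D. snd z \<le> snd w)" for z
    proof -
      have "m \<in> D" using pos by (auto simp: D)
      with that have "snd z \<le> snd m" "z \<in> D" by auto
      then show ?thesis by (auto simp: D prod_eq_iff)
    qed
  qed
  moreover have "top_vertex U = n"
    unfolding top_vertex_def cl
  proof (rule the_equality)
    show "n \<in> D \<and> (\<forall>z\<in>D. snd z \<le> snd n)" using pos by (auto simp: D n)
    show "z = n" if "z \<in> D \<and> (\<forall>w\<in>D. snd w \<le> snd z)" for z
    proof -
      have "n \<in> D" using pos by (auto simp: D n)
      with that have "snd n \<le> snd z" "z \<in> D" by auto
      then show ?thesis by (auto simp: D n prod_eq_iff)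
    qed
  qed
  moreover have "left_corner U = m + \<alpha> *\<^sub>R (-1, 1)"
    unfolding left_corner_def cl
  proof (rule the_equality)
    show "m + \<alpha> *\<^sub>R (-1, 1) \<in> D \<and> (\<forall>z\<in>D. fst (m + \<alpha> *\<^sub>R (-1, 1)) \<le> fst z)"
      using pos by (auto simp: D)
    show "z = m + \<alpha> *\<^sub>R (-1, 1)" if "z \<in> D \<and> (\<forall>w\<in>D. fst z \<le> fst w)" for z
    proof -
      have "m + \<alpha> *\<^sub>R (-1, 1) \<in> D" using pos by (auto simp: D)
      with that have "fst z \<le> fst (m + \<alpha> *\<^sub>R (-1, 1))" "z \<in> D" by auto
      then show ?thesis by (auto simp: D prod_eq_iff)
    qed
  qed
  moreover have "right_corner U = m + \<beta> *\<^sub>R (1, 1)"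
    unfolding right_corner_def cl
  proof (rule the_equality)
    show "m + \<beta> *\<^sub>R (1, 1) \<in> D \<and> (\<forall>z\<in>D. fst z \<le> fst (m + \<beta> *\<^sub>R (1, 1)))"
      using pos by (auto simp: D)
    show "z = m + \<beta> *\<^sub>R (1, 1)" if "z \<in> D \<and> (\<forall>w\<in>D. fst w \<le> fst z)" for z
    proof -
      have "m + \<beta> *\<^sub>R (1, 1) \<in> D" using pos by (auto simp: D)
      with that have "fst (m + \<beta> *\<^sub>R (1, 1)) \<le> fst z" "z \<in> D" by auto
      then show ?thesis by (auto simp: D prod_eq_iff)
    qed
  qed
  ultimately show thesis using that[OF pos] cl D_def n by metis
qed

lemma boundaries_paths:
  assumes "causal_subset U"
  shows "future_boundary U \<in> paths" "past_boundary U \<in> paths"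
proof -
  from assms obtain m \<alpha> \<beta> where pos: "0 < \<alpha>" "0 < \<beta>" and
    c: "bottom_vertex U = m" "top_vertex U = m + \<alpha> *\<^sub>R (-1, 1) + \<beta> *\<^sub>R (1, 1)"
    "left_corner U = m + \<alpha> *\<^sub>R (-1, 1)" "right_corner U = m + \<beta> *\<^sub>R (1, 1)"
    by (rule causal_subset_corners)
  have *: "lightlike_right (left_corner U) (top_vertex U)"
    unfolding lightlike_right_def c using pos by (intro exI[of _ \<beta>]) (simp add: prod_eq_iff)
  have **: "lightlike_right (top_vertex U) (right_corner U)"
    unfolding lightlike_right_def c using pos by (intro exI[of _ \<alpha>]) (simp add: prod_eq_iff)
  have \<dagger>: "lightlike_right (left_corner U) (bottom_vertex U)"
    unfolding lightlike_right_def c using pos by (intro exI[of _ \<alpha>]) (simp add: prod_eq_iff)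
  have \<ddagger>: "lightlike_right (bottom_vertex U) (right_corner U)"
    unfolding lightlike_right_def c using pos by (intro exI[of _ \<beta>]) (simp add: prod_eq_iff)
  have two: "polygon [p, x, q] \<in> paths" if "lightlike_right p x" "lightlike_right x q" for p x q
  proof -
    have "concat_path (const_path q) (seg x q) \<in> paths"
      using that paths.const[of q] by (intro concat_path_paths seg_paths) (simp_all add: const_path_def seg_def)
    then have "concat_path (concat_path (const_path q) (seg x q)) (seg p x) \<in> paths"
      by (rule concat_path_paths[OF _ seg_paths[OF that(1)]]) (simp add: concat_path_def seg_def)
    then show ?thesis by simp
  qed
  show "future_boundary U \<in> paths" "past_boundary U \<in> paths"
    unfolding future_boundary_def past_boundary_def using two * ** \<dagger> \<ddagger> by blast+
qed

lemma boundaries_subset: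
  assumes "causal_subset U"
  shows "fst (snd (future_boundary U)) \<subseteq> closure U" "fst (snd (past_boundary U)) \<subseteq> closure U"
proof -
  from assms obtain m \<alpha> \<beta> where pos: "0 < \<alpha>" "0 < \<beta>" and
    cl: "closure U = causal_future m \<inter> causal_past (m + \<alpha> *\<^sub>R (-1, 1) + \<beta> *\<^sub>R (1, 1))" and
    c: "bottom_vertex U = m" "top_vertex U = m + \<alpha> *\<^sub>R (-1, 1) + \<beta> *\<^sub>R (1, 1)"
    "left_corner U = m + \<alpha> *\<^sub>R (-1, 1)" "right_corner U = m + \<beta> *\<^sub>R (1, 1)"
    by (rule causal_subset_corners)
  have conv: "convex (closure U)"
    unfolding cl by (intro convex_Int convex_causal_future convex_causal_past)
  have "{left_corner U, right_corner U, bottom_vertex U, top_vertex U} \<subseteq> closure U"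
    using pos unfolding cl c by (auto simp: causal_past_def causal_future_eq)
  then show "fst (snd (future_boundary U)) \<subseteq> closure U" "fst (snd (past_boundary U)) \<subseteq> closure U"
    using closed_segment_subset[OF _ _ conv]
    by (auto simp: future_boundary_def past_boundary_def concat_path_def seg_def const_path_def)
qed

lemma regions_props:
  "R \<in> regions \<Longrightarrow> fst R \<in> paths \<and> snd (snd R) \<in> paths \<and> fst (fst R) = fst (snd (snd R)) \<and>
    snd (snd (fst R)) = snd (snd (snd (snd R))) \<and>
    fst (snd (fst R)) \<subseteq> fst (snd R) \<and> fst (snd (snd (snd R))) \<subseteq> fst (snd R)"
proof (induction rule: regions.induct)
  case (causal U)
  then show ?case
    using boundaries_paths[OF causal] boundaries_subset[OF causal]
    by (simp add: future_boundary_def past_boundary_def concat_path_def seg_def const_path_def)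
next
  case (hglue S R)
  then show ?case
    by (auto simp: hglue_def intro!: concat_path_paths) (auto simp: concat_path_def)
qed (auto simp: id_region_def vglue_def)

lemma strict_2category_P2: "strict_2category P2"
proof
  show "\<And>h. h \<in> Arr P2 \<Longrightarrow> src1 P2 h \<in> Obj P2 \<and> tgt1 P2 h \<in> Obj P2"
    by (simp add: P2_def)
  show "\<And>a. a \<in> Cell P2 \<Longrightarrow> src2 P2 a \<in> Arr P2 \<and> tgt2 P2 a \<in> Arr P2"
    by (simp add: P2_def regions_props)
  show "\<And>a. a \<in> Cell P2 \<Longrightarrow>
      src1 P2 (src2 P2 a) = src1 P2 (tgt2 P2 a) \<and> tgt1 P2 (src2 P2 a) = tgt1 P2 (tgt2 P2 a)"
    by (simp add: P2_def regions_props)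
  show "\<And>x. x \<in> Obj P2 \<Longrightarrow> id1 P2 x \<in> Arr P2 \<and> src1 P2 (id1 P2 x) = x \<and> tgt1 P2 (id1 P2 x) = x"
    using paths.const by (simp add: P2_def const_path_def)
  show "\<And>h. h \<in> Arr P2 \<Longrightarrow> id2 P2 h \<in> Cell P2 \<and> src2 P2 (id2 P2 h) = h \<and> tgt2 P2 (id2 P2 h) = h"
    using regions.id by (simp add: P2_def id_region_def)
  show "\<And>h k. \<lbrakk>h \<in> Arr P2; k \<in> Arr P2; src1 P2 h = tgt1 P2 k\<rbrakk> \<Longrightarrow>
      h \<cdot>\<^bsub>P2\<^esub> k \<in> Arr P2 \<and> src1 P2 (h \<cdot>\<^bsub>P2\<^esub> k) = src1 P2 k \<and> tgt1 P2 (h \<cdot>\<^bsub>P2\<^esub> k) = tgt1 P2 h"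
    by (simp add: P2_def concat_path_paths) (simp add: concat_path_def)
  show "\<And>h. h \<in> Arr P2 \<Longrightarrow> h \<cdot>\<^bsub>P2\<^esub> id1 P2 (src1 P2 h) = h \<and> id1 P2 (tgt1 P2 h) \<cdot>\<^bsub>P2\<^esub> h = h"
    using paths_ends by (fastforce simp: P2_def concat_path_def const_path_def)
  show "\<And>a b. \<lbrakk>a \<in> Cell P2; b \<in> Cell P2; src2 P2 a = tgt2 P2 b\<rbrakk> \<Longrightarrow>
      a \<circ>\<^sub>v\<^bsub>P2\<^esub> b \<in> Cell P2 \<and> src2 P2 (a \<circ>\<^sub>v\<^bsub>P2\<^esub> b) = src2 P2 b \<and> tgt2 P2 (a \<circ>\<^sub>v\<^bsub>P2\<^esub> b) = tgt2 P2 a"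
    by (simp add: P2_def regions.vglue) (simp add: vglue_def)
  show "\<And>a. a \<in> Cell P2 \<Longrightarrow> a \<circ>\<^sub>v\<^bsub>P2\<^esub> id2 P2 (src2 P2 a) = a \<and> id2 P2 (tgt2 P2 a) \<circ>\<^sub>v\<^bsub>P2\<^esub> a = a"
    using regions_props by (fastforce simp: P2_def vglue_def id_region_def)
  show "\<And>a b. \<lbrakk>a \<in> Cell P2; b \<in> Cell P2; src1 P2 (src2 P2 a) = tgt1 P2 (src2 P2 b)\<rbrakk> \<Longrightarrow>
      a \<circ>\<^sub>h\<^bsub>P2\<^esub> b \<in> Cell P2 \<and> src2 P2 (a \<circ>\<^sub>h\<^bsub>P2\<^esub> b) = src2 P2 a \<cdot>\<^bsub>P2\<^esub> src2 P2 b \<and>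
      tgt2 P2 (a \<circ>\<^sub>h\<^bsub>P2\<^esub> b) = tgt2 P2 a \<cdot>\<^bsub>P2\<^esub> tgt2 P2 b"
    by (simp add: P2_def regions.hglue) (simp add: hglue_def)
  show "\<And>a. a \<in> Cell P2 \<Longrightarrow> a \<circ>\<^sub>h\<^bsub>P2\<^esub> id2 P2 (id1 P2 (src1 P2 (src2 P2 a))) = a \<and>
      id2 P2 (id1 P2 (tgt1 P2 (src2 P2 a))) \<circ>\<^sub>h\<^bsub>P2\<^esub> a = a"
  proof -
    fix a :: region
    assume "a \<in> Cell P2"
    then have a: "a \<in> regions" by (simp add: P2_def)
    note pr = regions_props[OF a]
    show "a \<circ>\<^sub>h\<^bsub>P2\<^esub> id2 P2 (id1 P2 (src1 P2 (src2 P2 a))) = a \<and>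
      id2 P2 (id1 P2 (tgt1 P2 (src2 P2 a))) \<circ>\<^sub>h\<^bsub>P2\<^esub> a = a"
    proof -
      obtain p \<gamma> q R p' \<gamma>' q' where "a = ((p, \<gamma>, q), R, (p', \<gamma>', q'))"
        by (metis prod.collapse)
      then show ?thesis
      using pr paths_ends[of "fst a"] paths_ends[of "snd (snd a)"]
      by (auto simp: P2_def hglue_def id_region_def const_path_def concat_path_def)
    qed
  qed
qed (auto simp: P2_def concat_path_def vglue_def hglue_def id_region_def)

text \<open>The 2-functor induced by a map of the plane, by taking images.\<close>

definition image_path :: "(point \<Rightarrow> point) \<Rightarrow> path \<Rightarrow> path" where
  "image_path g \<gamma> = (g (fst \<gamma>), g ` fst (snd \<gamma>), g (snd (snd \<gamma>)))"

definition image_region :: "(point \<Rightarrow> point) \<Rightarrow> region \<Rightarrow> region" where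
  "image_region g R = (image_path g (fst R), g ` fst (snd R), image_path g (snd (snd R)))"

definition P2_map :: "(point \<Rightarrow> point) \<Rightarrow> (point, path, region, point, path, region) two_functor" where
  "P2_map g = \<lparr>on_obj = g, on_arr = image_path g, on_cell = image_region g\<rparr>"


section \<open>Nets of monoids\<close>

text \<open>\<open>incl A V U\<close> is the value of the functor \<open>A\<close> on the inclusion \<open>V \<subseteq> U\<close>.\<close>

record 'b net_data =
  alg :: "point set \<Rightarrow> 'b monoid"
  incl :: "point set \<Rightarrow> point set \<Rightarrow> 'b \<Rightarrow> 'b"

locale net =
  fixes A :: "'b net_data"
  assumes alg_monoid: "causal_subset U \<Longrightarrow> Group.monoid (alg A U)"
    and incl_hom: "\<lbrakk>causal_subset V; causal_subset U; V \<subseteq> U\<rbrakk> \<Longrightarrow>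
      incl A V U \<in> hom (alg A V) (alg A U) \<and> incl A V U \<one>\<^bsub>alg A V\<^esub> = \<one>\<^bsub>alg A U\<^esub>"
    and incl_id: "\<lbrakk>causal_subset U; a \<in> carrier (alg A U)\<rbrakk> \<Longrightarrow> incl A U U a = a"
    and incl_comp: "\<lbrakk>causal_subset W; causal_subset V; causal_subset U; W \<subseteq> V; V \<subseteq> U;
        a \<in> carrier (alg A W)\<rbrakk> \<Longrightarrow> incl A V U (incl A W V a) = incl A W U a"

definition net_pullback :: "(point \<Rightarrow> point) \<Rightarrow> 'b net_data \<Rightarrow> 'b net_data" where
  "net_pullback g A = \<lparr>alg = (\<lambda>U. alg A (g ` U)), incl = (\<lambda>V U. incl A (g ` V) (g ` U))\<rparr>"

text \<open>A bijection in \<open>hom\<close> between monoids automatically preserves the unit.\<close>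

locale net_isomorphism = A: net A + B: net B
  for A :: "'b net_data" and B :: "'d net_data" +
  fixes r :: "point set \<Rightarrow> 'b \<Rightarrow> 'd"
  assumes component_iso: "causal_subset U \<Longrightarrow> r U \<in> iso (alg A U) (alg B U)"
    and natural: "\<lbrakk>causal_subset V; causal_subset U; V \<subseteq> U; a \<in> carrier (alg A V)\<rbrakk> \<Longrightarrow>
      r U (incl A V U a) = incl B V U (r V a)"


section \<open>The net of a 2-functor\<close>

text \<open>The lower (past) path is the second argument.\<close>

definition between :: "path \<Rightarrow> path \<Rightarrow> point set" where
  "between \<gamma> \<gamma>' = {(x, t). \<exists>s s'. (x, s) \<in> fst (snd \<gamma>) \<and> (x, s') \<in> fst (snd \<gamma>') \<and> s' \<le> t \<and> t \<le> s}"

definition left_attach :: "point set \<Rightarrow> point set \<Rightarrow> point" where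
  "left_attach V U = (THE u. u \<in> closed_segment (left_corner U) (bottom_vertex U) \<and>
     (\<exists>s \<ge> 0. left_corner V = u + s *\<^sub>R (1, 1)))"

definition right_attach :: "point set \<Rightarrow> point set \<Rightarrow> point" where
  "right_attach V U = (THE v. v \<in> closed_segment (bottom_vertex U) (right_corner U) \<and>
     (\<exists>s \<ge> 0. v = right_corner V + s *\<^sub>R (1, -1)))"

definition inclusion_region :: "point set \<Rightarrow> point set \<Rightarrow> region" where
  "inclusion_region V U =
    (let u = left_attach V U; v = right_attach V U;
         \<gamma> = polygon [u, left_corner V, bottom_vertex V, right_corner V, v];
         \<gamma>' = polygon [u, bottom_vertex U, v]
     in whisker P2 (seg v (right_corner U)) (\<gamma>, between \<gamma> \<gamma>', \<gamma>') (seg (left_corner U) u))"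

definition net_of ::
  "('o, 'm, 'c) two_category \<Rightarrow> (point, path, region, 'o, 'm, 'c) two_functor \<Rightarrow> 'c net_data" where
  "net_of C Z =
    \<lparr>alg = (\<lambda>U. End C (on_arr Z (past_boundary U))),
     incl = (\<lambda>V U a.
       let f' = on_cell Z (inclusion_region V U);
           a' = whisker C
             (on_arr Z (polygon [right_corner V, right_attach V U, right_corner U])) a
             (on_arr Z (polygon [left_corner U, left_attach V U, left_corner V]))
       in f' \<circ>\<^sub>v\<^bsub>C\<^esub> a' \<circ>\<^sub>v\<^bsub>C\<^esub> inv2 C f')\<rparr>"


section \<open>Group actions and equivariant structures\<close>

text \<open>Continuous differentiability of order \<open>k\<close> via directional derivatives.\<close>

primrec C_diff :: "nat \<Rightarrow> ('a::euclidean_space \<Rightarrow> 'b::real_normed_vector) \<Rightarrow> bool" where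
  "C_diff 0 f \<longleftrightarrow> continuous_on UNIV f"
| "C_diff (Suc k) f \<longleftrightarrow>
    f differentiable_on UNIV \<and> (\<forall>v. C_diff k (\<lambda>x. frechet_derivative f (at x) v))"

definition diffeomorphism :: "('a::euclidean_space \<Rightarrow> 'a) \<Rightarrow> bool" where
  "diffeomorphism g \<longleftrightarrow> bij g \<and> (\<forall>k. C_diff k g \<and> C_diff k (inv_into UNIV g))"

text \<open>
  The product convention makes \<open>act\<close> a right action.  Preservation of inclusions by
  \<open>U \<mapsto> act g ` U\<close> is automatic.
\<close>

locale causal_action = group G
  for G :: "('g, 'e) monoid_scheme" (structure) +
  fixes act :: "'g \<Rightarrow> point \<Rightarrow> point"
  assumes act_diffeomorphism: "g \<in> carrier G \<Longrightarrow> diffeomorphism (act g)"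
    and act_one: "act \<one> x = x"
    and act_mult: "\<lbrakk>g\<^sub>1 \<in> carrier G; g\<^sub>2 \<in> carrier G\<rbrakk> \<Longrightarrow> act (g\<^sub>1 \<otimes> g\<^sub>2) x = act g\<^sub>2 (act g\<^sub>1 x)"
    and act_causal: "\<lbrakk>g \<in> carrier G; causal_subset U\<rbrakk> \<Longrightarrow> causal_subset (act g ` U)"
    and act_2functor: "g \<in> carrier G \<Longrightarrow> strict_2functor P2 P2 (P2_map (act g))"

locale equivariant_2functor = causal_action G act + strict_2functor P2 C Z
  for G :: "('g, 'e) monoid_scheme" (structure) and act
    and C :: "('o, 'm, 'c) two_category" and Z +
  fixes f :: "'g \<Rightarrow> (point, path, 'm, 'c) transformation"
    and F :: "'g \<Rightarrow> 'g \<Rightarrow> point \<Rightarrow> 'c"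
  assumes f_iso: "g \<in> carrier G \<Longrightarrow>
      functor_isomorphism P2 C Z (functor_comp Z (P2_map (act g))) (f g)"
    and F_mod: "\<lbrakk>g\<^sub>1 \<in> carrier G; g\<^sub>2 \<in> carrier G\<rbrakk> \<Longrightarrow>
      invertible_modification P2 C Z (functor_comp Z (P2_map (act (g\<^sub>1 \<otimes> g\<^sub>2))))
        (trans_comp P2 C (trans_pullback (P2_map (act g\<^sub>1)) (f g\<^sub>2)) (f g\<^sub>1)) (f (g\<^sub>1 \<otimes> g\<^sub>2)) (F g\<^sub>1 g\<^sub>2)"
    and F_coherent: "\<lbrakk>g\<^sub>1 \<in> carrier G; g\<^sub>2 \<in> carrier G; g\<^sub>3 \<in> carrier G\<rbrakk> \<Longrightarrow>
      F (g\<^sub>1 \<otimes> g\<^sub>2) g\<^sub>3 x \<circ>\<^sub>v\<^bsub>C\<^esub> (id2 C (t_obj (f g\<^sub>3) (act (g\<^sub>1 \<otimes> g\<^sub>2) x)) \<circ>\<^sub>h\<^bsub>C\<^esub> F g\<^sub>1 g\<^sub>2 x) =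
      F g\<^sub>1 (g\<^sub>2 \<otimes> g\<^sub>3) x \<circ>\<^sub>v\<^bsub>C\<^esub> (F g\<^sub>2 g\<^sub>3 (act g\<^sub>1 x) \<circ>\<^sub>h\<^bsub>C\<^esub> id2 C (t_obj (f g\<^sub>1) x))"

locale equivariant_net = causal_action G act + net A
  for G :: "('g, 'e) monoid_scheme" (structure) and act and A :: "'b net_data" +
  fixes r :: "'g \<Rightarrow> point set \<Rightarrow> 'b \<Rightarrow> 'b"
  assumes r_iso: "g \<in> carrier G \<Longrightarrow> net_isomorphism A (net_pullback (act g) A) (r g)"
    and r_mult: "\<lbrakk>g\<^sub>1 \<in> carrier G; g\<^sub>2 \<in> carrier G; causal_subset U; a \<in> carrier (alg A U)\<rbrakk> \<Longrightarrow>
      r g\<^sub>2 (act g\<^sub>1 ` U) (r g\<^sub>1 U a) = r (g\<^sub>1 \<otimes> g\<^sub>2) U a"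

text \<open>
  With \<open>\<gamma>\<close> the past boundary of \<open>U\<close>, from \<open>p\<close> to \<open>q\<close>, an endomorphism \<open>a\<close> of \<open>Z \<gamma>\<close> is whiskered to
  an endomorphism of \<open>f q \<cdot> Z \<gamma>\<close>, conjugated by \<open>f \<gamma> : f q \<cdot> Z \<gamma> \<Rightarrow> Z (g \<gamma>) \<cdot> f p\<close>, and the
  factor \<open>f p\<close> is then cancelled by its strict inverse.
\<close>

definition induced_structure ::
  "('o, 'm, 'c) two_category \<Rightarrow> ('g \<Rightarrow> (point, path, 'm, 'c) transformation) \<Rightarrow>
   'g \<Rightarrow> point set \<Rightarrow> 'c \<Rightarrow> 'c" where
  "induced_structure C f g U a =
    (let c = t_arr (f g) (past_boundary U)
     in (c \<circ>\<^sub>v\<^bsub>C\<^esub> (id2 C (t_obj (f g) (right_corner U)) \<circ>\<^sub>h\<^bsub>C\<^esub> a) \<circ>\<^sub>v\<^bsub>C\<^esub> inv2 C c)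
        \<circ>\<^sub>h\<^bsub>C\<^esub> id2 C (inv1 C (t_obj (f g) (left_corner U))))"

end

theory Submission
  imports Defs
begin

text \<open>
  Write \<open>\<eta> = f g\<close> for one of the given transformations.  A 2-cell \<open>c : q \<cdot> h \<Rightarrow> k \<cdot> p\<close> that fills a square of
  1-cells relates an endomorphism \<open>a\<close> of \<open>h\<close> to an endomorphism \<open>b\<close> of \<open>k\<close> when
  \<open>(b \<cdot> 1\<^sub>p) \<circ> c = c \<circ> (1\<^sub>q \<cdot> a)\<close>.  In a 2-groupoid \<open>c\<close>, \<open>p\<close> and \<open>q\<close> can be cancelled, so this relation
  (\<open>intertwines\<close>) is the graph of an isomorphism \<open>End h \<rightarrow> End k\<close>; for the naturality square of \<open>\<eta>\<close> at
  the past boundary of \<open>U\<close> this isomorphism is the component at \<open>U\<close> of the induced structure.  Since the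
  relation determines \<open>b\<close> from \<open>a\<close>, each identity between such isomorphisms follows once the relation is
  known to survive an operation on squares, and no inverses have to be manipulated:

  \<^item> pasting squares side by side and replacing the rows along 2-cells, which together give naturality
  in \<open>U\<close>: the structure maps of the net whisker along the legs of an inclusion and conjugate by the
  image of its region, and \<open>\<eta>\<close> is compatible with both (\<open>intertwines_incl\<close>);

  \<^item> stacking squares and replacing the columns along 2-cells, which together give the composition
  law: the composite of two induced maps is related to the stacked square, and the modification
  \<open>F g\<^sub>1 g\<^sub>2\<close> carries this square to that of \<open>f (g\<^sub>1 \<otimes> g\<^sub>2)\<close> (\<open>induced_structure_mult\<close>).

  What remains is the geometry of the plane.  A path is the graph of a function of the space coordinate,
  and a region consists of the points between its two boundary graphs.  Hence a region is determined by
  its two boundary paths (\<open>regions_locally_thin\<close>): every equation between parallel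
  2-morphisms reduces to a comparison of paths.  This yields the functoriality of the net, where the two composites for
  \<open>W \<subseteq> V \<subseteq> U\<close> differ by rectangles at the left and at the right of \<open>W\<close>, which slide past the
  endomorphism.  A region is also determined by its set of points alone (\<open>regions_eq_if_same_points\<close>).
  A symmetry \<open>g\<close> maps the closure of \<open>U\<close> onto the closure of \<open>g ` U\<close>, so it must map past boundary to past
  boundary and the left and right corners to the left and right corners.  The bottom vertex is preserved,
  too: the images of all causal subsets \<open>V \<subseteq> U\<close> with the bottom of \<open>U\<close> have one and the same bottom,
  because their past boundaries are contained in that of \<open>g ` U\<close>, and the bottom of \<open>U\<close> is the only point
  that the past boundaries of all these \<open>V\<close> have in common.  Therefore \<open>g\<close> preserves each of the two lightlike directions, and with them the attaching points and
  the region of every inclusion (\<open>image_inclusion_region\<close>).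
\<close>

section \<open>Pasting and conjugation of endomorphisms in 2-groupoids\<close>

context strict_2category
begin

lemmas typing = arr_obj cell_arr id1_arr id2_cell comp1_arr vcomp_cell hcomp_cell

lemma cell_ends:
  assumes "a \<in> Cell C"
  shows "src1 C (tgt2 C a) = src1 C (src2 C a)" "tgt1 C (tgt2 C a) = tgt1 C (src2 C a)"
  using cell_globular[OF assms] by auto

lemma id2_vcomp_id2: "h \<in> Arr C \<Longrightarrow> id2 C h \<circ>\<^sub>v id2 C h = id2 C h"
  using vcomp_unit[of "id2 C h"] id2_cell by simp

lemma whisker_left_vcomp:
  assumes "k \<in> Arr C" "a \<in> Cell C" "b \<in> Cell C" "src2 C a = tgt2 C b"
    "src1 C k = tgt1 C (src2 C b)"
  shows "id2 C k \<circ>\<^sub>h (a \<circ>\<^sub>v b) = (id2 C k \<circ>\<^sub>h a) \<circ>\<^sub>v (id2 C k \<circ>\<^sub>h b)"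
  using interchange[of "id2 C k" "id2 C k" b a] assms by (simp add: typing id2_vcomp_id2)

lemma whisker_right_vcomp:
  assumes "k \<in> Arr C" "a \<in> Cell C" "b \<in> Cell C" "src2 C a = tgt2 C b"
    "tgt1 C k = src1 C (src2 C b)"
  shows "(a \<circ>\<^sub>v b) \<circ>\<^sub>h id2 C k = (a \<circ>\<^sub>h id2 C k) \<circ>\<^sub>v (b \<circ>\<^sub>h id2 C k)"
  using interchange[of b a "id2 C k" "id2 C k"] assms by (simp add: typing id2_vcomp_id2)

lemma hcomp_eq_right_first:
  assumes "a \<in> Cell C" "b \<in> Cell C" "src1 C (src2 C a) = tgt1 C (src2 C b)"
  shows "(a \<circ>\<^sub>h id2 C (tgt2 C b)) \<circ>\<^sub>v (id2 C (src2 C a) \<circ>\<^sub>h b) = a \<circ>\<^sub>h b"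
  using interchange[of "id2 C (src2 C a)" a b "id2 C (tgt2 C b)"] assms
  by (simp add: typing cell_ends vcomp_unit)

lemma hcomp_eq_left_first:
  assumes "a \<in> Cell C" "b \<in> Cell C" "src1 C (src2 C a) = tgt1 C (src2 C b)"
  shows "(id2 C (tgt2 C a) \<circ>\<^sub>h b) \<circ>\<^sub>v (a \<circ>\<^sub>h id2 C (src2 C b)) = a \<circ>\<^sub>h b"
  using interchange[of a "id2 C (tgt2 C a)" "id2 C (src2 C b)" b] assms
  by (simp add: typing cell_ends vcomp_unit)

lemma inverse2_unique:
  assumes "a \<in> Cell C" "inverse2 C a b" "inverse2 C a b'"
  shows "b = b'"
proof -
  have "(b \<circ>\<^sub>v a) \<circ>\<^sub>v b' = b \<circ>\<^sub>v (a \<circ>\<^sub>v b')"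
    using assms by (intro vcomp_assoc) (auto simp: inverse2_def)
  then show ?thesis
    using assms vcomp_unit[of b] vcomp_unit[of b'] by (simp add: inverse2_def)
qed

lemma inverse1_unique:
  assumes "h \<in> Arr C" "inverse1 C h k" "inverse1 C h k'"
  shows "k = k'"
proof -
  have "(k \<cdot> h) \<cdot> k' = k \<cdot> (h \<cdot> k')"
    using assms by (intro comp1_assoc) (auto simp: inverse1_def)
  then show ?thesis
    using assms comp1_unit[of k] comp1_unit[of k'] by (simp add: inverse1_def)
qed

lemma End_monoid:
  assumes "h \<in> Arr C"
  shows "Group.monoid (End C h)"
  by unfold_locales (use assms in \<open>auto simp: End_def typing vcomp_assoc, (metis vcomp_unit)+\<close>)

text \<open>
  The arrows \<open>h\<close> and \<open>k\<close> are the rows and \<open>p\<close> and \<open>q\<close> the left and right columns; the filler points from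
  the path \<open>q \<cdot> h\<close> to the path \<open>k \<cdot> p\<close>, as for the components of a pseudonatural transformation.
\<close>

definition square :: "'m \<Rightarrow> 'm \<Rightarrow> 'm \<Rightarrow> 'm \<Rightarrow> 'c \<Rightarrow> bool" where
  "square p q h k c \<longleftrightarrow> p \<in> Arr C \<and> q \<in> Arr C \<and> h \<in> Arr C \<and> k \<in> Arr C \<and>
     src1 C p = src1 C h \<and> tgt1 C p = src1 C k \<and> src1 C q = tgt1 C h \<and> tgt1 C q = tgt1 C k \<and>
     c \<in> Cell C \<and> src2 C c = q \<cdot> h \<and> tgt2 C c = k \<cdot> p"

definition endo :: "'c \<Rightarrow> 'm \<Rightarrow> bool" where
  "endo a h \<longleftrightarrow> a \<in> Cell C \<and> src2 C a = h \<and> tgt2 C a = h"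

definition intertwines :: "'m \<Rightarrow> 'm \<Rightarrow> 'c \<Rightarrow> 'c \<Rightarrow> 'c \<Rightarrow> bool" where
  "intertwines p q c a b \<longleftrightarrow> (b \<circ>\<^sub>h id2 C p) \<circ>\<^sub>v c = c \<circ>\<^sub>v (id2 C q \<circ>\<^sub>h a)"

text \<open>
  With \<open>p\<close>, \<open>q\<close> and \<open>c\<close> taken from a pseudonatural transformation this is the formula that defines the
  induced structure.
\<close>

definition transport :: "'m \<Rightarrow> 'm \<Rightarrow> 'c \<Rightarrow> 'c \<Rightarrow> 'c" where
  "transport p q c a = (c \<circ>\<^sub>v (id2 C q \<circ>\<^sub>h a) \<circ>\<^sub>v inv2 C c) \<circ>\<^sub>h id2 C (inv1 C p)"

lemma carrier_End: "a \<in> carrier (End C h) \<longleftrightarrow> endo a h"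
  by (simp add: End_def endo_def)

lemma endo_id2: "h \<in> Arr C \<Longrightarrow> endo (id2 C h) h"
  by (simp add: endo_def typing)

lemma endo_vcomp: "endo a h \<Longrightarrow> endo b h \<Longrightarrow> endo (a \<circ>\<^sub>v b) h"
  by (simp add: endo_def typing)

lemma intertwines_id2:
  assumes "square p q h k c"
  shows "intertwines p q c (id2 C h) (id2 C k)"
  using assms vcomp_unit[of c] by (simp add: intertwines_def square_def hcomp_id2)

lemma intertwines_vcomp:
  assumes sq: "square p q h k c" and "endo a h" "endo a' h" "endo b k" "endo b' k"
    and ab: "intertwines p q c a b" and ab': "intertwines p q c a' b'"
  shows "intertwines p q c (a \<circ>\<^sub>v a') (b \<circ>\<^sub>v b')"
proof -
  note [simp] = typing
  note d = assms(2-5)[unfolded endo_def] sq[unfolded square_def]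
  have "((b \<circ>\<^sub>v b') \<circ>\<^sub>h id2 C p) \<circ>\<^sub>v c = (b \<circ>\<^sub>h id2 C p) \<circ>\<^sub>v ((b' \<circ>\<^sub>h id2 C p) \<circ>\<^sub>v c)"
    using d by (simp add: whisker_right_vcomp vcomp_assoc)
  also have "\<dots> = ((b \<circ>\<^sub>h id2 C p) \<circ>\<^sub>v c) \<circ>\<^sub>v (id2 C q \<circ>\<^sub>h a')"
    using d ab' by (simp add: intertwines_def vcomp_assoc)
  also have "\<dots> = c \<circ>\<^sub>v (id2 C q \<circ>\<^sub>h (a \<circ>\<^sub>v a'))"
    using d ab by (simp add: intertwines_def vcomp_assoc whisker_left_vcomp)
  finally show ?thesis by (simp add: intertwines_def)
qed

lemma square_hpaste:
  assumes "square p q h k c" "square q s h' k' c'"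
  shows "square p s (h' \<cdot> h) (k' \<cdot> k) ((id2 C k' \<circ>\<^sub>h c) \<circ>\<^sub>v (c' \<circ>\<^sub>h id2 C h))"
  using assms by (simp add: square_def typing comp1_assoc)

text \<open>
  The pasted filler applies \<open>c'\<close> first and then \<open>c\<close>; the endomorphism \<open>b'\<close> slides past \<open>c\<close> and \<open>a\<close> slides
  past \<open>c'\<close>, so the two relations can be used one after the other.  The filler has the form in which a
  pseudonatural transformation evaluates a composite 1-cell.
\<close>

lemma intertwines_hpaste:
  assumes sq: "square p q h k c" and sq': "square q s h' k' c'"
    and "endo a h" "endo b k" "endo a' h'" "endo b' k'"
    and ab: "intertwines p q c a b" and ab': "intertwines q s c' a' b'"
  shows "intertwines p s ((id2 C k' \<circ>\<^sub>h c) \<circ>\<^sub>v (c' \<circ>\<^sub>h id2 C h)) (a' \<circ>\<^sub>h a) (b' \<circ>\<^sub>h b)"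
proof -
  note [simp] = typing
  note d = assms(3-6)[unfolded endo_def] sq[unfolded square_def] sq'[unfolded square_def]
  let ?c = "id2 C k' \<circ>\<^sub>h c" and ?c' = "c' \<circ>\<^sub>h id2 C h"
  have "((b' \<circ>\<^sub>h b) \<circ>\<^sub>h id2 C p) \<circ>\<^sub>v ?c = b' \<circ>\<^sub>h ((b \<circ>\<^sub>h id2 C p) \<circ>\<^sub>v c)"
    using d interchange[of "id2 C k'" b' c "b \<circ>\<^sub>h id2 C p"] vcomp_unit[of b']
    by (simp add: hcomp_assoc)
  also have "\<dots> = ?c \<circ>\<^sub>v ((b' \<circ>\<^sub>h id2 C q) \<circ>\<^sub>h a)"
    using d ab interchange[of b' "id2 C k'" "id2 C q \<circ>\<^sub>h a" c] vcomp_unit[of b']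
    by (simp add: hcomp_assoc intertwines_def)
  finally have 1: "((b' \<circ>\<^sub>h b) \<circ>\<^sub>h id2 C p) \<circ>\<^sub>v ?c = ?c \<circ>\<^sub>v ((b' \<circ>\<^sub>h id2 C q) \<circ>\<^sub>h a)" .
  have "((b' \<circ>\<^sub>h id2 C q) \<circ>\<^sub>h a) \<circ>\<^sub>v ?c' = ((b' \<circ>\<^sub>h id2 C q) \<circ>\<^sub>v c') \<circ>\<^sub>h a"
    using d interchange[of c' "b' \<circ>\<^sub>h id2 C q" "id2 C h" a] vcomp_unit[of a]
    by simp
  also have "\<dots> = ?c' \<circ>\<^sub>v (id2 C s \<circ>\<^sub>h (a' \<circ>\<^sub>h a))"
    using d ab' interchange[of "id2 C s \<circ>\<^sub>h a'" c' a "id2 C h"] vcomp_unit[of a]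
    by (simp add: hcomp_assoc intertwines_def)
  finally have 2: "((b' \<circ>\<^sub>h id2 C q) \<circ>\<^sub>h a) \<circ>\<^sub>v ?c' = ?c' \<circ>\<^sub>v (id2 C s \<circ>\<^sub>h (a' \<circ>\<^sub>h a))" .
  have "((b' \<circ>\<^sub>h b) \<circ>\<^sub>h id2 C p) \<circ>\<^sub>v (?c \<circ>\<^sub>v ?c') = (((b' \<circ>\<^sub>h b) \<circ>\<^sub>h id2 C p) \<circ>\<^sub>v ?c) \<circ>\<^sub>v ?c'"
    using d by (simp add: vcomp_assoc comp1_assoc)
  also have "\<dots> = ?c \<circ>\<^sub>v (((b' \<circ>\<^sub>h id2 C q) \<circ>\<^sub>h a) \<circ>\<^sub>v ?c')"
    unfolding 1 using d by (simp add: vcomp_assoc comp1_assoc)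
  also have "\<dots> = (?c \<circ>\<^sub>v ?c') \<circ>\<^sub>v (id2 C s \<circ>\<^sub>h (a' \<circ>\<^sub>h a))"
    unfolding 2 using d by (simp add: vcomp_assoc comp1_assoc)
  finally show ?thesis by (simp add: intertwines_def)
qed

lemma square_vpaste:
  assumes "square p q h k c" "square p' q' k l c'"
  shows "square (p' \<cdot> p) (q' \<cdot> q) h l ((c' \<circ>\<^sub>h id2 C p) \<circ>\<^sub>v (id2 C q' \<circ>\<^sub>h c))"
  using assms by (simp add: square_def typing comp1_assoc)

text \<open>
  The row \<open>k\<close> is shared, and \<open>b\<close> serves as the intermediate endomorphism.  The filler has the form in which
  a composite of two transformations evaluates a 1-cell.
\<close>

lemma intertwines_vpaste:
  assumes sq: "square p q h k c" and sq': "square p' q' k l c'"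
    and "endo a h" "endo b k" "endo d l"
    and ab: "intertwines p q c a b" and bd: "intertwines p' q' c' b d"
  shows "intertwines (p' \<cdot> p) (q' \<cdot> q) ((c' \<circ>\<^sub>h id2 C p) \<circ>\<^sub>v (id2 C q' \<circ>\<^sub>h c)) a d"
proof -
  note [simp] = typing
  note e = assms(3-5)[unfolded endo_def] sq[unfolded square_def] sq'[unfolded square_def]
  let ?c = "id2 C q' \<circ>\<^sub>h c" and ?c' = "c' \<circ>\<^sub>h id2 C p" and ?b = "id2 C q' \<circ>\<^sub>h b \<circ>\<^sub>h id2 C p"
  have "(d \<circ>\<^sub>h id2 C (p' \<cdot> p)) \<circ>\<^sub>v ?c' = ((d \<circ>\<^sub>h id2 C p') \<circ>\<^sub>v c') \<circ>\<^sub>h id2 C p"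
    using e by (simp add: hcomp_id2[symmetric] hcomp_assoc whisker_right_vcomp)
  also have "\<dots> = ?c' \<circ>\<^sub>v ?b"
    using e bd by (simp add: intertwines_def whisker_right_vcomp hcomp_assoc)
  finally have 1: "(d \<circ>\<^sub>h id2 C (p' \<cdot> p)) \<circ>\<^sub>v ?c' = ?c' \<circ>\<^sub>v ?b" .
  have "?b \<circ>\<^sub>v ?c = id2 C q' \<circ>\<^sub>h ((b \<circ>\<^sub>h id2 C p) \<circ>\<^sub>v c)"
    using e by (simp add: whisker_left_vcomp)
  also have "\<dots> = ?c \<circ>\<^sub>v (id2 C (q' \<cdot> q) \<circ>\<^sub>h a)"
    using e ab by (simp add: intertwines_def whisker_left_vcomp hcomp_id2[symmetric] hcomp_assoc)
  finally have 2: "?b \<circ>\<^sub>v ?c = ?c \<circ>\<^sub>v (id2 C (q' \<cdot> q) \<circ>\<^sub>h a)" .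
  have "(d \<circ>\<^sub>h id2 C (p' \<cdot> p)) \<circ>\<^sub>v (?c' \<circ>\<^sub>v ?c) = ((d \<circ>\<^sub>h id2 C (p' \<cdot> p)) \<circ>\<^sub>v ?c') \<circ>\<^sub>v ?c"
    using e by (simp add: vcomp_assoc comp1_assoc)
  also have "\<dots> = ?c' \<circ>\<^sub>v (?b \<circ>\<^sub>v ?c)"
    unfolding 1 using e by (simp add: vcomp_assoc comp1_assoc)
  also have "\<dots> = (?c' \<circ>\<^sub>v ?c) \<circ>\<^sub>v (id2 C (q' \<cdot> q) \<circ>\<^sub>h a)"
    unfolding 2 using e by (simp add: vcomp_assoc comp1_assoc)
  finally show ?thesis by (simp add: intertwines_def)
qed

end

context strict_2groupoid
begin

lemma inverse2_inv2: "a \<in> Cell C \<Longrightarrow> inverse2 C a (inv2 C a)"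
  unfolding inv2_def by (rule theI') (use cell_invertible inverse2_unique in blast)

lemma inverse1_inv1: "h \<in> Arr C \<Longrightarrow> inverse1 C h (inv1 C h)"
  unfolding inv1_def by (rule theI') (use arr_invertible inverse1_unique in blast)

lemma inv2_props:
  assumes "a \<in> Cell C"
  shows "inv2 C a \<in> Cell C" "src2 C (inv2 C a) = tgt2 C a" "tgt2 C (inv2 C a) = src2 C a"
    "inv2 C a \<circ>\<^sub>v a = id2 C (src2 C a)" "a \<circ>\<^sub>v inv2 C a = id2 C (tgt2 C a)"
  using inverse2_inv2[OF assms] by (auto simp: inverse2_def)

lemma inv1_props:
  assumes "h \<in> Arr C"
  shows "inv1 C h \<in> Arr C" "src1 C (inv1 C h) = tgt1 C h" "tgt1 C (inv1 C h) = src1 C h"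
    "inv1 C h \<cdot> h = id1 C (src1 C h)" "h \<cdot> inv1 C h = id1 C (tgt1 C h)"
  using inverse1_inv1[OF assms] by (auto simp: inverse1_def)

lemma vcomp_inv2_cancel:
  assumes "c \<in> Cell C" "x \<in> Cell C" "tgt2 C c = tgt2 C x"
  shows "c \<circ>\<^sub>v (inv2 C c \<circ>\<^sub>v x) = x"
  using assms vcomp_unit[of x] vcomp_assoc[of c "inv2 C c" x] by (simp add: inv2_props)

lemma vcomp_right_cancel:
  assumes "a \<in> Cell C" "b \<in> Cell C" "c \<in> Cell C" "src2 C a = tgt2 C c" "src2 C b = tgt2 C c"
    "a \<circ>\<^sub>v c = b \<circ>\<^sub>v c"
  shows "a = b"
proof -
  have "(x \<circ>\<^sub>v c) \<circ>\<^sub>v inv2 C c = x" if "x \<in> Cell C" "src2 C x = tgt2 C c" for x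
    using that assms(3) vcomp_unit[OF that(1)] vcomp_assoc[of x c "inv2 C c"]
    by (simp add: inv2_props)
  from this[of a] this[of b] show ?thesis using assms by metis
qed

lemma vcomp_left_cancel:
  assumes "a \<in> Cell C" "b \<in> Cell C" "c \<in> Cell C" "src2 C c = tgt2 C a" "src2 C c = tgt2 C b"
    "c \<circ>\<^sub>v a = c \<circ>\<^sub>v b"
  shows "a = b"
proof -
  have "inv2 C c \<circ>\<^sub>v (c \<circ>\<^sub>v x) = x" if "x \<in> Cell C" "src2 C c = tgt2 C x" for x
    using that assms(3) vcomp_unit[OF that(1)] vcomp_assoc[of "inv2 C c" c x]
    by (simp add: inv2_props)
  from this[of a] this[of b] show ?thesis using assms by metis
qed

lemma hcomp_id2_inv1_right:
  assumes "a \<in> Cell C" "p \<in> Arr C" "src1 C (src2 C a) = tgt1 C p"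
  shows "(a \<circ>\<^sub>h id2 C p) \<circ>\<^sub>h id2 C (inv1 C p) = a"
  using assms hcomp_unit[of a] by (simp add: hcomp_assoc typing inv1_props hcomp_id2)

lemma hcomp_id2_inv1_right':
  assumes "a \<in> Cell C" "p \<in> Arr C" "src1 C (src2 C a) = src1 C p"
  shows "(a \<circ>\<^sub>h id2 C (inv1 C p)) \<circ>\<^sub>h id2 C p = a"
  using assms hcomp_unit[of a] by (simp add: hcomp_assoc typing inv1_props hcomp_id2)

lemma hcomp_id2_inv1_left:
  assumes "a \<in> Cell C" "q \<in> Arr C" "tgt1 C (src2 C a) = src1 C q"
  shows "id2 C (inv1 C q) \<circ>\<^sub>h (id2 C q \<circ>\<^sub>h a) = a"
  using assms hcomp_unit[of a] by (simp add: hcomp_assoc[symmetric] typing inv1_props hcomp_id2)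

lemma hcomp_id2_inv1_left':
  assumes "a \<in> Cell C" "q \<in> Arr C" "tgt1 C (src2 C a) = tgt1 C q"
  shows "id2 C q \<circ>\<^sub>h (id2 C (inv1 C q) \<circ>\<^sub>h a) = a"
  using assms hcomp_unit[of a] by (simp add: hcomp_assoc[symmetric] typing inv1_props hcomp_id2)

text \<open>
  Whiskering with \<open>inv1 C p\<close> and then with \<open>p\<close> is the identity, and the remaining conjugation by \<open>c\<close> is
  the relation itself.
\<close>

lemma transport_intertwines:
  assumes sq: "square p q h k c" and "endo a h"
  shows "endo (transport p q c a) k" "intertwines p q c a (transport p q c a)"
proof -
  note [simp] = typing inv2_props inv1_props
  note d = assms(2)[unfolded endo_def] sq[unfolded square_def]
  let ?x = "c \<circ>\<^sub>v (id2 C q \<circ>\<^sub>h a) \<circ>\<^sub>v inv2 C c"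
  have x: "?x \<in> Cell C" "src2 C ?x = k \<cdot> p" "tgt2 C ?x = k \<cdot> p"
    using d by simp_all
  have "(k \<cdot> p) \<cdot> inv1 C p = k"
    using d comp1_unit[of k] by (simp add: comp1_assoc)
  then show "endo (transport p q c a) k"
    using d x unfolding transport_def endo_def by simp
  have "transport p q c a \<circ>\<^sub>h id2 C p = ?x"
    using d x hcomp_id2_inv1_right'[of ?x p] unfolding transport_def by simp
  then show "intertwines p q c a (transport p q c a)"
    using d vcomp_unit[of "id2 C q \<circ>\<^sub>h a"] by (simp add: intertwines_def vcomp_assoc)
qed

lemma intertwines_unique_right:
  assumes sq: "square p q h k c" and "endo a h" "endo b k" "endo b' k"
    and "intertwines p q c a b" "intertwines p q c a b'"
  shows "b = b'"
proof -
  note [simp] = typing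
  note d = assms(2-4)[unfolded endo_def] sq[unfolded square_def]
  have "b \<circ>\<^sub>h id2 C p = b' \<circ>\<^sub>h id2 C p"
    by (rule vcomp_right_cancel[of _ _ c]) (use d assms(5,6) in \<open>simp_all add: intertwines_def\<close>)
  then show ?thesis
    using d hcomp_id2_inv1_right[of b p] hcomp_id2_inv1_right[of b' p] by metis
qed

lemma intertwines_unique_left:
  assumes sq: "square p q h k c" and "endo a h" "endo a' h" "endo b k"
    and "intertwines p q c a b" "intertwines p q c a' b"
  shows "a = a'"
proof -
  note [simp] = typing
  note d = assms(2-4)[unfolded endo_def] sq[unfolded square_def]
  have "id2 C q \<circ>\<^sub>h a = id2 C q \<circ>\<^sub>h a'"
    by (rule vcomp_left_cancel[of _ _ c]) (use d assms(5,6) in \<open>simp_all add: intertwines_def\<close>)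
  then show ?thesis
    using d hcomp_id2_inv1_left[of a q] hcomp_id2_inv1_left[of a' q] by metis
qed

text \<open>
  Replacing \<open>c\<close> by its inverse exchanges the roles of the two columns, so a preimage is found by
  conjugating with the inverse and cancelling \<open>q\<close> instead of \<open>p\<close>.
\<close>

lemma intertwines_surjective:
  assumes sq: "square p q h k c" and "endo b k"
  obtains a where "endo a h" "intertwines p q c a b"
proof -
  note [simp] = typing inv2_props inv1_props
  note d = assms(2)[unfolded endo_def] sq[unfolded square_def]
  let ?x = "inv2 C c \<circ>\<^sub>v (b \<circ>\<^sub>h id2 C p) \<circ>\<^sub>v c"
  let ?a = "id2 C (inv1 C q) \<circ>\<^sub>h ?x"
  have x: "?x \<in> Cell C" "src2 C ?x = q \<cdot> h" "tgt2 C ?x = q \<cdot> h"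
    using d by simp_all
  have "inv1 C q \<cdot> (q \<cdot> h) = h"
    using d comp1_unit[of h] by (simp add: comp1_assoc[symmetric])
  then have 1: "endo ?a h"
    using d x unfolding endo_def by simp
  have "id2 C q \<circ>\<^sub>h ?a = ?x"
    using d x hcomp_id2_inv1_left'[of ?x q] by simp
  then have "intertwines p q c ?a b"
    using d vcomp_inv2_cancel[of c "(b \<circ>\<^sub>h id2 C p) \<circ>\<^sub>v c"]
    by (simp add: intertwines_def)
  with 1 show thesis by (rule that)
qed

lemma transport_iso:
  assumes sq: "square p q h k c"
  shows "transport p q c \<in> iso (End C h) (End C k)"
proof -
  note t = transport_intertwines[OF sq]
  have carrier: "a \<in> carrier (End C l) \<longleftrightarrow> endo a l" for a l
    by (simp add: End_def endo_def)
  have "transport p q c (a \<circ>\<^sub>v a') = transport p q c a \<circ>\<^sub>v transport p q c a'"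
    if "endo a h" "endo a' h" for a a'
    by (rule intertwines_unique_right[OF sq endo_vcomp[OF that]])
      (use that in \<open>auto intro!: t endo_vcomp intertwines_vcomp[OF sq]\<close>)
  moreover have "bij_betw (transport p q c) (carrier (End C h)) (carrier (End C k))"
  proof (rule bij_betw_imageI)
    show "inj_on (transport p q c) (carrier (End C h))"
    proof (rule inj_onI)
      fix a a' assume "a \<in> carrier (End C h)" "a' \<in> carrier (End C h)"
        and eq: "transport p q c a = transport p q c a'"
      then have a: "endo a h" "endo a' h" by (simp_all add: carrier)
      show "a = a'"
        using intertwines_unique_left[OF sq a t(1)[OF a(1)] t(2)[OF a(1)]] t(2)[OF a(2)] eq by simp
    qed
    show "transport p q c ` carrier (End C h) = carrier (End C k)"
    proof (intro equalityI subsetI)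
      fix b assume "b \<in> carrier (End C k)"
      then have b: "endo b k" by (simp add: carrier)
      from intertwines_surjective[OF sq b] obtain a where a: "endo a h" "intertwines p q c a b" .
      then have "b = transport p q c a"
        using intertwines_unique_right[OF sq a(1) b] t[OF a(1)] by blast
      then show "b \<in> transport p q c ` carrier (End C h)" using a carrier by blast
    qed (auto simp: carrier intro: t)
  qed
  ultimately show ?thesis
    using carrier t(1) by (auto simp: iso_def hom_def End_def)
qed

text \<open>
  This is the form in which naturality with respect to 2-cells enters: \<open>a'\<close> and \<open>b'\<close> are the conjugates
  of \<open>a\<close> and \<open>b\<close> by \<open>\<phi>\<close> and \<open>\<psi>\<close>, and the equation \<open>nat\<close> lets \<open>\<phi>\<close> pass through the square.
\<close>

lemma intertwines_change_rows:
  assumes sq: "square p q h k c" and sq': "square p q h' k' c'"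
    and "endo a h" "endo b k" "endo a' h'" "endo b' k'"
    and \<phi>: "\<phi> \<in> Cell C" "src2 C \<phi> = h" "tgt2 C \<phi> = h'"
    and \<psi>: "\<psi> \<in> Cell C" "src2 C \<psi> = k" "tgt2 C \<psi> = k'"
    and nat: "c' \<circ>\<^sub>v (id2 C q \<circ>\<^sub>h \<phi>) = (\<psi> \<circ>\<^sub>h id2 C p) \<circ>\<^sub>v c"
    and a': "a' \<circ>\<^sub>v \<phi> = \<phi> \<circ>\<^sub>v a" and b': "b' \<circ>\<^sub>v \<psi> = \<psi> \<circ>\<^sub>v b"
    and ab: "intertwines p q c a b"
  shows "intertwines p q c' a' b'"
proof -
  note [simp] = typing
  note d = assms(3-6)[unfolded endo_def] sq[unfolded square_def] sq'[unfolded square_def] \<phi> \<psi>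
  let ?\<phi> = "id2 C q \<circ>\<^sub>h \<phi>" and ?\<psi> = "\<psi> \<circ>\<^sub>h id2 C p"
  have "((b' \<circ>\<^sub>h id2 C p) \<circ>\<^sub>v c') \<circ>\<^sub>v ?\<phi> = ((b' \<circ>\<^sub>h id2 C p) \<circ>\<^sub>v ?\<psi>) \<circ>\<^sub>v c"
    using d nat by (simp add: vcomp_assoc)
  also have "(b' \<circ>\<^sub>h id2 C p) \<circ>\<^sub>v ?\<psi> = ?\<psi> \<circ>\<^sub>v (b \<circ>\<^sub>h id2 C p)"
    using d b' by (simp add: whisker_right_vcomp[symmetric])
  also have "(?\<psi> \<circ>\<^sub>v (b \<circ>\<^sub>h id2 C p)) \<circ>\<^sub>v c = (?\<psi> \<circ>\<^sub>v c) \<circ>\<^sub>v (id2 C q \<circ>\<^sub>h a)"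
    using d ab by (simp add: vcomp_assoc intertwines_def)
  also have "\<dots> = c' \<circ>\<^sub>v (?\<phi> \<circ>\<^sub>v (id2 C q \<circ>\<^sub>h a))"
    using d nat[symmetric] by (simp add: vcomp_assoc)
  also have "?\<phi> \<circ>\<^sub>v (id2 C q \<circ>\<^sub>h a) = (id2 C q \<circ>\<^sub>h a') \<circ>\<^sub>v ?\<phi>"
    using d a' by (simp add: whisker_left_vcomp[symmetric])
  also have "c' \<circ>\<^sub>v ((id2 C q \<circ>\<^sub>h a') \<circ>\<^sub>v ?\<phi>) = (c' \<circ>\<^sub>v (id2 C q \<circ>\<^sub>h a')) \<circ>\<^sub>v ?\<phi>"
    using d by (simp add: vcomp_assoc)
  finally have "((b' \<circ>\<^sub>h id2 C p) \<circ>\<^sub>v c') \<circ>\<^sub>v ?\<phi> = (c' \<circ>\<^sub>v (id2 C q \<circ>\<^sub>h a')) \<circ>\<^sub>v ?\<phi>" .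
  then show ?thesis
    unfolding intertwines_def by (rule vcomp_right_cancel[rotated -1]) (use d in simp_all)
qed

text \<open>
  The cells \<open>M\<close> and \<open>N\<close> act on the columns and \<open>a\<close> and \<open>b\<close> on the rows, so they commute by interchange;
  the equation \<open>mod\<close> is the axiom for a modification.
\<close>

lemma intertwines_change_columns:
  assumes sq: "square p q h k c" and sq': "square p' q' h k c'"
    and "endo a h" "endo b k"
    and M: "M \<in> Cell C" "src2 C M = p" "tgt2 C M = p'"
    and N: "N \<in> Cell C" "src2 C N = q" "tgt2 C N = q'"
    and mod: "(id2 C k \<circ>\<^sub>h M) \<circ>\<^sub>v c = c' \<circ>\<^sub>v (N \<circ>\<^sub>h id2 C h)"
    and ab: "intertwines p q c a b"
  shows "intertwines p' q' c' a b"
proof -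
  note [simp] = typing
  note d = assms(3-4)[unfolded endo_def] sq[unfolded square_def] sq'[unfolded square_def] M N
  let ?M = "id2 C k \<circ>\<^sub>h M" and ?N = "N \<circ>\<^sub>h id2 C h"
  have "((b \<circ>\<^sub>h id2 C p') \<circ>\<^sub>v c') \<circ>\<^sub>v ?N = ((b \<circ>\<^sub>h id2 C p') \<circ>\<^sub>v ?M) \<circ>\<^sub>v c"
    using d mod by (simp add: vcomp_assoc)
  also have "(b \<circ>\<^sub>h id2 C p') \<circ>\<^sub>v ?M = ?M \<circ>\<^sub>v (b \<circ>\<^sub>h id2 C p)"
    using d hcomp_eq_right_first[of b M] hcomp_eq_left_first[of b M] by simp
  also have "(?M \<circ>\<^sub>v (b \<circ>\<^sub>h id2 C p)) \<circ>\<^sub>v c = (?M \<circ>\<^sub>v c) \<circ>\<^sub>v (id2 C q \<circ>\<^sub>h a)"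
    using d ab by (simp add: vcomp_assoc intertwines_def)
  also have "\<dots> = c' \<circ>\<^sub>v (?N \<circ>\<^sub>v (id2 C q \<circ>\<^sub>h a))"
    using d mod by (simp add: vcomp_assoc)
  also have "?N \<circ>\<^sub>v (id2 C q \<circ>\<^sub>h a) = (id2 C q' \<circ>\<^sub>h a) \<circ>\<^sub>v ?N"
    using d hcomp_eq_right_first[of N a] hcomp_eq_left_first[of N a] by simp
  also have "c' \<circ>\<^sub>v ((id2 C q' \<circ>\<^sub>h a) \<circ>\<^sub>v ?N) = (c' \<circ>\<^sub>v (id2 C q' \<circ>\<^sub>h a)) \<circ>\<^sub>v ?N"
    using d by (simp add: vcomp_assoc)
  finally have "((b \<circ>\<^sub>h id2 C p') \<circ>\<^sub>v c') \<circ>\<^sub>v ?N = (c' \<circ>\<^sub>v (id2 C q' \<circ>\<^sub>h a)) \<circ>\<^sub>v ?N" .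
  then show ?thesis
    unfolding intertwines_def by (rule vcomp_right_cancel[rotated -1]) (use d in simp_all)
qed

lemma whisker_endo:
  assumes "endo a h" "h \<in> Arr C" "r \<in> Arr C" "l \<in> Arr C" "src1 C r = tgt1 C h" "src1 C h = tgt1 C l"
  shows "endo (whisker C r a l) (r \<cdot> (h \<cdot> l))"
  using assms by (simp add: endo_def whisker_def typing)

lemma whisker_vcomp:
  assumes "a \<in> Cell C" "b \<in> Cell C" "src2 C a = tgt2 C b" "r \<in> Arr C" "l \<in> Arr C"
    "src1 C r = tgt1 C (src2 C b)" "src1 C (src2 C b) = tgt1 C l"
  shows "whisker C r (a \<circ>\<^sub>v b) l = whisker C r a l \<circ>\<^sub>v whisker C r b l"
proof -
  have "src1 C (src2 C a) = tgt1 C l" using assms cell_ends[of b] by simp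
  then show ?thesis
    using assms by (simp add: whisker_def typing whisker_left_vcomp whisker_right_vcomp)
qed

lemma whisker_whisker:
  assumes "a \<in> Cell C" "r1 \<in> Arr C" "l1 \<in> Arr C" "r2 \<in> Arr C" "l2 \<in> Arr C"
    "src1 C r1 = tgt1 C (src2 C a)" "src1 C (src2 C a) = tgt1 C l1"
    "src1 C r2 = tgt1 C r1" "src1 C l1 = tgt1 C l2"
  shows "whisker C r2 (whisker C r1 a l1) l2 = whisker C (r2 \<cdot> r1) a (l1 \<cdot> l2)"
  using assms by (simp add: whisker_def typing hcomp_assoc hcomp_id2[symmetric])

text \<open>
  Conjugation is handled through the equation on the left, which composes and whiskers without inverses.
\<close>

lemma conjugate_iff:
  assumes "\<phi> \<in> Cell C" "endo a (src2 C \<phi>)" "endo b (tgt2 C \<phi>)"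
  shows "b \<circ>\<^sub>v \<phi> = \<phi> \<circ>\<^sub>v a \<longleftrightarrow> b = \<phi> \<circ>\<^sub>v a \<circ>\<^sub>v inv2 C \<phi>"
proof
  note d = assms[unfolded endo_def]
  assume eq: "b \<circ>\<^sub>v \<phi> = \<phi> \<circ>\<^sub>v a"
  have "b = b \<circ>\<^sub>v \<phi> \<circ>\<^sub>v inv2 C \<phi>"
    using d vcomp_unit[of b] by (simp add: inv2_props)
  also have "\<dots> = (b \<circ>\<^sub>v \<phi>) \<circ>\<^sub>v inv2 C \<phi>"
    using d by (intro vcomp_assoc[symmetric]) (simp_all add: inv2_props)
  also have "\<dots> = \<phi> \<circ>\<^sub>v a \<circ>\<^sub>v inv2 C \<phi>"
    unfolding eq using d by (intro vcomp_assoc) (simp_all add: inv2_props)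
  finally show "b = \<phi> \<circ>\<^sub>v a \<circ>\<^sub>v inv2 C \<phi>" .
next
  note d = assms[unfolded endo_def]
  assume eq: "b = \<phi> \<circ>\<^sub>v a \<circ>\<^sub>v inv2 C \<phi>"
  show "b \<circ>\<^sub>v \<phi> = \<phi> \<circ>\<^sub>v a"
    unfolding eq using d vcomp_unit[of a] by (simp add: vcomp_assoc inv2_props typing)
qed

lemma conjugate_endo:
  assumes "\<phi> \<in> Cell C" "endo a (src2 C \<phi>)"
  shows "endo (\<phi> \<circ>\<^sub>v a \<circ>\<^sub>v inv2 C \<phi>) (tgt2 C \<phi>)"
  using assms by (simp add: endo_def typing inv2_props)

text \<open>
  Conjugating by \<open>\<phi>\<close> and then by \<open>\<psi>\<close> has the same effect as conjugating by \<open>\<theta>\<close> when \<open>\<psi> \<circ> \<phi>\<close> and \<open>\<theta>\<close>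
  differ only by cells \<open>\<rho>\<close> and \<open>lam\<close> that sit to the right and to the left of \<open>h\<close>: these commute with an
  endomorphism of \<open>h\<close> and can be cancelled.
\<close>

lemma conjugation_compose:
  assumes arrs: "h \<in> Arr C" "r1 \<in> Arr C" "l1 \<in> Arr C" "r2 \<in> Arr C" "l2 \<in> Arr C"
    and ends: "src1 C r1 = tgt1 C h" "src1 C h = tgt1 C l1" "src1 C r2 = tgt1 C r1" "src1 C l1 = tgt1 C l2"
    and \<phi>: "\<phi> \<in> Cell C" "src2 C \<phi> = r1 \<cdot> (h \<cdot> l1)" "tgt2 C \<phi> = k"
    and \<psi>: "\<psi> \<in> Cell C" "src2 C \<psi> = r2 \<cdot> (k \<cdot> l2)" "tgt2 C \<psi> = m"
    and \<theta>: "\<theta> \<in> Cell C" "src2 C \<theta> = r3 \<cdot> (h \<cdot> l3)" "tgt2 C \<theta> = m"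
    and \<rho>: "\<rho> \<in> Cell C" "src2 C \<rho> = r2 \<cdot> r1" "tgt2 C \<rho> = r3"
    and lam: "lam \<in> Cell C" "src2 C lam = l1 \<cdot> l2" "tgt2 C lam = l3"
    and eq: "\<psi> \<circ>\<^sub>v whisker C r2 \<phi> l2 = \<theta> \<circ>\<^sub>v (\<rho> \<circ>\<^sub>h id2 C h \<circ>\<^sub>h lam)"
    and "endo a h" "endo b k" "endo c m"
    and b: "b \<circ>\<^sub>v \<phi> = \<phi> \<circ>\<^sub>v whisker C r1 a l1" and c: "c \<circ>\<^sub>v \<psi> = \<psi> \<circ>\<^sub>v whisker C r2 b l2"
  shows "c \<circ>\<^sub>v \<theta> = \<theta> \<circ>\<^sub>v whisker C r3 a l3"
proof -
  note [simp] = typing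
  have k: "k \<in> Arr C" "src1 C k = src1 C l1" "tgt1 C k = tgt1 C r1"
    using cell_arr[OF \<phi>(1)] cell_globular[OF \<phi>(1)] \<phi> arrs ends by simp_all
  have r3: "r3 \<in> Arr C" "src1 C r3 = src1 C r1" "tgt1 C r3 = tgt1 C r2"
    using cell_arr[OF \<rho>(1)] cell_globular[OF \<rho>(1)] \<rho> arrs ends by simp_all
  have l3: "l3 \<in> Arr C" "src1 C l3 = src1 C l2" "tgt1 C l3 = tgt1 C l1"
    using cell_arr[OF lam(1)] cell_globular[OF lam(1)] lam arrs ends by simp_all
  note a = \<open>endo a h\<close>[unfolded endo_def] and b' = \<open>endo b k\<close>[unfolded endo_def]
    and c' = \<open>endo c m\<close>[unfolded endo_def]
  note d = arrs ends \<phi> \<psi> \<theta> \<rho> lam k r3 l3 a b' c'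
  let ?E = "\<rho> \<circ>\<^sub>h id2 C h \<circ>\<^sub>h lam" and ?\<Phi> = "whisker C r2 \<phi> l2" and ?A = "whisker C r1 a l1"
  let ?A2 = "whisker C (r2 \<cdot> r1) a (l1 \<cdot> l2)" and ?A3 = "whisker C r3 a l3"
  have E: "?E \<in> Cell C" "src2 C ?E = (r2 \<cdot> r1) \<cdot> (h \<cdot> (l1 \<cdot> l2))" "tgt2 C ?E = r3 \<cdot> (h \<cdot> l3)"
    using d by simp_all
  have \<Phi>: "?\<Phi> \<in> Cell C" "src2 C ?\<Phi> = r2 \<cdot> ((r1 \<cdot> (h \<cdot> l1)) \<cdot> l2)" "tgt2 C ?\<Phi> = r2 \<cdot> (k \<cdot> l2)"
    using d by (simp_all add: whisker_def)
  have same: "(r2 \<cdot> r1) \<cdot> (h \<cdot> (l1 \<cdot> l2)) = r2 \<cdot> ((r1 \<cdot> (h \<cdot> l1)) \<cdot> l2)"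
    using d by (simp add: comp1_assoc)
  have A: "endo ?A (r1 \<cdot> (h \<cdot> l1))" "endo ?A2 ((r2 \<cdot> r1) \<cdot> (h \<cdot> (l1 \<cdot> l2)))" "endo ?A3 (r3 \<cdot> (h \<cdot> l3))"
    using d \<open>endo a h\<close> by (simp_all add: whisker_endo)
  have B: "endo (whisker C r2 b l2) (r2 \<cdot> (k \<cdot> l2))"
    using d \<open>endo b k\<close> by (simp add: whisker_endo)
  have 1: "whisker C r2 b l2 \<circ>\<^sub>v ?\<Phi> = ?\<Phi> \<circ>\<^sub>v ?A2"
  proof -
    have "whisker C r2 b l2 \<circ>\<^sub>v ?\<Phi> = whisker C r2 (b \<circ>\<^sub>v \<phi>) l2"
      using d by (intro whisker_vcomp[symmetric]) simp_all
    also have "\<dots> = ?\<Phi> \<circ>\<^sub>v whisker C r2 ?A l2"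
      unfolding b using d A(1) by (intro whisker_vcomp) (simp_all add: endo_def)
    also have "whisker C r2 ?A l2 = ?A2"
      using d by (intro whisker_whisker) simp_all
    finally show ?thesis .
  qed
  have 2: "?E \<circ>\<^sub>v ?A2 = ?A3 \<circ>\<^sub>v ?E"
  proof -
    have "?E \<circ>\<^sub>v ?A2 = \<rho> \<circ>\<^sub>h a \<circ>\<^sub>h lam"
      using d interchange[of "id2 C (r2 \<cdot> r1)" \<rho> "a \<circ>\<^sub>h id2 C (l1 \<cdot> l2)" "id2 C h \<circ>\<^sub>h lam"]
        interchange[of a "id2 C h" "id2 C (l1 \<cdot> l2)" lam]
        vcomp_unit[of \<rho>] vcomp_unit[of a] vcomp_unit[of lam]
      by (simp add: whisker_def)
    also have "\<dots> = ?A3 \<circ>\<^sub>v ?E"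
      using d interchange[of \<rho> "id2 C r3" "id2 C h \<circ>\<^sub>h lam" "a \<circ>\<^sub>h id2 C l3"]
        interchange[of "id2 C h" a lam "id2 C l3"]
        vcomp_unit[of \<rho>] vcomp_unit[of a] vcomp_unit[of lam]
      by (simp add: whisker_def)
    finally show ?thesis .
  qed
  note cells = E[unfolded same] \<Phi> A[unfolded endo_def same] B[unfolded endo_def] \<psi> \<theta> c'
  have "(c \<circ>\<^sub>v \<theta>) \<circ>\<^sub>v ?E = c \<circ>\<^sub>v (\<psi> \<circ>\<^sub>v ?\<Phi>)"
    unfolding eq using cells by (intro vcomp_assoc) simp_all
  also have "\<dots> = (c \<circ>\<^sub>v \<psi>) \<circ>\<^sub>v ?\<Phi>"
    using cells by (intro vcomp_assoc[symmetric]) simp_all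
  also have "\<dots> = \<psi> \<circ>\<^sub>v (whisker C r2 b l2 \<circ>\<^sub>v ?\<Phi>)"
    unfolding c using cells by (intro vcomp_assoc) simp_all
  also have "\<dots> = (\<psi> \<circ>\<^sub>v ?\<Phi>) \<circ>\<^sub>v ?A2"
    unfolding 1 using cells by (intro vcomp_assoc[symmetric]) simp_all
  also have "\<dots> = \<theta> \<circ>\<^sub>v (?E \<circ>\<^sub>v ?A2)"
    unfolding eq using cells by (intro vcomp_assoc) simp_all
  also have "\<dots> = (\<theta> \<circ>\<^sub>v ?A3) \<circ>\<^sub>v ?E"
    unfolding 2 using cells by (intro vcomp_assoc[symmetric]) simp_all
  finally show ?thesis
    by (rule vcomp_right_cancel[rotated -1]) (use cells in simp_all)
qed

end

lemma (in strict_2functor) map_whisker: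
  assumes "a \<in> Cell A" "r \<in> Arr A" "l \<in> Arr A" "src1 A r = tgt1 A (src2 A a)"
    "src1 A (src2 A a) = tgt1 A l"
  shows "on_cell F (whisker A r a l) = whisker B (on_arr F r) (on_cell F a) (on_arr F l)"
  using assms by (simp add: whisker_def A.typing map_hcomp map_id2)

lemma (in pseudonatural) naturality_square:
  assumes "h \<in> Arr A"
  shows "strict_2category.square B (t_obj t (src1 A h)) (t_obj t (tgt1 A h)) (on_arr F h) (on_arr G h)
    (t_arr t h)"
  unfolding F.B.square_def
  using assms comp_arr[OF assms] comp_obj F.map_arr[OF assms] G.map_arr[OF assms] F.A.arr_obj[OF assms]
  by auto

section \<open>Light-cone coordinates; paths and regions as graphs\<close>

text \<open>
  Light-cone coordinates: \<open>a\<close> grows to the upper left and \<open>b\<close> to the upper right.  Future-right moving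
  segments have constant \<open>a\<close> and growing \<open>b\<close>, past-right moving ones have constant \<open>b\<close> and falling \<open>a\<close>.
\<close>

definition lightcone :: "real \<Rightarrow> real \<Rightarrow> point" where
  "lightcone a b = (b - a, a + b)"

lemma lightcone_eq_iff [simp]: "lightcone a b = lightcone a' b' \<longleftrightarrow> a = a' \<and> b = b'"
  by (auto simp: lightcone_def)

lemma lightcone_cases: obtains a b where "p = lightcone a b"
  by (rule that[of "(snd p - fst p) / 2" "(snd p + fst p) / 2"]) (simp add: lightcone_def prod_eq_iff field_simps)

lemma lightcone_add:
  "lightcone a b + s *\<^sub>R (1, 1) = lightcone a (b + s)"
  "lightcone a b + s *\<^sub>R (-1, 1) = lightcone (a + s) b"
  "lightcone a b + s *\<^sub>R (1, -1) = lightcone (a - s) b"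
  by (auto simp: lightcone_def)

lemma closed_segment_lightcone:
  "b \<le> b' \<Longrightarrow> closed_segment (lightcone a b) (lightcone a b') = lightcone a ` {b..b'}"
  "a' \<le> a \<Longrightarrow> closed_segment (lightcone a b) (lightcone a' b) = (\<lambda>x. lightcone x b) ` {a'..a}"
proof -
  have 1: "(\<lambda>u. (1 - u) *\<^sub>R lightcone a b + u *\<^sub>R lightcone a b') = lightcone a \<circ> (\<lambda>u. (1 - u) *\<^sub>R b + u *\<^sub>R b')"
    for a b b' by (auto simp: lightcone_def algebra_simps)
  have 2: "(\<lambda>u. (1 - u) *\<^sub>R lightcone a b + u *\<^sub>R lightcone a' b) = (\<lambda>x. lightcone x b) \<circ> (\<lambda>u. (1 - u) *\<^sub>R a + u *\<^sub>R a')"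
    for a a' b by (auto simp: lightcone_def algebra_simps)
  show "closed_segment (lightcone a b) (lightcone a b') = lightcone a ` {b..b'}" if "b \<le> b'"
    using closed_segment_eq_real_ivl[of b b'] that
    unfolding closed_segment_image_interval 1 image_comp[symmetric] by simp
  show "closed_segment (lightcone a b) (lightcone a' b) = (\<lambda>x. lightcone x b) ` {a'..a}" if "a' \<le> a"
    using closed_segment_eq_real_ivl[of a a'] that
    unfolding closed_segment_image_interval 2 image_comp[symmetric] by (cases "a = a'") auto
qed

abbreviation rise :: "real \<Rightarrow> real \<Rightarrow> real \<Rightarrow> path" where
  "rise a b b' \<equiv> seg (lightcone a b) (lightcone a b')"

abbreviation fall :: "real \<Rightarrow> real \<Rightarrow> real \<Rightarrow> path" where
  "fall b a a' \<equiv> seg (lightcone a b) (lightcone a' b)"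

lemma rise_paths: "b \<le> b' \<Longrightarrow> rise a b b' \<in> paths"
  by (intro seg_paths) (auto simp: lightlike_right_def lightcone_def intro!: exI[of _ "b' - b"])

lemma fall_paths: "a' \<le> a \<Longrightarrow> fall b a a' \<in> paths"
  by (intro seg_paths) (auto simp: lightlike_right_def lightcone_def intro!: exI[of _ "a - a'"])

lemma seg_ends [simp]: "fst (seg p q) = p" "snd (snd (seg p q)) = q"
  by (simp_all add: seg_def)

lemma concat_path_ends [simp]:
  "fst (concat_path \<delta> \<gamma>) = fst \<gamma>" "snd (snd (concat_path \<delta> \<gamma>)) = snd (snd \<delta>)"
  by (simp_all add: concat_path_def)

lemma concat_path_const_seg: "concat_path (const_path q) (seg p q) = seg p q"
  by (auto simp: concat_path_def const_path_def seg_def)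

lemma polygon_3: "polygon [p, q, r] = concat_path (seg q r) (seg p q)"
  by (simp add: concat_path_const_seg)

lemma rise_rise:
  assumes "b \<le> b'" "b' \<le> b''"
  shows "concat_path (rise a b' b'') (rise a b b') = rise a b b''"
proof -
  have "{b..b''} = {b..b'} \<union> {b'..b''}" using assms by auto
  then have "lightcone a ` {b..b''} = lightcone a ` {b..b'} \<union> lightcone a ` {b'..b''}" by (metis image_Un)
  then show ?thesis using assms by (simp add: concat_path_def seg_def closed_segment_lightcone)
qed

lemma fall_fall:
  assumes "a'' \<le> a'" "a' \<le> a"
  shows "concat_path (fall b a' a'') (fall b a a') = fall b a a''"
proof -
  have "{a''..a} = {a'..a} \<union> {a''..a'}" using assms by auto
  then have "(\<lambda>x. lightcone x b) ` {a''..a} = (\<lambda>x. lightcone x b) ` {a'..a} \<union> (\<lambda>x. lightcone x b) ` {a''..a'}"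
    by (metis image_Un)
  then show ?thesis using assms by (simp add: concat_path_def seg_def closed_segment_lightcone)
qed

lemma rise_rise_assoc: "b \<le> b' \<Longrightarrow> b' \<le> b'' \<Longrightarrow>
    concat_path (rise a b' b'') (concat_path (rise a b b') \<gamma>) = concat_path (rise a b b'') \<gamma>"
  by (metis rise_rise concat_path_assoc)

text \<open>
  For \<open>a0 < a1\<close> and \<open>b0 < b1\<close>, the bottom, left, right and top vertices are at \<open>(a0, b0)\<close>, \<open>(a1, b0)\<close>, \<open>(a0, b1)\<close> and \<open>(a1, b1)\<close> in
  light-cone coordinates.
\<close>

definition diamond :: "real \<Rightarrow> real \<Rightarrow> real \<Rightarrow> real \<Rightarrow> point set" where
  "diamond a0 a1 b0 b1 = interior (causal_future (lightcone a0 b0) \<inter> causal_past (lightcone a1 b1))"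

lemma lightcone_in_rectangle:
  "lightcone a b \<in> causal_future (lightcone a0 b0) \<inter> causal_past (lightcone a1 b1) \<longleftrightarrow>
    a0 \<le> a \<and> a \<le> a1 \<and> b0 \<le> b \<and> b \<le> b1"
  by (auto simp: causal_past_def causal_future_eq lightcone_def)

lemma rectangle_subsetD:
  assumes "causal_future (lightcone a0 b0) \<inter> causal_past (lightcone a1 b1) \<subseteq>
      causal_future (lightcone a0' b0') \<inter> causal_past (lightcone a1' b1')" "a0 \<le> a1" "b0 \<le> b1"
  shows "a0' \<le> a0" "a1 \<le> a1'" "b0' \<le> b0" "b1 \<le> b1'"
proof -
  have "lightcone a0 b0 \<in> causal_future (lightcone a0' b0') \<inter> causal_past (lightcone a1' b1')"
    "lightcone a1 b1 \<in> causal_future (lightcone a0' b0') \<inter> causal_past (lightcone a1' b1')"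
    using assms lightcone_in_rectangle by blast+
  then show "a0' \<le> a0" "a1 \<le> a1'" "b0' \<le> b0" "b1 \<le> b1'"
    by (simp_all only: lightcone_in_rectangle)
qed

lemma causal_subset_diamond:
  assumes "a0 < a1" "b0 < b1"
  shows "causal_subset (diamond a0 a1 b0 b1)"
proof -
  let ?S = "{p. 2 * a0 < snd p - fst p \<and> snd p - fst p < 2 * a1 \<and>
    2 * b0 < snd p + fst p \<and> snd p + fst p < 2 * (b1 :: real)}"
  have "?S \<subseteq> diamond a0 a1 b0 b1"
    unfolding diamond_def
  proof (rule interior_maximal)
    show "?S \<subseteq> causal_future (lightcone a0 b0) \<inter> causal_past (lightcone a1 b1)"
      by (auto simp: causal_past_def causal_future_eq lightcone_def)
    show "open ?S"
      by (intro open_Collect_conj open_Collect_less continuous_intros)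
  qed
  moreover have "lightcone ((a0 + a1) / 2) ((b0 + b1) / 2) \<in> ?S"
    using assms by (simp add: lightcone_def field_simps)
  ultimately have "diamond a0 a1 b0 b1 \<noteq> {}" by blast
  then show ?thesis
    unfolding causal_subset_def diamond_def by blast
qed

text \<open>
  A convex open set is the interior of its closure, so a causal subset can be recovered from the four
  corners of its closure.
\<close>

lemma causal_subsetE:
  assumes "causal_subset U"
  obtains a0 a1 b0 b1 where "a0 < a1" "b0 < b1" "U = diamond a0 a1 b0 b1"
    "closure U = causal_future (lightcone a0 b0) \<inter> causal_past (lightcone a1 b1)"
    "bottom_vertex U = lightcone a0 b0" "top_vertex U = lightcone a1 b1"
    "left_corner U = lightcone a1 b0" "right_corner U = lightcone a0 b1"
proof -
  from assms obtain m \<alpha> \<beta> where pos: "0 < \<alpha>" "0 < \<beta>" and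
    cl: "closure U = causal_future m \<inter> causal_past (m + \<alpha> *\<^sub>R (-1, 1) + \<beta> *\<^sub>R (1, 1))" and
    c: "bottom_vertex U = m" "top_vertex U = m + \<alpha> *\<^sub>R (-1, 1) + \<beta> *\<^sub>R (1, 1)"
    "left_corner U = m + \<alpha> *\<^sub>R (-1, 1)" "right_corner U = m + \<beta> *\<^sub>R (1, 1)"
    by (rule causal_subset_corners)
  obtain a b where m: "m = lightcone a b" by (rule lightcone_cases)
  have "convex U" "open U"
    using assms unfolding causal_subset_def
    by (auto intro!: convex_interior convex_Int convex_causal_future convex_causal_past)
  then have "U = interior (closure U)"
    by (simp add: convex_interior_closure interior_open)
  then have "U = diamond a (a + \<alpha>) b (b + \<beta>)"
    unfolding diamond_def cl m lightcone_add by simp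
  then show thesis
    using that[of a "a + \<alpha>" b "b + \<beta>"] pos cl c unfolding m lightcone_add by simp
qed

lemma diamond_props:
  assumes "a0 < a1" "b0 < b1"
  shows "closure (diamond a0 a1 b0 b1) = causal_future (lightcone a0 b0) \<inter> causal_past (lightcone a1 b1)"
    "bottom_vertex (diamond a0 a1 b0 b1) = lightcone a0 b0" "top_vertex (diamond a0 a1 b0 b1) = lightcone a1 b1"
    "left_corner (diamond a0 a1 b0 b1) = lightcone a1 b0" "right_corner (diamond a0 a1 b0 b1) = lightcone a0 b1"
proof -
  let ?D = "causal_future (lightcone a0 b0) \<inter> causal_past (lightcone a1 b1)"
  let ?U = "diamond a0 a1 b0 b1"
  from causal_subset_diamond[OF assms] obtain c0 c1 d0 d1 where c: "c0 < c1" "d0 < d1"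
    "closure ?U = causal_future (lightcone c0 d0) \<inter> causal_past (lightcone c1 d1)"
    "bottom_vertex ?U = lightcone c0 d0" "top_vertex ?U = lightcone c1 d1"
    "left_corner ?U = lightcone c1 d0" "right_corner ?U = lightcone c0 d1"
    by (rule causal_subsetE)
  have "?U \<noteq> {}" using causal_subset_diamond[OF assms] by (simp add: causal_subset_def)
  then have cl: "closure ?U = ?D"
    unfolding diamond_def
    by (metis convex_closure_interior closure_closed closed_Int closed_causal_future
        closed_causal_past convex_Int convex_causal_future convex_causal_past)
  then have "c0 = a0" "c1 = a1" "d0 = b0" "d1 = b1"
    using c(1-3) assms rectangle_subsetD[of c0 d0 c1 d1 a0 b0 a1 b1]
      rectangle_subsetD[of a0 b0 a1 b1 c0 d0 c1 d1] by auto
  with c cl show "closure ?U = ?D" "bottom_vertex ?U = lightcone a0 b0" "top_vertex ?U = lightcone a1 b1"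
    "left_corner ?U = lightcone a1 b0" "right_corner ?U = lightcone a0 b1" by auto
qed

lemma diamond_subset_iff:
  assumes "a0' < a1'" "b0' < b1'" "a0 < a1" "b0 < b1"
  shows "diamond a0' a1' b0' b1' \<subseteq> diamond a0 a1 b0 b1 \<longleftrightarrow>
    a0 \<le> a0' \<and> a1' \<le> a1 \<and> b0 \<le> b0' \<and> b1' \<le> b1"
proof
  assume "diamond a0' a1' b0' b1' \<subseteq> diamond a0 a1 b0 b1"
  then have "closure (diamond a0' a1' b0' b1') \<subseteq> closure (diamond a0 a1 b0 b1)"
    by (rule closure_mono)
  then show "a0 \<le> a0' \<and> a1' \<le> a1 \<and> b0 \<le> b0' \<and> b1' \<le> b1"
    using assms rectangle_subsetD[of a0' b0' a1' b1' a0 b0 a1 b1] by (simp add: diamond_props)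
next
  assume "a0 \<le> a0' \<and> a1' \<le> a1 \<and> b0 \<le> b0' \<and> b1' \<le> b1"
  then show "diamond a0' a1' b0' b1' \<subseteq> diamond a0 a1 b0 b1"
    unfolding diamond_def
    by (intro interior_mono) (auto simp: causal_past_def causal_future_eq lightcone_def)
qed

lemma boundaries_diamond:
  assumes "a0 < a1" "b0 < b1"
  shows "future_boundary (diamond a0 a1 b0 b1) = concat_path (fall b1 a1 a0) (rise a1 b0 b1)"
    "past_boundary (diamond a0 a1 b0 b1) = concat_path (rise a0 b0 b1) (fall b0 a1 a0)"
  by (simp_all only: future_boundary_def past_boundary_def polygon_3 diamond_props[OF assms])

definition graph_path :: "(real \<Rightarrow> real) \<Rightarrow> real \<Rightarrow> real \<Rightarrow> path" where
  "graph_path \<phi> x0 x1 = ((x0, \<phi> x0), (\<lambda>x. (x, \<phi> x)) ` {x0..x1}, (x1, \<phi> x1))"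

definition graph_region :: "(real \<Rightarrow> real) \<Rightarrow> (real \<Rightarrow> real) \<Rightarrow> real \<Rightarrow> real \<Rightarrow> region" where
  "graph_region \<phi> \<psi> x0 x1 =
    (graph_path \<phi> x0 x1, {(x, t). x0 \<le> x \<and> x \<le> x1 \<and> \<psi> x \<le> t \<and> t \<le> \<phi> x}, graph_path \<psi> x0 x1)"

lemma graph_path_cong:
  "x0 \<le> x1 \<Longrightarrow> (\<And>x. x0 \<le> x \<Longrightarrow> x \<le> x1 \<Longrightarrow> \<phi> x = \<psi> x) \<Longrightarrow> graph_path \<phi> x0 x1 = graph_path \<psi> x0 x1"
  by (auto simp: graph_path_def)

lemma graph_path_proj:
  "fst (graph_path \<phi> x0 x1) = (x0, \<phi> x0)" "snd (snd (graph_path \<phi> x0 x1)) = (x1, \<phi> x1)"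
  "(x, t) \<in> fst (snd (graph_path \<phi> x0 x1)) \<longleftrightarrow> x0 \<le> x \<and> x \<le> x1 \<and> t = \<phi> x"
  by (auto simp: graph_path_def)

lemma graph_path_eqD:
  assumes eq: "graph_path \<phi> x0 x1 = graph_path \<psi> y0 y1"
  shows "x0 = y0" "x1 = y1" "x0 \<le> x \<Longrightarrow> x \<le> x1 \<Longrightarrow> \<phi> x = \<psi> x"
proof -
  show "x0 = y0"
    using arg_cong[OF eq, of fst] unfolding graph_path_proj by (rule Pair_inject)
  show "x1 = y1"
    using arg_cong[OF eq, of "\<lambda>\<gamma>. snd (snd \<gamma>)"] unfolding graph_path_proj by (rule Pair_inject)
  show "\<phi> x = \<psi> x" if "x0 \<le> x" "x \<le> x1"
  proof -
    have "(x, \<phi> x) \<in> fst (snd (graph_path \<phi> x0 x1))" using that by (simp add: graph_path_proj)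
    then show ?thesis unfolding eq graph_path_proj by simp
  qed
qed

lemma concat_graph_path:
  assumes "x0 \<le> x1" "x1 \<le> x2" "\<phi> x1 = \<psi> x1"
  shows "concat_path (graph_path \<psi> x1 x2) (graph_path \<phi> x0 x1) =
    graph_path (\<lambda>x. if x \<le> x1 then \<phi> x else \<psi> x) x0 x2"
proof -
  have "(\<lambda>x. (x, if x \<le> x1 then \<phi> x else \<psi> x)) ` {x0..x2} =
      (\<lambda>x. (x, \<phi> x)) ` {x0..x1} \<union> (\<lambda>x. (x, \<psi> x)) ` {x1..x2}"
    using assms by (auto simp: image_iff order_less_imp_le not_le)
  then show ?thesis
    using assms by (auto simp: concat_path_def graph_path_def)
qed

lemma rise_graph:
  assumes "b \<le> b'"
  shows "rise a b b' = graph_path (\<lambda>x. x + 2 * a) (b - a) (b' - a)"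
proof -
  have "lightcone a ` {b..b'} = (\<lambda>x. (x, x + 2 * a)) ` (\<lambda>y. y - a) ` {b..b'}"
    unfolding image_image by (intro image_cong) (auto simp: lightcone_def)
  then show ?thesis
    using assms by (simp add: seg_def closed_segment_lightcone graph_path_def image_minus_const_atLeastAtMost')
      (simp add: lightcone_def)
qed

lemma fall_graph:
  assumes "a' \<le> a"
  shows "fall b a a' = graph_path (\<lambda>x. 2 * b - x) (b - a) (b - a')"
proof -
  have "(\<lambda>x. lightcone x b) ` {a'..a} = (\<lambda>x. (x, 2 * b - x)) ` (\<lambda>y. b - y) ` {a'..a}"
    unfolding image_image by (intro image_cong) (auto simp: lightcone_def)
  then show ?thesis
    using assms by (simp add: seg_def closed_segment_lightcone graph_path_def) (simp add: lightcone_def)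
qed

lemma path_graph:
  assumes "\<gamma> \<in> paths"
  obtains \<phi> x0 x1 where "x0 \<le> x1" "\<gamma> = graph_path \<phi> x0 x1"
proof -
  have "\<exists>\<phi> x0 x1. x0 \<le> x1 \<and> \<gamma> = graph_path \<phi> x0 x1"
    using assms
  proof induction
    case (const p)
    have "const_path p = graph_path (\<lambda>_. snd p) (fst p) (fst p)"
      by (simp add: const_path_def graph_path_def)
    then show ?case by (metis order.refl)
  next
    case (step \<gamma> q r)
    then obtain \<phi> x0 x1 where \<phi>: "x0 \<le> x1" "\<gamma> = graph_path \<phi> x0 x1" by blast
    obtain a b where q: "q = lightcone a b" by (rule lightcone_cases)
    obtain \<psi> x2 where \<psi>: "x1 \<le> x2" "\<phi> x1 = \<psi> x1" "seg q r = graph_path \<psi> x1 x2"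
    proof -
      have "(x1, \<phi> x1) = (b - a, a + b)"
        using step.hyps(2) unfolding \<phi>(2) q lightcone_def graph_path_proj .
      then have x1: "x1 = b - a" "\<phi> x1 = a + b" by blast+
      have join: "\<phi> (b - a) = a + b" using x1 by simp
      from step.hyps(3) obtain s where s: "s \<ge> 0" "r = lightcone a (b + s) \<or> r = lightcone (a - s) b"
        unfolding lightlike_right_def q lightcone_add by blast
      from s(2) show thesis
      proof
        assume "r = lightcone a (b + s)"
        then show thesis
          using s(1) join rise_graph[of b "b + s" a] that[of "b + s - a" "\<lambda>x. x + 2 * a"]
          unfolding q x1(1) by simp
      next
        assume "r = lightcone (a - s) b"
        then show thesis
          using s(1) join fall_graph[of "a - s" a b] that[of "b - (a - s)" "\<lambda>x. 2 * b - x"]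
          unfolding q x1(1) by simp
      qed
    qed
    then have "concat_path (seg q r) \<gamma> = graph_path (\<lambda>x. if x \<le> x1 then \<phi> x else \<psi> x) x0 x2"
      unfolding \<phi>(2) \<psi>(3) by (intro concat_graph_path \<phi>(1))
    moreover have "x0 \<le> x2" using \<phi>(1) \<psi>(1) by simp
    ultimately show ?case by blast
  qed
  then show thesis using that by blast
qed

lemma boundaries_graph:
  assumes "a0 < a1" "b0 < b1"
  shows "future_boundary (diamond a0 a1 b0 b1) =
      graph_path (\<lambda>x. if x \<le> b1 - a1 then x + 2 * a1 else 2 * b1 - x) (b0 - a1) (b1 - a0)"
    "past_boundary (diamond a0 a1 b0 b1) =
      graph_path (\<lambda>x. if x \<le> b0 - a0 then 2 * b0 - x else x + 2 * a0) (b0 - a1) (b1 - a0)"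
  using assms by (simp_all add: boundaries_diamond rise_graph fall_graph concat_graph_path)

text \<open>
  The condition on two graphs to be the future and the past boundary of a region.  Equality at the
  end points is what makes two regions meet in a single point when they are glued side by side.
\<close>

definition graph_pair :: "(real \<Rightarrow> real) \<Rightarrow> (real \<Rightarrow> real) \<Rightarrow> real \<Rightarrow> real \<Rightarrow> bool" where
  "graph_pair \<phi> \<psi> x0 x1 \<longleftrightarrow> x0 \<le> x1 \<and> \<phi> x0 = \<psi> x0 \<and> \<phi> x1 = \<psi> x1 \<and>
     (\<forall>x. x0 \<le> x \<longrightarrow> x \<le> x1 \<longrightarrow> \<psi> x \<le> \<phi> x)"

lemma graph_pairD:
  assumes "graph_pair \<phi> \<psi> x0 x1"
  shows "x0 \<le> x1" "\<phi> x0 = \<psi> x0" "\<phi> x1 = \<psi> x1" "x0 \<le> x \<Longrightarrow> x \<le> x1 \<Longrightarrow> \<psi> x \<le> \<phi> x"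
  using assms by (auto simp: graph_pair_def)

lemma graph_region_diamond:
  fixes a0 a1 b0 b1 :: real
  assumes "a0 < a1" "b0 < b1"
  defines "U \<equiv> diamond a0 a1 b0 b1"
    and "\<phi> \<equiv> \<lambda>x. if x \<le> b1 - a1 then x + 2 * a1 else 2 * b1 - x"
    and "\<psi> \<equiv> \<lambda>x. if x \<le> b0 - a0 then 2 * b0 - x else x + 2 * a0"
  shows "(future_boundary U, closure U, past_boundary U) = graph_region \<phi> \<psi> (b0 - a1) (b1 - a0)"
    "graph_pair \<phi> \<psi> (b0 - a1) (b1 - a0)"
proof -
  have "(x, t) \<in> closure U \<longleftrightarrow> b0 - a1 \<le> x \<and> x \<le> b1 - a0 \<and> \<psi> x \<le> t \<and> t \<le> \<phi> x" for x t
    unfolding U_def \<phi>_def \<psi>_def diamond_props[OF assms(1,2)]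
    using assms(1,2) by (auto simp: causal_past_def causal_future_eq lightcone_def split: if_splits)
  then have "closure U = {(x, t). b0 - a1 \<le> x \<and> x \<le> b1 - a0 \<and> \<psi> x \<le> t \<and> t \<le> \<phi> x}"
    by auto
  then show "(future_boundary U, closure U, past_boundary U) = graph_region \<phi> \<psi> (b0 - a1) (b1 - a0)"
    unfolding graph_region_def U_def boundaries_graph[OF assms(1,2)] \<phi>_def \<psi>_def by simp
  show "graph_pair \<phi> \<psi> (b0 - a1) (b1 - a0)"
    using assms(1,2) unfolding graph_pair_def \<phi>_def \<psi>_def by auto
qed

lemma graph_region_vglue:
  assumes R: "graph_pair \<phi> \<psi> x0 x1" and S: "graph_pair \<phi>' \<psi>' y0 y1"
    and joint: "fst (graph_region \<phi>' \<psi>' y0 y1) = snd (snd (graph_region \<phi> \<psi> x0 x1))"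
  shows "vglue (graph_region \<phi>' \<psi>' y0 y1) (graph_region \<phi> \<psi> x0 x1) = graph_region \<phi> \<psi>' x0 x1"
    "graph_pair \<phi> \<psi>' x0 x1"
proof -
  have "graph_path \<phi>' y0 y1 = graph_path \<psi> x0 x1"
    using joint by (simp add: graph_region_def)
  note eq = graph_path_eqD[OF this]
  note R = graph_pairD[OF R] and S = graph_pairD[OF S, unfolded eq(1,2)]
  have "(x0 \<le> x \<and> x \<le> x1 \<and> \<psi> x \<le> t \<and> t \<le> \<phi> x) \<or> (x0 \<le> x \<and> x \<le> x1 \<and> \<psi>' x \<le> t \<and> t \<le> \<phi>' x)
      \<longleftrightarrow> x0 \<le> x \<and> x \<le> x1 \<and> \<psi>' x \<le> t \<and> t \<le> \<phi> x" for x t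
    using R(4)[of x] S(4)[of x] eq(3)[of x] eq(1,2)
    by (cases "x0 \<le> x \<and> x \<le> x1") auto
  then show "vglue (graph_region \<phi>' \<psi>' y0 y1) (graph_region \<phi> \<psi> x0 x1) = graph_region \<phi> \<psi>' x0 x1"
    unfolding vglue_def graph_region_def eq(1,2) by auto
  have "\<phi>' x = \<psi> x" if "x0 \<le> x" "x \<le> x1" for x
    using that eq by simp
  then show "graph_pair \<phi> \<psi>' x0 x1"
    using R S unfolding graph_pair_def by (metis order.refl order.trans)
qed

lemma graph_region_hglue:
  fixes \<phi> \<psi> \<phi>' \<psi>' :: "real \<Rightarrow> real" and x0 x1 y0 y1 :: real
  assumes R: "graph_pair \<phi> \<psi> x0 x1" and S: "graph_pair \<phi>' \<psi>' y0 y1"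
    and joint: "fst (fst (graph_region \<phi>' \<psi>' y0 y1)) = snd (snd (fst (graph_region \<phi> \<psi> x0 x1)))"
  defines "\<Phi> \<equiv> \<lambda>x. if x \<le> x1 then \<phi> x else \<phi>' x" and "\<Psi> \<equiv> \<lambda>x. if x \<le> x1 then \<psi> x else \<psi>' x"
  shows "hglue (graph_region \<phi>' \<psi>' y0 y1) (graph_region \<phi> \<psi> x0 x1) = graph_region \<Phi> \<Psi> x0 y1"
    "graph_pair \<Phi> \<Psi> x0 y1"
proof -
  note R = graph_pairD[OF R] and S = graph_pairD[OF S]
  have "(y0, \<phi>' y0) = (x1, \<phi> x1)"
    using joint unfolding graph_region_def fst_conv graph_path_proj .
  then have y0: "y0 = x1" and "\<phi>' x1 = \<phi> x1" by auto
  then have eq: "\<phi>' x1 = \<phi> x1" "\<psi>' x1 = \<phi> x1" "\<psi> x1 = \<phi> x1"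
    using R(3) S(2) by auto
  have "(x0 \<le> x \<and> x \<le> x1 \<and> \<psi> x \<le> t \<and> t \<le> \<phi> x) \<or> (x1 \<le> x \<and> x \<le> y1 \<and> \<psi>' x \<le> t \<and> t \<le> \<phi>' x)
      \<longleftrightarrow> x0 \<le> x \<and> x \<le> y1 \<and> \<Psi> x \<le> t \<and> t \<le> \<Phi> x" for x t
    using R(1) S(1) eq unfolding y0 \<Phi>_def \<Psi>_def
    by (cases x x1 rule: linorder_cases) auto
  then have "{(x, t). x0 \<le> x \<and> x \<le> x1 \<and> \<psi> x \<le> t \<and> t \<le> \<phi> x} \<union>
      {(x, t). x1 \<le> x \<and> x \<le> y1 \<and> \<psi>' x \<le> t \<and> t \<le> \<phi>' x} =
      {(x, t). x0 \<le> x \<and> x \<le> y1 \<and> \<Psi> x \<le> t \<and> t \<le> \<Phi> x}"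
    by auto
  moreover have "concat_path (graph_path \<phi>' x1 y1) (graph_path \<phi> x0 x1) = graph_path \<Phi> x0 y1"
    "concat_path (graph_path \<psi>' x1 y1) (graph_path \<psi> x0 x1) = graph_path \<Psi> x0 y1"
    using R(1) S(1) eq unfolding \<Phi>_def \<Psi>_def y0 by (simp_all add: concat_graph_path)
  ultimately show "hglue (graph_region \<phi>' \<psi>' y0 y1) (graph_region \<phi> \<psi> x0 x1) = graph_region \<Phi> \<Psi> x0 y1"
    by (simp add: hglue_def graph_region_def y0)
  show "graph_pair \<Phi> \<Psi> x0 y1"
    using R(1,2) S(1,3) R(4) S(4) eq unfolding graph_pair_def \<Phi>_def \<Psi>_def y0 by auto
qed

text \<open>
  Both kinds of gluing preserve this form: glued vertically, two regions share a graph that lies below the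
  upper and above the lower of the remaining ones; glued side by side, they share a single point.
\<close>

lemma region_graph:
  assumes "R \<in> regions"
  obtains \<phi> \<psi> x0 x1 where "graph_pair \<phi> \<psi> x0 x1" "R = graph_region \<phi> \<psi> x0 x1"
proof -
  have "\<exists>\<phi> \<psi> x0 x1. graph_pair \<phi> \<psi> x0 x1 \<and> R = graph_region \<phi> \<psi> x0 x1"
    using assms
  proof induction
    case (id \<gamma>)
    then obtain \<phi> x0 x1 where "x0 \<le> x1" "\<gamma> = graph_path \<phi> x0 x1" by (rule path_graph)
    then have "id_region \<gamma> = graph_region \<phi> \<phi> x0 x1" "graph_pair \<phi> \<phi> x0 x1"
      by (auto simp: id_region_def graph_region_def graph_path_def graph_pair_def)
    then show ?case by metis
  next
    case (causal U)
    then obtain a0 a1 b0 b1 where "a0 < a1" "b0 < b1" "U = diamond a0 a1 b0 b1"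
      by (rule causal_subsetE)
    then show ?case using graph_region_diamond by blast
  next
    case (vglue S R)
    then show ?case using graph_region_vglue by blast
  next
    case (hglue S R)
    then show ?case using graph_region_hglue by blast
  qed
  then show thesis using that by blast
qed

text \<open>
  There is at most one 2-morphism between two given paths.
\<close>

lemma regions_locally_thin:
  assumes "R \<in> regions" "S \<in> regions" "fst R = fst S" "snd (snd R) = snd (snd S)"
  shows "R = S"
proof -
  obtain \<phi> \<psi> x0 x1 where R: "R = graph_region \<phi> \<psi> x0 x1" using assms(1) by (rule region_graph)
  obtain \<phi>' \<psi>' y0 y1 where S: "S = graph_region \<phi>' \<psi>' y0 y1" using assms(2) by (rule region_graph)
  have "graph_path \<phi> x0 x1 = graph_path \<phi>' y0 y1" "graph_path \<psi> x0 x1 = graph_path \<psi>' y0 y1"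
    using assms R S by (simp_all add: graph_region_def)
  note eq = graph_path_eqD[OF this(1)] graph_path_eqD[OF this(2)]
  have "x0 \<le> x \<and> x \<le> x1 \<and> \<psi> x \<le> t \<and> t \<le> \<phi> x \<longleftrightarrow> y0 \<le> x \<and> x \<le> y1 \<and> \<psi>' x \<le> t \<and> t \<le> \<phi>' x" for x t
    using eq(1,2) eq(3)[of x] eq(6)[of x] by auto
  then have "fst (snd R) = fst (snd S)"
    unfolding R S graph_region_def by simp
  with assms show ?thesis by (simp add: prod_eq_iff)
qed

text \<open>
  The two boundaries are recovered from the region as the highest and lowest points over each space
  coordinate.
\<close>

lemma regions_eq_if_same_points:
  assumes "R \<in> regions" "S \<in> regions" "fst (snd R) = fst (snd S)"
  shows "R = S"
proof -
  obtain \<phi> \<psi> x0 x1 where pR: "graph_pair \<phi> \<psi> x0 x1" and R: "R = graph_region \<phi> \<psi> x0 x1"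
    using assms(1) by (rule region_graph)
  obtain \<phi>' \<psi>' y0 y1 where pS: "graph_pair \<phi>' \<psi>' y0 y1" and S: "S = graph_region \<phi>' \<psi>' y0 y1"
    using assms(2) by (rule region_graph)
  note pR = graph_pairD[OF pR] and pS = graph_pairD[OF pS]
  have iff: "x0 \<le> x \<and> x \<le> x1 \<and> \<psi> x \<le> t \<and> t \<le> \<phi> x \<longleftrightarrow> y0 \<le> x \<and> x \<le> y1 \<and> \<psi>' x \<le> t \<and> t \<le> \<phi>' x"
    for x t
    using assms(3) unfolding R S graph_region_def by (auto simp: set_eq_iff)
  have ends: "x0 = y0" "x1 = y1"
    using pR(1-3) pS(1-3) iff[of x0 "\<phi> x0"] iff[of x1 "\<phi> x1"] iff[of y0 "\<phi>' y0"] iff[of y1 "\<phi>' y1"]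
    by auto
  have "\<phi> x = \<phi>' x \<and> \<psi> x = \<psi>' x" if "x0 \<le> x" "x \<le> x1" for x
    using that ends pR(4)[of x] pS(4)[of x]
      iff[of x "\<phi> x"] iff[of x "\<phi>' x"] iff[of x "\<psi> x"] iff[of x "\<psi>' x"] by auto
  then have "fst R = fst S" "snd (snd R) = snd (snd S)"
    using pR(1) ends unfolding R S graph_region_def by (auto intro: graph_path_cong)
  with assms(3) show ?thesis by (simp add: prod_eq_iff)
qed

lemma region_points_between:
  assumes "R \<in> regions"
  shows "fst (snd R) = between (fst R) (snd (snd R))"
proof -
  obtain \<phi> \<psi> x0 x1 where R: "R = graph_region \<phi> \<psi> x0 x1" using assms by (rule region_graph)
  show ?thesis
    unfolding R between_def graph_region_def fst_conv snd_conv graph_path_proj by auto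
qed

section \<open>The regions of inclusions and their symmetries\<close>

text \<open>
  Since regions are determined by their boundary, the existence of a region between two paths is all there
  is to know about 2-morphisms; it is a preorder that is compatible with concatenation.
\<close>

definition fills :: "path \<Rightarrow> path \<Rightarrow> bool" where
  "fills \<gamma> \<gamma>' \<longleftrightarrow> (\<gamma>, between \<gamma> \<gamma>', \<gamma>') \<in> regions"

lemma fills_region: "R \<in> regions \<Longrightarrow> fills (fst R) (snd (snd R))"
  using region_points_between[of R] by (cases R) (simp add: fills_def)

lemma fills_refl: "\<gamma> \<in> paths \<Longrightarrow> fills \<gamma> \<gamma>"
  using fills_region[OF regions.id[of \<gamma>]] by (simp add: id_region_def)

lemma fills_trans:
  assumes "fills \<gamma> \<gamma>'" "fills \<gamma>' \<gamma>''"
  shows "fills \<gamma> \<gamma>''"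
  using fills_region[OF regions.vglue[OF assms(2,1)[unfolded fills_def]]] by (simp add: vglue_def)

lemma fills_concat:
  assumes "fills \<delta> \<delta>'" "fills \<gamma> \<gamma>'" "fst \<delta> = snd (snd \<gamma>)"
  shows "fills (concat_path \<delta> \<gamma>) (concat_path \<delta>' \<gamma>')"
  using fills_region[OF regions.hglue[OF assms(1,2)[unfolded fills_def]]] assms(3)
  by (simp add: hglue_def)

text \<open>
  Rectangles generate all the regions below.  They are allowed to degenerate to a segment, which covers
  inclusions of causal subsets with common boundary points.
\<close>

lemma fills_rectangle:
  assumes "a0 \<le> a1" "b0 \<le> b1"
  shows "fills (concat_path (fall b1 a1 a0) (rise a1 b0 b1)) (concat_path (rise a0 b0 b1) (fall b0 a1 a0))"
proof -
  consider "a0 = a1" | "b0 = b1" | "a0 < a1" "b0 < b1" using assms by linarith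
  then show ?thesis
  proof cases
    case 1
    have "concat_path (fall b1 a1 a1) (rise a1 b0 b1) = rise a1 b0 b1"
      "concat_path (rise a1 b0 b1) (fall b0 a1 a1) = rise a1 b0 b1"
      using assms by (auto simp: concat_path_def seg_def closed_segment_lightcone)
    then show ?thesis using 1 assms fills_refl[OF rise_paths] by simp
  next
    case 2
    have "concat_path (fall b1 a1 a0) (rise a1 b1 b1) = fall b1 a1 a0"
      "concat_path (rise a0 b1 b1) (fall b1 a1 a0) = fall b1 a1 a0"
      using assms by (auto simp: concat_path_def seg_def closed_segment_lightcone)
    then show ?thesis using 2 assms fills_refl[OF fall_paths] by simp
  next
    case 3
    then show ?thesis
      using fills_region[OF regions.causal[OF causal_subset_diamond[OF 3]]]
      by (simp add: boundaries_diamond)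
  qed
qed

text \<open>
  The legs join the corners of \<open>U\<close> to those of \<open>V\<close> through the attaching points; they are the paths along
  which endomorphisms over \<open>V\<close> are whiskered.
\<close>

definition left_leg :: "point set \<Rightarrow> point set \<Rightarrow> path" where
  "left_leg V U = polygon [left_corner U, left_attach V U, left_corner V]"

definition right_leg :: "point set \<Rightarrow> point set \<Rightarrow> path" where
  "right_leg V U = polygon [right_corner V, right_attach V U, right_corner U]"

lemma attach_diamond:
  assumes "a0 \<le> a0'" "a0' < a1'" "a1' \<le> a1" "b0 \<le> b0'" "b0' < b1'" "b1' \<le> b1"
  defines "V \<equiv> diamond a0' a1' b0' b1'" and "U \<equiv> diamond a0 a1 b0 b1"
  shows "u \<in> closed_segment (left_corner U) (bottom_vertex U) \<and> (\<exists>s\<ge>0. left_corner V = u + s *\<^sub>R (1, 1))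
      \<longleftrightarrow> u = lightcone a1' b0" (is ?left)
    and "v \<in> closed_segment (bottom_vertex U) (right_corner U) \<and> (\<exists>s\<ge>0. v = right_corner V + s *\<^sub>R (1, -1))
      \<longleftrightarrow> v = lightcone a0 b1'" (is ?right)
proof -
  have ab: "a0 < a1" "b0 < b1" using assms(1-6) by auto
  note props = diamond_props[OF ab] diamond_props[OF assms(2,5)]
  show ?left
    unfolding U_def V_def props closed_segment_lightcone(2)[OF less_imp_le[OF ab(1)]]
    using assms(1-6) by (auto simp: lightcone_def intro!: exI[of _ "b0' - b0"])
  show ?right
    unfolding U_def V_def props closed_segment_lightcone(1)[OF less_imp_le[OF ab(2)]]
    using assms(1-6) by (auto simp: lightcone_def intro!: exI[of _ "a0' - a0"])
qed

lemma causal_inclusionE: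
  assumes "causal_subset V" "causal_subset U" "V \<subseteq> U"
  obtains a0 a0' a1' a1 b0 b0' b1' b1 where
    "a0 \<le> a0'" "a0' < a1'" "a1' \<le> a1" "b0 \<le> b0'" "b0' < b1'" "b1' \<le> b1"
    "V = diamond a0' a1' b0' b1'" "U = diamond a0 a1 b0 b1"
proof -
  obtain a0' a1' b0' b1' where V: "a0' < a1'" "b0' < b1'" "V = diamond a0' a1' b0' b1'"
    using assms(1) by (rule causal_subsetE)
  obtain a0 a1 b0 b1 where U: "a0 < a1" "b0 < b1" "U = diamond a0 a1 b0 b1"
    using assms(2) by (rule causal_subsetE)
  from assms(3) show thesis
    using that V U diamond_subset_iff[OF V(1,2) U(1,2)] by blast
qed

lemma attach_characterization:
  assumes "causal_subset V" "causal_subset U" "V \<subseteq> U"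
  shows "u = left_attach V U \<longleftrightarrow>
      u \<in> closed_segment (left_corner U) (bottom_vertex U) \<and> (\<exists>s\<ge>0. left_corner V = u + s *\<^sub>R (1, 1))"
    and "v = right_attach V U \<longleftrightarrow>
      v \<in> closed_segment (bottom_vertex U) (right_corner U) \<and> (\<exists>s\<ge>0. v = right_corner V + s *\<^sub>R (1, -1))"
proof -
  from assms obtain a0 a0' a1' a1 b0 b0' b1' b1 where
    "a0 \<le> a0'" "a0' < a1'" "a1' \<le> a1" "b0 \<le> b0'" "b0' < b1'" "b1' \<le> b1" and
    VU: "V = diamond a0' a1' b0' b1'" "U = diamond a0 a1 b0 b1"
    by (rule causal_inclusionE)
  note iff = attach_diamond[OF this(1-6)]
  show "u = left_attach V U \<longleftrightarrow>
      u \<in> closed_segment (left_corner U) (bottom_vertex U) \<and> (\<exists>s\<ge>0. left_corner V = u + s *\<^sub>R (1, 1))"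
    unfolding left_attach_def VU iff by simp
  show "v = right_attach V U \<longleftrightarrow>
      v \<in> closed_segment (bottom_vertex U) (right_corner U) \<and> (\<exists>s\<ge>0. v = right_corner V + s *\<^sub>R (1, -1))"
    unfolding right_attach_def VU iff by simp
qed

lemma inclusion_legs_diamond:
  assumes "a0 \<le> a0'" "a0' < a1'" "a1' \<le> a1" "b0 \<le> b0'" "b0' < b1'" "b1' \<le> b1"
  defines "V \<equiv> diamond a0' a1' b0' b1'" and "U \<equiv> diamond a0 a1 b0 b1"
  shows "left_attach V U = lightcone a1' b0" "right_attach V U = lightcone a0 b1'"
    "left_leg V U = concat_path (rise a1' b0 b0') (fall b0 a1 a1')"
    "right_leg V U = concat_path (rise a0 b1' b1) (fall b1' a0' a0)"
proof -
  have ab: "a0 < a1" "b0 < b1" using assms(1-6) by auto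
  note props = diamond_props[OF ab] diamond_props[OF assms(2,5)]
  show 1: "left_attach V U = lightcone a1' b0"
    unfolding left_attach_def U_def V_def attach_diamond[OF assms(1-6)] by simp
  show 2: "right_attach V U = lightcone a0 b1'"
    unfolding right_attach_def U_def V_def attach_diamond[OF assms(1-6)] by simp
  show "left_leg V U = concat_path (rise a1' b0 b0') (fall b0 a1 a1')"
    unfolding left_leg_def 1 polygon_3 unfolding U_def V_def props ..
  show "right_leg V U = concat_path (rise a0 b1' b1) (fall b1' a0' a0)"
    unfolding right_leg_def 2 polygon_3 unfolding U_def V_def props ..
qed

lemma legs_paths:
  assumes "causal_subset V" "causal_subset U" "V \<subseteq> U"
  shows "left_leg V U \<in> paths" "fst (left_leg V U) = left_corner U"
    "snd (snd (left_leg V U)) = left_corner V"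
    "right_leg V U \<in> paths" "fst (right_leg V U) = right_corner V"
    "snd (snd (right_leg V U)) = right_corner U"
proof -
  from assms obtain a0 a0' a1' a1 b0 b0' b1' b1 where
    ab: "a0 \<le> a0'" "a0' < a1'" "a1' \<le> a1" "b0 \<le> b0'" "b0' < b1'" "b1' \<le> b1" and
    VU: "V = diamond a0' a1' b0' b1'" "U = diamond a0 a1 b0 b1"
    by (rule causal_inclusionE)
  show "left_leg V U \<in> paths" "right_leg V U \<in> paths"
    unfolding VU inclusion_legs_diamond[OF ab] using ab
    by (auto intro!: concat_path_paths rise_paths fall_paths)
  show "fst (left_leg V U) = left_corner U" "snd (snd (left_leg V U)) = left_corner V"
    "fst (right_leg V U) = right_corner V" "snd (snd (right_leg V U)) = right_corner U"
    unfolding left_leg_def right_leg_def polygon_3 by simp_all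
qed

lemma past_boundary_props:
  assumes "causal_subset U"
  shows "past_boundary U \<in> paths" "fst (past_boundary U) = left_corner U"
    "snd (snd (past_boundary U)) = right_corner U"
  using boundaries_paths[OF assms] by (simp_all add: past_boundary_def polygon_3 del: polygon.simps)

text \<open>
  The region is L-shaped and consists of two rectangles.  One lies between the lower left side of \<open>V\<close> and
  that of \<open>U\<close>.  The other lies between the extended lower right side of \<open>V\<close> and that of \<open>U\<close>, and reaches
  from the bottom of \<open>U\<close> to the right corner of \<open>V\<close> and the attaching point next to it.
\<close>

lemma inclusion_region_props:
  assumes "causal_subset V" "causal_subset U" "V \<subseteq> U"
  shows "inclusion_region V U \<in> regions"
    "fst (inclusion_region V U) =
      concat_path (right_leg V U) (concat_path (past_boundary V) (left_leg V U))"
    "snd (snd (inclusion_region V U)) = past_boundary U"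
proof -
  from assms obtain a0 a0' a1' a1 b0 b0' b1' b1 where
    ab: "a0 \<le> a0'" "a0' < a1'" "a1' \<le> a1" "b0 \<le> b0'" "b0' < b1'" "b1' \<le> b1" and
    VU: "V = diamond a0' a1' b0' b1'" "U = diamond a0 a1 b0 b1"
    by (rule causal_inclusionE)
  have ab': "a0 < a1" "b0 < b1" using ab by auto
  note props = diamond_props[OF ab'] diamond_props[OF ab(2,5)] inclusion_legs_diamond[OF ab]
    boundaries_diamond[OF ab'] boundaries_diamond[OF ab(2,5)]
  \<comment> \<open>The middle path follows the lower left side of \<open>U\<close> until it meets the extended lower right
  side of \<open>V\<close>, and then follows the latter to the right corner of \<open>V\<close>.\<close>
  let ?upper = "concat_path (fall b1' a0' a0) (concat_path (rise a0' b0' b1')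
      (concat_path (fall b0' a1' a0') (rise a1' b0 b0')))"
  let ?middle = "concat_path (fall b1' a0' a0) (concat_path (rise a0' b0 b1') (fall b0 a1' a0'))"
  let ?lower = "concat_path (rise a0 b0 b1') (fall b0 a1' a0)"
  have upper: "polygon [left_attach V U, left_corner V, bottom_vertex V, right_corner V,
      right_attach V U] = ?upper"
    unfolding VU props by (simp add: concat_path_const_seg concat_path_assoc)
  have lower: "polygon [left_attach V U, bottom_vertex U, right_attach V U] = ?lower"
    unfolding VU props by (simp add: concat_path_const_seg)
  have "fills ?upper (concat_path (fall b1' a0' a0) (concat_path (rise a0' b0' b1')
      (concat_path (rise a0' b0 b0') (fall b0 a1' a0'))))"
    using ab by (intro fills_concat fills_refl fills_rectangle rise_paths fall_paths) simp_all
  then have "fills ?upper ?middle"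
    using ab by (simp add: rise_rise_assoc)
  moreover have "fills (concat_path (concat_path (fall b1' a0' a0) (rise a0' b0 b1')) (fall b0 a1' a0'))
      (concat_path (concat_path (rise a0 b0 b1') (fall b0 a0' a0)) (fall b0 a1' a0'))"
    using ab by (intro fills_concat fills_refl fills_rectangle rise_paths fall_paths) simp_all
  then have "fills ?middle ?lower"
    using ab by (simp add: concat_path_assoc fall_fall)
  ultimately have "fills ?upper ?lower" by (rule fills_trans)
  then have R: "(?upper, between ?upper ?lower, ?lower) \<in> regions" by (simp add: fills_def)
  have eq: "inclusion_region V U = hglue (id_region (rise a0 b1' b1))
      (hglue (?upper, between ?upper ?lower, ?lower) (id_region (fall b0 a1 a1')))"
    unfolding inclusion_region_def Let_def upper lower whisker_def unfolding VU props
    by (simp add: P2_def)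
  show "inclusion_region V U \<in> regions"
    unfolding eq using ab
    by (intro regions.hglue regions.id R rise_paths fall_paths) (simp_all add: id_region_def hglue_def)
  show "fst (inclusion_region V U) =
      concat_path (right_leg V U) (concat_path (past_boundary V) (left_leg V U))"
    unfolding eq unfolding VU props by (simp add: hglue_def id_region_def concat_path_assoc)
  show "snd (snd (inclusion_region V U)) = past_boundary U"
    unfolding eq unfolding VU props using ab
    by (simp add: hglue_def id_region_def concat_path_assoc rise_rise_assoc fall_fall)
qed

lemma legs_self:
  assumes "causal_subset U"
  shows "left_leg U U = const_path (left_corner U)" "right_leg U U = const_path (right_corner U)"
proof -
  obtain a0 a1 b0 b1 where "a0 < a1" "b0 < b1" and U: "U = diamond a0 a1 b0 b1"
    using assms by (rule causal_subsetE)
  note ab = order.refl[of a0] this(1) order.refl[of a1] order.refl[of b0] this(2) order.refl[of b1]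
  show "left_leg U U = const_path (left_corner U)" "right_leg U U = const_path (right_corner U)"
    unfolding U inclusion_legs_diamond[OF ab] diamond_props[OF ab(2,5)]
    by (simp_all add: concat_path_def seg_def const_path_def)
qed

text \<open>
  For \<open>W \<subseteq> V \<subseteq> U\<close> the composite left leg runs through the left corner of \<open>V\<close>, above the direct one; a
  single rectangle with this corner as its top lies between them.  On the right it is the same.
\<close>

lemma legs_compose:
  assumes "causal_subset W" "causal_subset V" "causal_subset U" "W \<subseteq> V" "V \<subseteq> U"
  shows "fills (concat_path (left_leg W V) (left_leg V U)) (left_leg W U)"
    "fills (concat_path (right_leg V U) (right_leg W V)) (right_leg W U)"
proof -
  obtain c0 c1 d0 d1 where W: "c0 < c1" "d0 < d1" "W = diamond c0 c1 d0 d1"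
    using assms(1) by (rule causal_subsetE)
  obtain a0' a1' b0' b1' where V: "a0' < a1'" "b0' < b1'" "V = diamond a0' a1' b0' b1'"
    using assms(2) by (rule causal_subsetE)
  obtain a0 a1 b0 b1 where U: "a0 < a1" "b0 < b1" "U = diamond a0 a1 b0 b1"
    using assms(3) by (rule causal_subsetE)
  have wv: "a0' \<le> c0" "c1 \<le> a1'" "b0' \<le> d0" "d1 \<le> b1'"
    using assms(4) diamond_subset_iff[OF W(1,2) V(1,2)] W V by auto
  have vu: "a0 \<le> a0'" "a1' \<le> a1" "b0 \<le> b0'" "b1' \<le> b1"
    using assms(5) diamond_subset_iff[OF V(1,2) U(1,2)] U V by auto
  have wu: "a0 \<le> c0" "c1 \<le> a1" "b0 \<le> d0" "d1 \<le> b1"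
    using wv vu by auto
  note legs = inclusion_legs_diamond[OF wv(1) W(1) wv(2,3) W(2) wv(4)]
    inclusion_legs_diamond[OF vu(1) V(1) vu(2,3) V(2) vu(4)]
    inclusion_legs_diamond[OF wu(1) W(1) wu(2,3) W(2) wu(4)]
  note ineqs = W(1,2) V(1,2) U(1,2) wv vu
  have "fills (concat_path (rise c1 b0' d0) (concat_path (concat_path (fall b0' a1' c1) (rise a1' b0 b0'))
        (fall b0 a1 a1')))
      (concat_path (rise c1 b0' d0) (concat_path (concat_path (rise c1 b0 b0') (fall b0 a1' c1)) (fall b0 a1 a1')))"
    using ineqs by (intro fills_concat fills_refl fills_rectangle rise_paths fall_paths) simp_all
  then show "fills (concat_path (left_leg W V) (left_leg V U)) (left_leg W U)"
    unfolding W(3) V(3) U(3) legs using ineqs by (simp add: concat_path_assoc rise_rise_assoc fall_fall)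
  have "fills (concat_path (rise a0 b1' b1) (concat_path (concat_path (fall b1' a0' a0) (rise a0' d1 b1'))
        (fall d1 c0 a0')))
      (concat_path (rise a0 b1' b1) (concat_path (concat_path (rise a0 d1 b1') (fall d1 a0' a0)) (fall d1 c0 a0')))"
    using ineqs by (intro fills_concat fills_refl fills_rectangle rise_paths fall_paths) simp_all
  then show "fills (concat_path (right_leg V U) (right_leg W V)) (right_leg W U)"
    unfolding W(3) V(3) U(3) legs using ineqs by (simp add: concat_path_assoc rise_rise_assoc fall_fall)
qed

text \<open>
  A path is itself a graph, so a path inside a graph is a piece of it; \<open>\<theta>\<close> is a simpler formula for \<open>\<psi>\<close> over
  this piece.
\<close>

lemma path_in_graph:
  assumes "\<gamma> \<in> paths" "fst (snd \<gamma>) \<subseteq> fst (snd (graph_path \<psi> y0 y1))"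
    "\<And>x. fst (fst \<gamma>) \<le> x \<Longrightarrow> x \<le> fst (snd (snd \<gamma>)) \<Longrightarrow> \<psi> x = \<theta> x"
  shows "\<gamma> = graph_path \<theta> (fst (fst \<gamma>)) (fst (snd (snd \<gamma>)))"
proof -
  obtain \<phi> x0 x1 where \<gamma>: "x0 \<le> x1" "\<gamma> = graph_path \<phi> x0 x1"
    using assms(1) by (rule path_graph)
  have "\<phi> x = \<theta> x" if "x0 \<le> x" "x \<le> x1" for x
  proof -
    have "(x, \<phi> x) \<in> fst (snd \<gamma>)"
      using that unfolding \<gamma>(2) by (simp add: graph_path_proj)
    with assms(2) have "(x, \<phi> x) \<in> fst (snd (graph_path \<psi> y0 y1))" by blast
    then show ?thesis
      using assms(3)[of x] that unfolding \<gamma>(2) by (simp add: graph_path_proj)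
  qed
  then show ?thesis
    unfolding \<gamma>(2) graph_path_proj fst_conv by (rule graph_path_cong[OF \<gamma>(1)])
qed

lemma past_points:
  assumes "a0 < a1" "b0 < b1"
  shows "lightcone a b \<in> fst (snd (past_boundary (diamond a0 a1 b0 b1))) \<longleftrightarrow>
    b = b0 \<and> a0 \<le> a \<and> a \<le> a1 \<or> a = a0 \<and> b0 \<le> b \<and> b \<le> b1"
  using assms by (auto simp: boundaries_diamond concat_path_def seg_def closed_segment_lightcone)

text \<open>
  A path with a corner is not contained in a straight segment, so the corner of the inner path must lie at
  the corner of the outer one.
\<close>

lemma past_boundary_subset_bottom:
  assumes "causal_subset V" "causal_subset U"
    "fst (snd (past_boundary V)) \<subseteq> fst (snd (past_boundary U))"
  shows "bottom_vertex V = bottom_vertex U"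
proof -
  obtain a0' a1' b0' b1' where V: "a0' < a1'" "b0' < b1'" "V = diamond a0' a1' b0' b1'"
    using assms(1) by (rule causal_subsetE)
  obtain a0 a1 b0 b1 where U: "a0 < a1" "b0 < b1" "U = diamond a0 a1 b0 b1"
    using assms(2) by (rule causal_subsetE)
  have "lightcone a0' b0' \<in> fst (snd (past_boundary U))" "lightcone a1' b0' \<in> fst (snd (past_boundary U))"
    "lightcone a0' b1' \<in> fst (snd (past_boundary U))"
    using assms(3) V past_points[OF V(1,2)] by (auto intro!: subsetD[OF assms(3)])
  then show ?thesis
    using V U by (auto simp: past_points diamond_props)
qed

text \<open>
  What is used of a diffeomorphism that respects the causal structure.
\<close>

locale causal_symmetry =
  fixes g :: "point \<Rightarrow> point"
  assumes inj: "inj g"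
    and closure_image: "closure (g ` U) = g ` closure U"
    and causal_image: "causal_subset U \<Longrightarrow> causal_subset (g ` U)"
    and two_functor: "strict_2functor P2 P2 (P2_map g)"
begin

lemma image_path_paths: "\<gamma> \<in> paths \<Longrightarrow> image_path g \<gamma> \<in> paths"
  using strict_2functor.map_arr[OF two_functor, of \<gamma>] by (simp add: P2_def P2_map_def)

lemma image_region_regions: "R \<in> regions \<Longrightarrow> image_region g R \<in> regions"
  using strict_2functor.map_cell[OF two_functor, of R] by (simp add: P2_def P2_map_def)

text \<open>
  The image of the region of \<open>U\<close> is a region with the same points as the region of \<open>g ` U\<close>, and there is
  only one such region.
\<close>

lemma image_causal_region:
  assumes "causal_subset U"
  shows "image_region g (future_boundary U, closure U, past_boundary U) =
    (future_boundary (g ` U), closure (g ` U), past_boundary (g ` U))"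
  using image_region_regions[OF regions.causal[OF assms]] regions.causal[OF causal_image[OF assms]]
  by (rule regions_eq_if_same_points) (simp add: image_region_def closure_image)

lemma image_past_boundary:
  "causal_subset U \<Longrightarrow> image_path g (past_boundary U) = past_boundary (g ` U)"
  using image_causal_region[of U] by (simp add: image_region_def)

lemma image_corners:
  assumes "causal_subset U"
  shows "g (left_corner U) = left_corner (g ` U)" "g (right_corner U) = right_corner (g ` U)"
  using arg_cong[OF image_past_boundary[OF assms], of fst]
    arg_cong[OF image_past_boundary[OF assms], of "\<lambda>\<gamma>. snd (snd \<gamma>)"]
    past_boundary_props[OF assms] past_boundary_props[OF causal_image[OF assms]]
  by (simp_all add: image_path_def)

text \<open>
  Let \<open>g p\<close> be the bottom of \<open>g ` U\<close>.  A causal subset \<open>V \<subseteq> U\<close> with the bottom of \<open>U\<close> has its past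
  boundary inside that of \<open>U\<close>.  The same holds for the images, so \<open>g ` V\<close> has the bottom \<open>g p\<close> as well, and
  \<open>p\<close> lies on the past boundary of \<open>V\<close>.  Only the bottom of \<open>U\<close> lies on all these past boundaries.
\<close>

lemma image_bottom:
  assumes "causal_subset U"
  shows "g (bottom_vertex U) = bottom_vertex (g ` U)"
proof -
  obtain a0 a1 b0 b1 where U: "a0 < a1" "b0 < b1" "U = diamond a0 a1 b0 b1"
    using assms by (rule causal_subsetE)
  have pts: "g ` fst (snd (past_boundary V)) = fst (snd (past_boundary (g ` V)))"
    if "causal_subset V" for V
    using image_past_boundary[OF that] unfolding image_path_def by (metis fst_conv snd_conv)
  have bottom_in: "bottom_vertex V \<in> fst (snd (past_boundary V))" if V: "causal_subset V" for V
  proof -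
    obtain c0 c1 d0 d1 where "c0 < c1" "d0 < d1" "V = diamond c0 c1 d0 d1"
      using V by (rule causal_subsetE)
    then show ?thesis by (simp add: diamond_props past_points)
  qed
  \<comment> \<open>The bottom of \<open>g ` U\<close> lies on its past boundary, which is the image of that of \<open>U\<close>.\<close>
  obtain p where p: "p \<in> fst (snd (past_boundary U))" "bottom_vertex (g ` U) = g p"
    using bottom_in[OF causal_image[OF assms]] unfolding pts[OF assms, symmetric] by blast
  have smaller: "p \<in> fst (snd (past_boundary (diamond a0 c b0 d)))"
    if c: "a0 < c" "c \<le> a1" and d: "b0 < d" "d \<le> b1" for c d
  proof -
    let ?V = "diamond a0 c b0 d"
    have V: "causal_subset ?V" using c d by (simp add: causal_subset_diamond)
    have "q \<in> fst (snd (past_boundary U))" if "q \<in> fst (snd (past_boundary ?V))" for q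
      using that c d U by (cases q rule: lightcone_cases) (auto simp: past_points)
    then have "fst (snd (past_boundary (g ` ?V))) \<subseteq> fst (snd (past_boundary (g ` U)))"
      unfolding pts[OF V, symmetric] pts[OF assms, symmetric] by blast
    then have "bottom_vertex (g ` ?V) = g p"
      unfolding p(2)[symmetric]
      by (rule past_boundary_subset_bottom[OF causal_image[OF V] causal_image[OF assms]])
    then have "g p \<in> g ` fst (snd (past_boundary ?V))"
      using bottom_in[OF causal_image[OF V]] unfolding pts[OF V] by simp
    then show ?thesis using inj by (simp add: inj_image_mem_iff)
  qed
  obtain a b where ab: "p = lightcone a b" by (rule lightcone_cases)
  have "a \<le> a0"
  proof (rule ccontr)
    assume "\<not> a \<le> a0"
    then show False
      \<comment> \<open>A causal subset whose left side ends halfway between the bottom and \<open>p\<close> misses \<open>p\<close>.\<close>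
      using smaller[of "min a1 ((a0 + a) / 2)" b1] U(1,2) p(1)
      unfolding ab U(3) by (auto simp: past_points min_def split: if_splits)
  qed
  moreover have "b \<le> b0"
  proof (rule ccontr)
    assume "\<not> b \<le> b0"
    then show False
      using smaller[of a1 "min b1 ((b0 + b) / 2)"] U(1,2) p(1)
      unfolding ab U(3) by (auto simp: past_points min_def split: if_splits)
  qed
  ultimately have "p = bottom_vertex U"
    using p(1) U(1,2) unfolding ab U(3) by (auto simp: past_points diamond_props)
  then show ?thesis using p(2) by simp
qed

text \<open>
  A non-degenerate past-right moving segment is the lower left side of some causal subset, and its image is
  the piece of the past boundary of the image between left corner and bottom.
\<close>

lemma image_fall:
  assumes "a' \<le> a"
  shows "image_path g (fall b a a') = seg (g (lightcone a b)) (g (lightcone a' b))"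
    "\<exists>s\<ge>0. g (lightcone a' b) = g (lightcone a b) + s *\<^sub>R (1, -1)"
proof -
  have "image_path g (fall b a a') = seg (g (lightcone a b)) (g (lightcone a' b)) \<and>
    (\<exists>s\<ge>0. g (lightcone a' b) = g (lightcone a b) + s *\<^sub>R (1, -1))"
  proof (cases "a' = a")
    case True
    then show ?thesis by (auto simp: image_path_def seg_def zero_prod_def intro!: exI[of _ 0])
  next
    case False
    with assms have ab: "a' < a" "b < b + 1" by auto
    \<comment> \<open>The extent in the other direction is arbitrary.\<close>
    define U where "U = diamond a' a b (b + 1)"
    have U: "causal_subset U" unfolding U_def using ab by (rule causal_subset_diamond)
    obtain c0 c1 d0 d1 where c: "c0 < c1" "d0 < d1" and gU: "g ` U = diamond c0 c1 d0 d1"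
      using causal_image[OF U] by (rule causal_subsetE)
    have ends: "g (lightcone a b) = lightcone c1 d0" "g (lightcone a' b) = lightcone c0 d0"
      using image_corners(1)[OF U] image_bottom[OF U] unfolding gU diamond_props[OF c]
      unfolding U_def diamond_props[OF ab] .
    let ?\<gamma> = "image_path g (fall b a a')"
    have "fst (snd ?\<gamma>) \<subseteq> fst (snd (image_path g (past_boundary U)))"
      unfolding U_def boundaries_diamond[OF ab] by (auto simp: image_path_def concat_path_def)
    then have sub: "fst (snd ?\<gamma>) \<subseteq> fst (snd (graph_path
        (\<lambda>x. if x \<le> d0 - c0 then 2 * d0 - x else x + 2 * c0) (d0 - c1) (d1 - c0)))"
      unfolding image_past_boundary[OF U] gU boundaries_graph[OF c] .
    have "fst (fst ?\<gamma>) = d0 - c1" "fst (snd (snd ?\<gamma>)) = d0 - c0"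
      by (simp_all add: image_path_def ends) (simp_all add: lightcone_def)
    then have "?\<gamma> = graph_path (\<lambda>x. 2 * d0 - x) (d0 - c1) (d0 - c0)"
      using path_in_graph[OF image_path_paths[OF fall_paths[OF assms]] sub,
          of "\<lambda>x. 2 * d0 - x"] by simp
    then have "?\<gamma> = fall d0 c1 c0" using fall_graph[of c0 c1 d0] c by simp
    then show ?thesis
      unfolding ends using c by (auto simp: lightcone_def intro!: exI[of _ "c1 - c0"])
  qed
  then show "image_path g (fall b a a') = seg (g (lightcone a b)) (g (lightcone a' b))"
    "\<exists>s\<ge>0. g (lightcone a' b) = g (lightcone a b) + s *\<^sub>R (1, -1)" by blast+
qed

text \<open>
  A non-degenerate future-right moving segment is the lower right side of some causal subset, and its image
  is the piece of the past boundary of the image between bottom and right corner.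
\<close>

lemma image_rise:
  assumes "b \<le> b'"
  shows "image_path g (rise a b b') = seg (g (lightcone a b)) (g (lightcone a b'))"
    "\<exists>s\<ge>0. g (lightcone a b') = g (lightcone a b) + s *\<^sub>R (1, 1)"
proof -
  have "image_path g (rise a b b') = seg (g (lightcone a b)) (g (lightcone a b')) \<and>
    (\<exists>s\<ge>0. g (lightcone a b') = g (lightcone a b) + s *\<^sub>R (1, 1))"
  proof (cases "b = b'")
    case True
    then show ?thesis by (auto simp: image_path_def seg_def zero_prod_def intro!: exI[of _ 0])
  next
    case False
    with assms have ab: "a < a + 1" "b < b'" by auto
    define U where "U = diamond a (a + 1) b b'"
    have U: "causal_subset U" unfolding U_def using ab by (rule causal_subset_diamond)
    obtain c0 c1 d0 d1 where c: "c0 < c1" "d0 < d1" and gU: "g ` U = diamond c0 c1 d0 d1"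
      using causal_image[OF U] by (rule causal_subsetE)
    have ends: "g (lightcone a b) = lightcone c0 d0" "g (lightcone a b') = lightcone c0 d1"
      using image_bottom[OF U] image_corners(2)[OF U] unfolding gU diamond_props[OF c]
      unfolding U_def diamond_props[OF ab] .
    let ?\<gamma> = "image_path g (rise a b b')"
    have "fst (snd ?\<gamma>) \<subseteq> fst (snd (image_path g (past_boundary U)))"
      unfolding U_def boundaries_diamond[OF ab] by (auto simp: image_path_def concat_path_def)
    then have sub: "fst (snd ?\<gamma>) \<subseteq> fst (snd (graph_path
        (\<lambda>x. if x \<le> d0 - c0 then 2 * d0 - x else x + 2 * c0) (d0 - c1) (d1 - c0)))"
      unfolding image_past_boundary[OF U] gU boundaries_graph[OF c] .
    have "fst (fst ?\<gamma>) = d0 - c0" "fst (snd (snd ?\<gamma>)) = d1 - c0"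
      by (simp_all add: image_path_def ends) (simp_all add: lightcone_def)
    then have "?\<gamma> = graph_path (\<lambda>x. x + 2 * c0) (d0 - c0) (d1 - c0)"
      using path_in_graph[OF image_path_paths[OF rise_paths[OF assms]] sub,
          of "\<lambda>x. x + 2 * c0"] by simp
    then have "?\<gamma> = rise c0 d0 d1" using rise_graph[of d0 d1 c0] c by simp
    then show ?thesis
      unfolding ends using c by (auto simp: lightcone_def intro!: exI[of _ "d1 - d0"])
  qed
  then show "image_path g (rise a b b') = seg (g (lightcone a b)) (g (lightcone a b'))"
    "\<exists>s\<ge>0. g (lightcone a b') = g (lightcone a b) + s *\<^sub>R (1, 1)" by blast+
qed

lemma image_concat_path:
  "image_path g (concat_path \<delta> \<gamma>) = concat_path (image_path g \<delta>) (image_path g \<gamma>)"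
  by (simp add: image_path_def concat_path_def image_Un)

lemma image_points: "fst (snd (image_path g \<gamma>)) = g ` fst (snd \<gamma>)"
  by (simp add: image_path_def)

text \<open>
  The attaching points are characterised by lying on a side of \<open>U\<close> and being joined to a corner of \<open>V\<close> by a
  lightlike segment of given direction; both properties are preserved.
\<close>

lemma image_legs:
  assumes "causal_subset V" "causal_subset U" "V \<subseteq> U"
  shows "image_path g (left_leg V U) = left_leg (g ` V) (g ` U)"
    "image_path g (right_leg V U) = right_leg (g ` V) (g ` U)"
proof -
  from assms obtain a0 a0' a1' a1 b0 b0' b1' b1 where
    ab: "a0 \<le> a0'" "a0' < a1'" "a1' \<le> a1" "b0 \<le> b0'" "b0' < b1'" "b1' \<le> b1" and
    VU: "V = diamond a0' a1' b0' b1'" "U = diamond a0 a1 b0 b1"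
    by (rule causal_inclusionE)
  have ab': "a0 < a1" "b0 < b1" using ab by auto
  note corners = diamond_props[OF ab', folded VU] diamond_props[OF ab(2,5), folded VU]
  note attach = inclusion_legs_diamond(1,2)[OF ab, folded VU]
  have g: "causal_subset (g ` V)" "causal_subset (g ` U)" "g ` V \<subseteq> g ` U"
    using assms causal_image by auto
  have "lightcone a1' b0 \<in> closed_segment (lightcone a1 b0) (lightcone a0 b0)"
    using ab by (subst closed_segment_lightcone) auto
  then have "g (lightcone a1' b0) \<in> fst (snd (image_path g (fall b0 a1 a0)))"
    unfolding image_points seg_def by simp
  then have "g (lightcone a1' b0) \<in> closed_segment (left_corner (g ` U)) (bottom_vertex (g ` U))"
    unfolding image_fall(1)[OF less_imp_le[OF ab'(1)]]
    unfolding seg_def fst_conv snd_conv corners(2,4)[symmetric]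
      image_corners[OF assms(2)] image_bottom[OF assms(2)] .
  moreover have "\<exists>s\<ge>0. left_corner (g ` V) = g (lightcone a1' b0) + s *\<^sub>R (1, 1)"
    using image_rise(2)[OF ab(4), of a1'] unfolding corners(9)[symmetric] image_corners[OF assms(1)] .
  ultimately have left: "g (left_attach V U) = left_attach (g ` V) (g ` U)"
    unfolding attach attach_characterization[OF g] by blast
  have "lightcone a0 b1' \<in> closed_segment (lightcone a0 b0) (lightcone a0 b1)"
    using ab by (subst closed_segment_lightcone) auto
  then have "g (lightcone a0 b1') \<in> fst (snd (image_path g (rise a0 b0 b1)))"
    unfolding image_points seg_def by simp
  then have "g (lightcone a0 b1') \<in> closed_segment (bottom_vertex (g ` U)) (right_corner (g ` U))"
    unfolding image_rise(1)[OF less_imp_le[OF ab'(2)]]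
    unfolding seg_def fst_conv snd_conv corners(2,5)[symmetric]
      image_corners[OF assms(2)] image_bottom[OF assms(2)] .
  moreover have "\<exists>s\<ge>0. g (lightcone a0 b1') = right_corner (g ` V) + s *\<^sub>R (1, -1)"
    using image_fall(2)[OF ab(1), of b1'] unfolding corners(10)[symmetric] image_corners[OF assms(1)] .
  ultimately have right: "g (right_attach V U) = right_attach (g ` V) (g ` U)"
    unfolding attach attach_characterization[OF g] by blast
  show "image_path g (left_leg V U) = left_leg (g ` V) (g ` U)"
    unfolding left_leg_def polygon_3 image_concat_path left[symmetric]
      image_corners[OF assms(1), symmetric] image_corners[OF assms(2), symmetric]
    unfolding corners attach image_rise(1)[OF ab(4)] image_fall(1)[OF ab(3)] ..
  show "image_path g (right_leg V U) = right_leg (g ` V) (g ` U)"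
    unfolding right_leg_def polygon_3 image_concat_path right[symmetric]
      image_corners[OF assms(1), symmetric] image_corners[OF assms(2), symmetric]
    unfolding corners attach image_rise(1)[OF ab(6)] image_fall(1)[OF ab(1)] ..
qed

text \<open>
  Both sides are regions, and their boundaries agree.
\<close>

lemma image_inclusion_region:
  assumes "causal_subset V" "causal_subset U" "V \<subseteq> U"
  shows "image_region g (inclusion_region V U) = inclusion_region (g ` V) (g ` U)"
proof -
  have g: "causal_subset (g ` V)" "causal_subset (g ` U)" "g ` V \<subseteq> g ` U"
    using assms causal_image by auto
  have "fst (image_region g (inclusion_region V U)) = fst (inclusion_region (g ` V) (g ` U))"
    "snd (snd (image_region g (inclusion_region V U))) = snd (snd (inclusion_region (g ` V) (g ` U)))"
    unfolding image_region_def fst_conv snd_conv inclusion_region_props[OF assms]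
      inclusion_region_props[OF g] image_concat_path image_legs[OF assms]
      image_past_boundary[OF assms(1)] image_past_boundary[OF assms(2)] by simp_all
  then show ?thesis
    using image_region_regions inclusion_region_props(1)[OF assms] inclusion_region_props(1)[OF g]
    by (intro regions_locally_thin) auto
qed

end

lemma diffeomorphism_image_closure:
  assumes "diffeomorphism g"
  shows "closure (g ` U) = g ` closure U"
proof
  have bij: "bij g" and cont: "continuous_on UNIV g" "continuous_on UNIV (inv_into UNIV g)"
    using assms unfolding diffeomorphism_def by (metis C_diff.simps(1))+
  show "g ` closure U \<subseteq> closure (g ` U)"
    by (rule continuous_image_closure_subset[OF cont(1)]) simp
  have "inv_into UNIV g ` closure (g ` U) \<subseteq> closure (inv_into UNIV g ` g ` U)"
    by (rule continuous_image_closure_subset[OF cont(2)]) simp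
  also have "inv_into UNIV g ` g ` U = U"
    using bij by (simp add: bij_is_inj image_inv_f_f)
  finally have "g ` inv_into UNIV g ` closure (g ` U) \<subseteq> g ` closure U" by blast
  then show "closure (g ` U) \<subseteq> g ` closure U"
    using bij by (simp add: bij_is_surj image_f_inv_f)
qed

lemma (in causal_action) act_causal_symmetry:
  assumes "g \<in> carrier G"
  shows "causal_symmetry (act g)"
  using act_diffeomorphism[OF assms] act_causal[OF assms] act_2functor[OF assms]
    diffeomorphism_image_closure[of "act g"]
  by (simp add: causal_symmetry_def diffeomorphism_def bij_is_inj)

lemma (in causal_symmetry) net_pullback_is_net:
  assumes "net A"
  shows "net (net_pullback g A)"
proof -
  interpret net A by fact
  show ?thesis
    by (rule net.intro)
      (simp_all add: net_pullback_def causal_image image_mono alg_monoid incl_hom incl_id incl_comp)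
qed

section \<open>The net of a 2-functor\<close>

lemma P2_simps:
  "Obj P2 = UNIV" "Arr P2 = paths" "Cell P2 = regions" "src1 P2 = fst" "tgt1 P2 \<gamma> = snd (snd \<gamma>)"
  "src2 P2 = fst" "tgt2 P2 R = snd (snd R)" "id1 P2 = const_path" "id2 P2 = id_region"
  "comp1 P2 = concat_path" "vcomp P2 = vglue" "hcomp P2 = hglue"
  by (simp_all add: P2_def)

locale fqft = strict_2groupoid C + Z: strict_2functor P2 C Z
  for C :: "('o, 'm, 'c) two_category" (structure)
    and Z :: "(point, path, region, 'o, 'm, 'c) two_functor"
begin

lemma Z_path:
  assumes "\<gamma> \<in> paths"
  shows "on_arr Z \<gamma> \<in> Arr C" "src1 C (on_arr Z \<gamma>) = on_obj Z (fst \<gamma>)"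
    "tgt1 C (on_arr Z \<gamma>) = on_obj Z (snd (snd \<gamma>))"
  using Z.map_arr[of \<gamma>] assms by (simp_all add: P2_simps)

lemma Z_region:
  assumes "R \<in> regions"
  shows "on_cell Z R \<in> Cell C" "src2 C (on_cell Z R) = on_arr Z (fst R)"
    "tgt2 C (on_cell Z R) = on_arr Z (snd (snd R))"
  using Z.map_cell[of R] assms by (simp_all add: P2_simps)

lemma Z_concat:
  assumes "\<delta> \<in> paths" "\<gamma> \<in> paths" "fst \<delta> = snd (snd \<gamma>)"
  shows "on_arr Z (concat_path \<delta> \<gamma>) = on_arr Z \<delta> \<cdot> on_arr Z \<gamma>"
  using Z.map_comp1[of \<delta> \<gamma>] assms by (simp add: P2_simps)

lemma Z_inclusion:
  assumes "causal_subset V" "causal_subset U" "V \<subseteq> U"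
  shows "on_cell Z (inclusion_region V U) \<in> Cell C"
    "src2 C (on_cell Z (inclusion_region V U)) =
      on_arr Z (right_leg V U) \<cdot> (on_arr Z (past_boundary V) \<cdot> on_arr Z (left_leg V U))"
    "tgt2 C (on_cell Z (inclusion_region V U)) = on_arr Z (past_boundary U)"
  using Z_region[OF inclusion_region_props(1)[OF assms]] inclusion_region_props[OF assms]
    legs_paths[OF assms] past_boundary_props[OF assms(1)]
  by (simp_all add: Z_concat concat_path_paths)

lemma whisker_legs_endo:
  assumes "causal_subset V" "causal_subset U" "V \<subseteq> U" "endo a (on_arr Z (past_boundary V))"
  shows "endo (whisker C (on_arr Z (right_leg V U)) a (on_arr Z (left_leg V U)))
    (src2 C (on_cell Z (inclusion_region V U)))"
  unfolding Z_inclusion[OF assms(1-3)]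
  using legs_paths[OF assms(1-3)] past_boundary_props[OF assms(1)]
  by (intro whisker_endo[OF assms(4)]) (simp_all add: Z_path)

lemma alg_net_of: "alg (net_of C Z) U = End C (on_arr Z (past_boundary U))"
  by (simp add: net_of_def)

lemma incl_net_of:
  "incl (net_of C Z) V U a = on_cell Z (inclusion_region V U) \<circ>\<^sub>v
     whisker C (on_arr Z (right_leg V U)) a (on_arr Z (left_leg V U)) \<circ>\<^sub>v
     inv2 C (on_cell Z (inclusion_region V U))"
  by (simp add: net_of_def Let_def right_leg_def left_leg_def del: polygon.simps)

lemma incl_endo:
  assumes "causal_subset V" "causal_subset U" "V \<subseteq> U" "endo a (on_arr Z (past_boundary V))"
  shows "endo (incl (net_of C Z) V U a) (on_arr Z (past_boundary U))"
  using conjugate_endo[OF Z_inclusion(1)[OF assms(1-3)] whisker_legs_endo[OF assms]]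
  unfolding incl_net_of Z_inclusion(3)[OF assms(1-3)] .

text \<open>
  The structure maps of the net are only used through this characterisation by an equation.
\<close>

lemma incl_iff:
  assumes "causal_subset V" "causal_subset U" "V \<subseteq> U" "endo a (on_arr Z (past_boundary V))"
    "endo b (on_arr Z (past_boundary U))"
  shows "b \<circ>\<^sub>v on_cell Z (inclusion_region V U) = on_cell Z (inclusion_region V U) \<circ>\<^sub>v
      whisker C (on_arr Z (right_leg V U)) a (on_arr Z (left_leg V U))
    \<longleftrightarrow> b = incl (net_of C Z) V U a"
  unfolding incl_net_of
  using Z_inclusion[OF assms(1-3)] whisker_legs_endo[OF assms(1-4)] assms(5)
  by (intro conjugate_iff) simp_all

lemma incl_eq:
  assumes "causal_subset V" "causal_subset U" "V \<subseteq> U" "endo a (on_arr Z (past_boundary V))"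
  shows "incl (net_of C Z) V U a \<circ>\<^sub>v on_cell Z (inclusion_region V U) =
    on_cell Z (inclusion_region V U) \<circ>\<^sub>v
      whisker C (on_arr Z (right_leg V U)) a (on_arr Z (left_leg V U))"
  using incl_iff[OF assms incl_endo[OF assms]] by simp

text \<open>
  For \<open>W \<subseteq> V \<subseteq> U\<close> the region of \<open>V \<subseteq> U\<close> glued to the whiskered region of \<open>W \<subseteq> V\<close> has a boundary that
  differs from the boundary of the region of \<open>W \<subseteq> U\<close> by the legs.  Regions \<open>lam\<close> and \<open>\<rho>\<close> between the legs make up
  for the difference, and \<open>conjugation_compose\<close> applies.
\<close>

lemma net_of_is_net: "net (net_of C Z)"
proof (rule net.intro)
  fix U assume "causal_subset U"
  then show "Group.monoid (alg (net_of C Z) U)"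
    unfolding alg_net_of by (intro End_monoid Z_path past_boundary_props)
next
  fix V U assume VU: "causal_subset V" "causal_subset U" "V \<subseteq> U"
  let ?i = "incl (net_of C Z) V U" and ?\<phi> = "on_cell Z (inclusion_region V U)"
  let ?w = "\<lambda>a. whisker C (on_arr Z (right_leg V U)) a (on_arr Z (left_leg V U))"
  let ?h = "on_arr Z (past_boundary V)" and ?k = "on_arr Z (past_boundary U)"
  have h: "?h \<in> Arr C" and k: "?k \<in> Arr C"
    using VU by (auto intro!: Z_path past_boundary_props)
  note \<phi> = Z_inclusion[OF VU]
  note paths = legs_paths[OF VU] past_boundary_props[OF VU(1)]
  have "?i (a \<circ>\<^sub>v b) = ?i a \<circ>\<^sub>v ?i b" if ab: "endo a ?h" "endo b ?h" for a b
  proof -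
    note ia = incl_endo[OF VU ab(1)] and ib = incl_endo[OF VU ab(2)]
    note wa = whisker_legs_endo[OF VU ab(1)] and wb = whisker_legs_endo[OF VU ab(2)]
    note d = ia[unfolded endo_def] ib[unfolded endo_def] wa[unfolded endo_def] wb[unfolded endo_def] \<phi>(1,3)
    have "(?i a \<circ>\<^sub>v ?i b) \<circ>\<^sub>v ?\<phi> = ?i a \<circ>\<^sub>v (?i b \<circ>\<^sub>v ?\<phi>)"
      using d by (intro vcomp_assoc) simp_all
    also have "\<dots> = (?i a \<circ>\<^sub>v ?\<phi>) \<circ>\<^sub>v ?w b"
      unfolding incl_eq[OF VU ab(2)] using d by (intro vcomp_assoc[symmetric]) simp_all
    also have "\<dots> = ?\<phi> \<circ>\<^sub>v (?w a \<circ>\<^sub>v ?w b)"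
      unfolding incl_eq[OF VU ab(1)] using d by (intro vcomp_assoc) simp_all
    also have "?w a \<circ>\<^sub>v ?w b = ?w (a \<circ>\<^sub>v b)"
      using ab paths by (intro whisker_vcomp[symmetric]) (simp_all add: endo_def Z_path)
    finally show ?thesis
      using incl_iff[OF VU endo_vcomp[OF ab] endo_vcomp[OF ia ib]] by simp
  qed
  moreover have "?i (id2 C ?h) = id2 C ?k"
  proof -
    have "?w (id2 C ?h) = id2 C (src2 C ?\<phi>)"
      unfolding \<phi>(2) whisker_def using paths by (simp add: hcomp_id2 Z_path comp1_arr)
    then have "id2 C ?k \<circ>\<^sub>v ?\<phi> = ?\<phi> \<circ>\<^sub>v ?w (id2 C ?h)"
      using vcomp_unit[OF \<phi>(1)] \<phi>(3) by simp
    then show ?thesis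
      using incl_iff[OF VU endo_id2[OF h] endo_id2[OF k]] by simp
  qed
  ultimately show "?i \<in> hom (alg (net_of C Z) V) (alg (net_of C Z) U) \<and>
      ?i \<one>\<^bsub>alg (net_of C Z) V\<^esub> = \<one>\<^bsub>alg (net_of C Z) U\<^esub>"
    unfolding alg_net_of hom_def using incl_endo[OF VU]
    by (auto simp: carrier_End) (simp_all add: End_def)
next
  fix U a assume U: "causal_subset U" and "a \<in> carrier (alg (net_of C Z) U)"
  then have a: "endo a (on_arr Z (past_boundary U))" by (simp add: alg_net_of carrier_End)
  note past = past_boundary_props[OF U]
  note UU = U U order.refl[of U]
  have unit: "concat_path (const_path (snd (snd \<gamma>))) \<gamma> = \<gamma>" "concat_path \<gamma> (const_path (fst \<gamma>)) = \<gamma>"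
    if "\<gamma> \<in> paths" for \<gamma>
    using that strict_2category.comp1_unit[OF strict_2category_P2, of \<gamma>] by (simp_all add: P2_simps)
  have "inclusion_region U U = id_region (past_boundary U)"
    using inclusion_region_props[OF UU] unit[OF past(1)] regions.id[OF past(1)] past(2,3)
    by (intro regions_locally_thin) (simp_all add: legs_self[OF U] id_region_def)
  then have \<phi>: "on_cell Z (inclusion_region U U) = id2 C (on_arr Z (past_boundary U))"
    using Z.map_id2[of "past_boundary U"] past by (simp add: P2_simps)
  have "on_arr Z (const_path p) = id1 C (on_obj Z p)" for p
    using Z.map_id1[of p] by (simp add: P2_simps)
  then have "whisker C (on_arr Z (right_leg U U)) a (on_arr Z (left_leg U U)) = a"
    using hcomp_unit[of a] a past by (simp add: legs_self[OF U] whisker_def endo_def Z_path)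
  then have "a \<circ>\<^sub>v on_cell Z (inclusion_region U U) = on_cell Z (inclusion_region U U) \<circ>\<^sub>v
      whisker C (on_arr Z (right_leg U U)) a (on_arr Z (left_leg U U))"
    unfolding \<phi> using a vcomp_unit[of a] by (simp add: endo_def)
  then show "incl (net_of C Z) U U a = a"
    using incl_iff[OF UU a a] by simp
next
  fix W V U a assume W: "causal_subset W" and V: "causal_subset V" and U: "causal_subset U"
    and "W \<subseteq> V" "V \<subseteq> U" and "a \<in> carrier (alg (net_of C Z) W)"
  then have a: "endo a (on_arr Z (past_boundary W))" by (simp add: alg_net_of carrier_End)
  note WV = W V \<open>W \<subseteq> V\<close> and VU = V U \<open>V \<subseteq> U\<close> and WU = W U order.trans[OF \<open>W \<subseteq> V\<close> \<open>V \<subseteq> U\<close>]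
  let ?b = "incl (net_of C Z) W V a"
  let ?c = "incl (net_of C Z) V U ?b"
  note b = incl_endo[OF WV a]
  note c = incl_endo[OF VU b]
  note legs = legs_paths[OF WV] legs_paths[OF VU] legs_paths[OF WU]
    past_boundary_props[OF W] past_boundary_props[OF V] past_boundary_props[OF U]
  define lam where "lam = (concat_path (left_leg W V) (left_leg V U),
    between (concat_path (left_leg W V) (left_leg V U)) (left_leg W U), left_leg W U)"
  define \<rho> where "\<rho> = (concat_path (right_leg V U) (right_leg W V),
    between (concat_path (right_leg V U) (right_leg W V)) (right_leg W U), right_leg W U)"
  have lam: "lam \<in> regions" "fst lam = concat_path (left_leg W V) (left_leg V U)"
      "snd (snd lam) = left_leg W U"
    and \<rho>: "\<rho> \<in> regions" "fst \<rho> = concat_path (right_leg V U) (right_leg W V)"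
      "snd (snd \<rho>) = right_leg W U"
    using legs_compose[OF W V U \<open>W \<subseteq> V\<close> \<open>V \<subseteq> U\<close>] by (simp_all add: lam_def \<rho>_def fills_def)
  let ?\<Phi> = "whisker P2 (right_leg V U) (inclusion_region W V) (left_leg V U)"
  let ?E = "hglue \<rho> (hglue (id_region (past_boundary W)) lam)"
  have \<Phi>: "?\<Phi> \<in> regions" "fst ?\<Phi> = concat_path (right_leg V U)
      (concat_path (fst (inclusion_region W V)) (left_leg V U))"
    "snd (snd ?\<Phi>) = concat_path (right_leg V U) (concat_path (past_boundary V) (left_leg V U))"
  proof -
    note incl_props = inclusion_region_props[OF WV]
    show "?\<Phi> \<in> regions"
      unfolding whisker_def P2_simps using legs incl_props
      by (intro regions.hglue regions.id) (simp_all add: hglue_def id_region_def)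
    show "fst ?\<Phi> = concat_path (right_leg V U)
        (concat_path (fst (inclusion_region W V)) (left_leg V U))"
      "snd (snd ?\<Phi>) = concat_path (right_leg V U) (concat_path (past_boundary V) (left_leg V U))"
      using incl_props(3) by (simp_all add: whisker_def P2_simps hglue_def id_region_def)
  qed
  have E: "?E \<in> regions" "fst ?E = concat_path (fst \<rho>) (concat_path (past_boundary W) (fst lam))"
    "snd (snd ?E) = concat_path (right_leg W U) (concat_path (past_boundary W) (left_leg W U))"
  proof -
    show "?E \<in> regions"
      using legs lam \<rho>
      by (intro regions.hglue regions.id) (simp_all add: hglue_def id_region_def)
    show "fst ?E = concat_path (fst \<rho>) (concat_path (past_boundary W) (fst lam))"
      "snd (snd ?E) = concat_path (right_leg W U) (concat_path (past_boundary W) (left_leg W U))"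
      using lam(3) \<rho>(3) by (simp_all add: hglue_def id_region_def)
  qed
  \<comment> \<open>Both sides have the path around \<open>W\<close> through the corners of \<open>V\<close> as source.\<close>
  have "vglue (inclusion_region V U) ?\<Phi> = vglue (inclusion_region W U) ?E"
  proof (rule regions_locally_thin)
    show "vglue (inclusion_region V U) ?\<Phi> \<in> regions" "vglue (inclusion_region W U) ?E \<in> regions"
      using \<Phi> E inclusion_region_props[OF VU] inclusion_region_props[OF WU]
      by (auto intro!: regions.vglue)
    show "fst (vglue (inclusion_region V U) ?\<Phi>) = fst (vglue (inclusion_region W U) ?E)"
      unfolding vglue_def fst_conv \<Phi>(2) E(2) lam \<rho> inclusion_region_props[OF WV]
      by (simp add: concat_path_assoc)
    show "snd (snd (vglue (inclusion_region V U) ?\<Phi>)) = snd (snd (vglue (inclusion_region W U) ?E))"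
      unfolding vglue_def snd_conv inclusion_region_props[OF VU] inclusion_region_props[OF WU] ..
  qed
  then have "on_cell Z (vglue (inclusion_region V U) ?\<Phi>) = on_cell Z (vglue (inclusion_region W U) ?E)"
    by simp
  moreover have "on_cell Z (vglue (inclusion_region V U) ?\<Phi>) =
      on_cell Z (inclusion_region V U) \<circ>\<^sub>v on_cell Z ?\<Phi>"
    using Z.map_vcomp[of "inclusion_region V U" ?\<Phi>] \<Phi> inclusion_region_props[OF VU]
    by (simp add: P2_simps)
  moreover have "on_cell Z ?\<Phi> = whisker C (on_arr Z (right_leg V U)) (on_cell Z (inclusion_region W V))
      (on_arr Z (left_leg V U))"
    using legs inclusion_region_props[OF WV] by (intro Z.map_whisker) (simp_all add: P2_simps)
  moreover have "on_cell Z (vglue (inclusion_region W U) ?E) =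
      on_cell Z (inclusion_region W U) \<circ>\<^sub>v on_cell Z ?E"
    using Z.map_vcomp[of "inclusion_region W U" ?E] E inclusion_region_props[OF WU]
    by (simp add: P2_simps)
  moreover have "on_cell Z ?E = on_cell Z \<rho> \<circ>\<^sub>h id2 C (on_arr Z (past_boundary W)) \<circ>\<^sub>h on_cell Z lam"
  proof -
    have "on_cell Z ?E = on_cell Z \<rho> \<circ>\<^sub>h on_cell Z (hglue (id_region (past_boundary W)) lam)"
      using Z.map_hcomp[of \<rho> "hglue (id_region (past_boundary W)) lam"] legs lam \<rho>
        regions.hglue[OF regions.id, of "past_boundary W" lam]
      by (simp add: P2_simps) (simp add: hglue_def id_region_def)
    also have "on_cell Z (hglue (id_region (past_boundary W)) lam) =
        on_cell Z (id_region (past_boundary W)) \<circ>\<^sub>h on_cell Z lam"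
      using Z.map_hcomp[of "id_region (past_boundary W)" lam] legs lam regions.id[of "past_boundary W"]
      by (simp add: P2_simps) (simp add: id_region_def)
    also have "on_cell Z (id_region (past_boundary W)) = id2 C (on_arr Z (past_boundary W))"
      using Z.map_id2[of "past_boundary W"] legs by (simp add: P2_simps)
    finally show ?thesis .
  qed
  ultimately have eq: "on_cell Z (inclusion_region V U) \<circ>\<^sub>v
      whisker C (on_arr Z (right_leg V U)) (on_cell Z (inclusion_region W V)) (on_arr Z (left_leg V U)) =
    on_cell Z (inclusion_region W U) \<circ>\<^sub>v
      (on_cell Z \<rho> \<circ>\<^sub>h id2 C (on_arr Z (past_boundary W)) \<circ>\<^sub>h on_cell Z lam)"
    by simp
  have "?c \<circ>\<^sub>v on_cell Z (inclusion_region W U) = on_cell Z (inclusion_region W U) \<circ>\<^sub>v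
      whisker C (on_arr Z (right_leg W U)) a (on_arr Z (left_leg W U))"
  proof (rule conjugation_compose[OF _ _ _ _ _ _ _ _ _ Z_inclusion[OF WV] Z_inclusion[OF VU]
        Z_inclusion[OF WU] _ _ _ _ _ _ eq a b c incl_eq[OF WV a] incl_eq[OF VU b]])
  qed (use legs lam \<rho> Z_region[OF lam(1)] Z_region[OF \<rho>(1)] in \<open>simp_all add: Z_path Z_concat\<close>)
  then show "?c = incl (net_of C Z) W U a"
    using incl_iff[OF WU a c] by simp
qed

section \<open>The induced equivariant structure\<close>

lemma boundary_square:
  assumes \<eta>: "pseudonatural P2 C Z (functor_comp Z (P2_map g)) \<eta>" and \<gamma>: "\<gamma> \<in> paths"
  shows "square (t_obj \<eta> (fst \<gamma>)) (t_obj \<eta> (snd (snd \<gamma>))) (on_arr Z \<gamma>) (on_arr Z (image_path g \<gamma>))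
    (t_arr \<eta> \<gamma>)"
  using pseudonatural.naturality_square[OF \<eta>, of \<gamma>] \<gamma>
  by (simp add: P2_simps functor_comp_def P2_map_def)

lemma induced_structure_eq_transport:
  "induced_structure C f g U = transport (t_obj (f g) (left_corner U)) (t_obj (f g) (right_corner U))
    (t_arr (f g) (past_boundary U))"
  by (simp add: fun_eq_iff induced_structure_def transport_def Let_def)

lemma t_arr_concat:
  assumes \<eta>: "pseudonatural P2 C Z (functor_comp Z (P2_map g)) \<eta>"
    and "\<delta> \<in> paths" "\<gamma> \<in> paths" "fst \<delta> = snd (snd \<gamma>)"
  shows "t_arr \<eta> (concat_path \<delta> \<gamma>) =
    (id2 C (on_arr Z (image_path g \<delta>)) \<circ>\<^sub>h t_arr \<eta> \<gamma>) \<circ>\<^sub>v (t_arr \<eta> \<delta> \<circ>\<^sub>h id2 C (on_arr Z \<gamma>))"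
  using pseudonatural.comp_comp1[OF \<eta>, of \<delta> \<gamma>] assms(2-4)
  by (simp add: P2_simps functor_comp_def P2_map_def)

lemma t_arr_natural:
  assumes \<eta>: "pseudonatural P2 C Z (functor_comp Z (P2_map g)) \<eta>" and "R \<in> regions"
  shows "t_arr \<eta> (snd (snd R)) \<circ>\<^sub>v (id2 C (t_obj \<eta> (snd (snd (fst R)))) \<circ>\<^sub>h on_cell Z R) =
    (on_cell Z (image_region g R) \<circ>\<^sub>h id2 C (t_obj \<eta> (fst (fst R)))) \<circ>\<^sub>v t_arr \<eta> (fst R)"
  using pseudonatural.natural[OF \<eta>, of R] assms(2)
  by (simp add: P2_simps functor_comp_def P2_map_def)

lemma boundary_square_causal:
  assumes "pseudonatural P2 C Z (functor_comp Z (P2_map g)) \<eta>" "causal_symmetry g" "causal_subset U"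
  shows "square (t_obj \<eta> (left_corner U)) (t_obj \<eta> (right_corner U)) (on_arr Z (past_boundary U))
    (on_arr Z (past_boundary (g ` U))) (t_arr \<eta> (past_boundary U))"
  using boundary_square[OF assms(1) past_boundary_props(1)[OF assms(3)]]
  by (simp add: past_boundary_props[OF assms(3)] causal_symmetry.image_past_boundary[OF assms(2,3)])

text \<open>
  The square of the path around \<open>V\<close> is pasted from the squares of the left leg, the past boundary of \<open>V\<close>
  and the right leg.  On the legs the identities are related, so the whiskered endomorphisms are related;
  replacing the rows along the region of the inclusion turns them into the images under the net.
\<close>

lemma intertwines_incl:
  assumes \<eta>: "pseudonatural P2 C Z (functor_comp Z (P2_map g)) \<eta>" and g: "causal_symmetry g"
    and VU: "causal_subset V" "causal_subset U" "V \<subseteq> U"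
    and a: "endo a (on_arr Z (past_boundary V))" and b: "endo b (on_arr Z (past_boundary (g ` V)))"
    and ab: "intertwines (t_obj \<eta> (left_corner V)) (t_obj \<eta> (right_corner V))
      (t_arr \<eta> (past_boundary V)) a b"
  shows "intertwines (t_obj \<eta> (left_corner U)) (t_obj \<eta> (right_corner U))
    (t_arr \<eta> (past_boundary U)) (incl (net_of C Z) V U a) (incl (net_of C Z) (g ` V) (g ` U) b)"
proof -
  have gVU: "causal_subset (g ` V)" "causal_subset (g ` U)" "g ` V \<subseteq> g ` U"
    using VU causal_symmetry.causal_image[OF g] by auto
  note legs = legs_paths[OF VU] and legs' = legs_paths[OF gVU]
  note past = past_boundary_props[OF VU(1)] past_boundary_props[OF VU(2)]
  note image_legs = causal_symmetry.image_legs[OF g VU]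
    causal_symmetry.image_past_boundary[OF g VU(1)]
  have squares: "square (t_obj \<eta> (left_corner U)) (t_obj \<eta> (left_corner V)) (on_arr Z (left_leg V U))
      (on_arr Z (left_leg (g ` V) (g ` U))) (t_arr \<eta> (left_leg V U))"
    "square (t_obj \<eta> (right_corner V)) (t_obj \<eta> (right_corner U)) (on_arr Z (right_leg V U))
      (on_arr Z (right_leg (g ` V) (g ` U))) (t_arr \<eta> (right_leg V U))"
    using boundary_square[OF \<eta> legs(1)] boundary_square[OF \<eta> legs(4)] by (simp_all add: legs image_legs)
  note sqV = boundary_square_causal[OF \<eta> g VU(1)]
  let ?inner = "concat_path (past_boundary V) (left_leg V U)"
  let ?outer = "concat_path (right_leg V U) ?inner"
  have inner: "?inner \<in> paths" using legs past by (simp add: concat_path_paths)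
  have t_inner: "t_arr \<eta> ?inner = (id2 C (on_arr Z (past_boundary (g ` V))) \<circ>\<^sub>h t_arr \<eta> (left_leg V U)) \<circ>\<^sub>v
      (t_arr \<eta> (past_boundary V) \<circ>\<^sub>h id2 C (on_arr Z (left_leg V U)))"
    using t_arr_concat[OF \<eta> past(1) legs(1)] legs past by (simp add: image_legs)
  have t_outer: "t_arr \<eta> ?outer =
      (id2 C (on_arr Z (right_leg (g ` V) (g ` U))) \<circ>\<^sub>h t_arr \<eta> ?inner) \<circ>\<^sub>v
      (t_arr \<eta> (right_leg V U) \<circ>\<^sub>h id2 C (on_arr Z (past_boundary V) \<cdot> on_arr Z (left_leg V U)))"
    using t_arr_concat[OF \<eta> legs(4) inner] legs past by (simp add: image_legs Z_concat)
  have lids: "endo (id2 C (on_arr Z (left_leg V U))) (on_arr Z (left_leg V U))"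
    "endo (id2 C (on_arr Z (left_leg (g ` V) (g ` U)))) (on_arr Z (left_leg (g ` V) (g ` U)))"
    using legs legs' by (auto intro!: endo_id2 Z_path)
  have rids: "endo (id2 C (on_arr Z (right_leg V U))) (on_arr Z (right_leg V U))"
    "endo (id2 C (on_arr Z (right_leg (g ` V) (g ` U)))) (on_arr Z (right_leg (g ` V) (g ` U)))"
    using legs legs' by (auto intro!: endo_id2 Z_path)
  note sq_inner = square_hpaste[OF squares(1) sqV, folded t_inner]
  have int_inner: "intertwines (t_obj \<eta> (left_corner U)) (t_obj \<eta> (right_corner V)) (t_arr \<eta> ?inner)
      (a \<circ>\<^sub>h id2 C (on_arr Z (left_leg V U))) (b \<circ>\<^sub>h id2 C (on_arr Z (left_leg (g ` V) (g ` U))))"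
    unfolding t_inner
    by (rule intertwines_hpaste[OF squares(1) sqV lids a b intertwines_id2[OF squares(1)] ab])
  have endo_inner: "endo (a \<circ>\<^sub>h id2 C (on_arr Z (left_leg V U)))
      (on_arr Z (past_boundary V) \<cdot> on_arr Z (left_leg V U))"
    "endo (b \<circ>\<^sub>h id2 C (on_arr Z (left_leg (g ` V) (g ` U))))
      (on_arr Z (past_boundary (g ` V)) \<cdot> on_arr Z (left_leg (g ` V) (g ` U)))"
    using a b legs legs' past past_boundary_props[OF gVU(1)]
    by (simp_all add: endo_def typing Z_path)
  note sq_outer = square_hpaste[OF sq_inner squares(2), folded t_outer]
  have int_outer: "intertwines (t_obj \<eta> (left_corner U)) (t_obj \<eta> (right_corner U)) (t_arr \<eta> ?outer)
      (whisker C (on_arr Z (right_leg V U)) a (on_arr Z (left_leg V U)))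
      (whisker C (on_arr Z (right_leg (g ` V) (g ` U))) b (on_arr Z (left_leg (g ` V) (g ` U))))"
    unfolding t_outer whisker_def
    by (rule intertwines_hpaste[OF sq_inner squares(2) endo_inner rids int_inner
          intertwines_id2[OF squares(2)]])
  have nat: "t_arr \<eta> (past_boundary U) \<circ>\<^sub>v
      (id2 C (t_obj \<eta> (right_corner U)) \<circ>\<^sub>h on_cell Z (inclusion_region V U)) =
    (on_cell Z (inclusion_region (g ` V) (g ` U)) \<circ>\<^sub>h id2 C (t_obj \<eta> (left_corner U))) \<circ>\<^sub>v t_arr \<eta> ?outer"
    using t_arr_natural[OF \<eta> inclusion_region_props(1)[OF VU]] inclusion_region_props[OF VU] legs
    by (simp add: causal_symmetry.image_inclusion_region[OF g VU])
  show ?thesis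
    by (rule intertwines_change_rows[OF sq_outer boundary_square_causal[OF \<eta> g VU(2)] _ _
          incl_endo[OF VU a] incl_endo[OF gVU b] Z_inclusion[OF VU] Z_inclusion[OF gVU] nat
          incl_eq[OF VU a] incl_eq[OF gVU b] int_outer])
      (use whisker_legs_endo[OF VU a] whisker_legs_endo[OF gVU b] in
        \<open>simp_all add: Z_inclusion[OF VU] Z_inclusion[OF gVU]\<close>)
qed

lemma induced_structure_iso:
  assumes \<eta>: "pseudonatural P2 C Z (functor_comp Z (P2_map g)) (f x)" and g: "causal_symmetry g"
  shows "net_isomorphism (net_of C Z) (net_pullback g (net_of C Z)) (induced_structure C f x)"
proof (rule net_isomorphism.intro)
  show "net (net_of C Z)" by (rule net_of_is_net)
  show "net (net_pullback g (net_of C Z))"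
    by (rule causal_symmetry.net_pullback_is_net[OF g net_of_is_net])
  note sq = boundary_square_causal[OF \<eta> g]
  show "net_isomorphism_axioms (net_of C Z) (net_pullback g (net_of C Z)) (induced_structure C f x)"
  proof
    fix U assume U: "causal_subset U"
    show "induced_structure C f x U \<in> iso (alg (net_of C Z) U) (alg (net_pullback g (net_of C Z)) U)"
      using transport_iso[OF sq[OF U]]
      by (simp add: net_pullback_def alg_net_of induced_structure_eq_transport)
  next
    fix V U a assume VU: "causal_subset V" "causal_subset U" "V \<subseteq> U"
      and "a \<in> carrier (alg (net_of C Z) V)"
    then have a: "endo a (on_arr Z (past_boundary V))" by (simp add: alg_net_of carrier_End)
    have gVU: "causal_subset (g ` V)" "causal_subset (g ` U)" "g ` V \<subseteq> g ` U"
      using VU causal_symmetry.causal_image[OF g] by auto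
    note r = transport_intertwines[OF sq[OF VU(1)] a, folded induced_structure_eq_transport]
    note ia = incl_endo[OF VU a]
    note ri = transport_intertwines[OF sq[OF VU(2)] ia, folded induced_structure_eq_transport]
    have "induced_structure C f x U (incl (net_of C Z) V U a) =
        incl (net_of C Z) (g ` V) (g ` U) (induced_structure C f x V a)"
      by (rule intertwines_unique_right[OF sq[OF VU(2)] ia ri(1) incl_endo[OF gVU r(1)] ri(2)
            intertwines_incl[OF \<eta> g VU a r]])
    then show "induced_structure C f x U (incl (net_of C Z) V U a) =
        incl (net_pullback g (net_of C Z)) V U (induced_structure C f x V a)"
      by (simp add: net_pullback_def)
  qed
qed

text \<open>
  Both sides are related to \<open>a\<close> by the naturality square of \<open>f (g1 \<otimes> g2)\<close>: the right-hand side by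
  definition, the left-hand side because the square of the composite transformation is stacked from those
  of \<open>f g1\<close> and \<open>f g2\<close> and then adjusted by the modification.
\<close>

lemma induced_structure_mult:
  assumes eq: "equivariant_2functor G act C Z f F"
    and g: "g1 \<in> carrier G" "g2 \<in> carrier G" and U: "causal_subset U"
    and a: "a \<in> carrier (alg (net_of C Z) U)"
  shows "induced_structure C f g2 (act g1 ` U) (induced_structure C f g1 U a) =
    induced_structure C f (g1 \<otimes>\<^bsub>G\<^esub> g2) U a"
proof -
  interpret act: causal_action G act
    using eq by (rule equivariant_2functor.axioms(1))
  note f_iso = equivariant_2functor.f_iso[OF eq]
  let ?g12 = "g1 \<otimes>\<^bsub>G\<^esub> g2" and ?p = "left_corner U" and ?q = "right_corner U" and ?\<gamma> = "past_boundary U"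
  have g12: "?g12 \<in> carrier G" using g by simp
  note sym1 = act.act_causal_symmetry[OF g(1)] and sym2 = act.act_causal_symmetry[OF g(2)]
    and sym12 = act.act_causal_symmetry[OF g12]
  note \<eta>1 = functor_isomorphism.axioms(1)[OF f_iso[OF g(1)]]
    and \<eta>2 = functor_isomorphism.axioms(1)[OF f_iso[OF g(2)]]
    and \<eta>12 = functor_isomorphism.axioms(1)[OF f_iso[OF g12]]
  have gU: "causal_subset (act g1 ` U)" using act.act_causal[OF g(1) U] .
  have image: "act g2 ` act g1 ` U = act ?g12 ` U"
    using act.act_mult[OF g] by (simp add: image_image)
  note corners = causal_symmetry.image_corners[OF sym1 U, symmetric]
  note past = past_boundary_props[OF U]
  have a: "endo a (on_arr Z ?\<gamma>)" using a by (simp add: alg_net_of carrier_End)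
  note sq1 = boundary_square_causal[OF \<eta>1 sym1 U]
    and sq2 = boundary_square_causal[OF \<eta>2 sym2 gU, unfolded image corners]
    and sq12 = boundary_square_causal[OF \<eta>12 sym12 U]
  note b = transport_intertwines[OF sq1 a, folded induced_structure_eq_transport]
  let ?b = "induced_structure C f g1 U a"
  have r2: "induced_structure C f g2 (act g1 ` U) = transport (t_obj (f g2) (act g1 ?p))
      (t_obj (f g2) (act g1 ?q)) (t_arr (f g2) (past_boundary (act g1 ` U)))"
    unfolding induced_structure_eq_transport corners ..
  note d = transport_intertwines[OF sq2 b(1), folded r2]
  note e = transport_intertwines[OF sq12 a, folded induced_structure_eq_transport]
  let ?s = "trans_comp P2 C (trans_pullback (P2_map (act g1)) (f g2)) (f g1)"
  have s: "t_arr ?s ?\<gamma> = (t_arr (f g2) (past_boundary (act g1 ` U)) \<circ>\<^sub>h\<^bsub>C\<^esub> id2 C (t_obj (f g1) ?p))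
      \<circ>\<^sub>v\<^bsub>C\<^esub> (id2 C (t_obj (f g2) (act g1 ?q)) \<circ>\<^sub>h\<^bsub>C\<^esub> t_arr (f g1) ?\<gamma>)"
    "t_obj ?s x = t_obj (f g2) (act g1 x) \<cdot>\<^bsub>C\<^esub> t_obj (f g1) x" for x
    using past causal_symmetry.image_past_boundary[OF sym1 U]
    by (simp_all add: trans_comp_def trans_pullback_def P2_map_def P2_simps)
  interpret M: invertible_modification P2 C Z "functor_comp Z (P2_map (act ?g12))" ?s "f ?g12" "F g1 g2"
    by (rule equivariant_2functor.F_mod[OF eq g])
  have M: "F g1 g2 x \<in> Cell C" "src2 C (F g1 g2 x) = t_obj (f g2) (act g1 x) \<cdot>\<^bsub>C\<^esub> t_obj (f g1) x"
    "tgt2 C (F g1 g2 x) = t_obj (f ?g12) x" for x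
    using M.component[of x] s(2)[of x] by (simp_all add: P2_simps)
  have mod: "(id2 C (on_arr Z (past_boundary (act ?g12 ` U))) \<circ>\<^sub>h\<^bsub>C\<^esub> F g1 g2 ?p) \<circ>\<^sub>v\<^bsub>C\<^esub> t_arr ?s ?\<gamma> =
      t_arr (f ?g12) ?\<gamma> \<circ>\<^sub>v\<^bsub>C\<^esub> (F g1 g2 ?q \<circ>\<^sub>h\<^bsub>C\<^esub> id2 C (on_arr Z ?\<gamma>))"
    using M.compatible[of ?\<gamma>] past causal_symmetry.image_past_boundary[OF sym12 U]
    by (simp add: P2_simps functor_comp_def P2_map_def)
  note pasted = square_vpaste[OF sq1 sq2] intertwines_vpaste[OF sq1 sq2 a b(1) d(1) b(2) d(2)]
  have "intertwines (t_obj (f ?g12) ?p) (t_obj (f ?g12) ?q) (t_arr (f ?g12) ?\<gamma>) a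
      (induced_structure C f g2 (act g1 ` U) ?b)"
    by (rule intertwines_change_columns[OF pasted(1) sq12 a d(1) M M mod[unfolded s(1)] pasted(2)])
  then show ?thesis
    by (rule intertwines_unique_right[OF sq12 a d(1) e(1) _ e(2)])
qed

end

theorem theorem3:
  fixes C :: "('o, 'm, 'c) two_category"
    and Z :: "(point, path, region, 'o, 'm, 'c) two_functor"
    and G :: "'g monoid"
    and act :: "'g \<Rightarrow> point \<Rightarrow> point"
    and f :: "'g \<Rightarrow> (point, path, 'm, 'c) transformation"
    and F :: "'g \<Rightarrow> 'g \<Rightarrow> point \<Rightarrow> 'c"
  assumes "strict_2groupoid C"
    and "strict_2functor P2 C Z"
    and "causal_action G act"
    and "equivariant_2functor G act C Z f F"
  shows "equivariant_net G act (net_of C Z) (induced_structure C f)"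
proof -
  interpret fqft C Z
    using assms(1,2) by (simp add: fqft_def)
  interpret act: causal_action G act by fact
  show ?thesis
  proof (intro equivariant_net.intro equivariant_net_axioms.intro)
    show "causal_action G act" by fact
    show "net (net_of C Z)" by (rule net_of_is_net)
    show "net_isomorphism (net_of C Z) (net_pullback (act g) (net_of C Z)) (induced_structure C f g)"
      if "g \<in> carrier G" for g
      using functor_isomorphism.axioms(1)[OF equivariant_2functor.f_iso[OF assms(4) that]]
        act.act_causal_symmetry[OF that]
      by (rule induced_structure_iso)
  qed (rule induced_structure_mult[OF assms(4)])
qed

end
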